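(* Let $\alpha,\beta\in\mathbb{K}^*$ be roots of unity with $\alpha\beta\neq1$. Suppose $\mathcal{N}$ is a simple $M_2(\alpha,\beta)$-module that is $X_{12}$-torsionfree, $X_{21}$-torsionfree and $D$-torsionfree. Then $\mathcal{N}$ is isomorphic to one of the following simple $M_2(\alpha,\beta)$-modules: (1) $\mathscr{V}_1(\underline{\mu})$ for some $\underline{\mu}=(\mu_1,\mu_2,\mu_3,\mu_4)\in(\mathbb{K}^* )^4$, if $\mathcal{N}$ is $X_{11}$-torsionfree; (2) $\mathscr{V}_2(\underline{\mu})$ for some $\underline{\mu}=(\mu_1,\mu_2,\mu_3)\in(\mathbb{K}^* )^3$, if $\mathcal{N}$ is $X_{11}$-torsion and $X_{22}$-torsionfree; (3) $\mathscr{V}_3(\underline{\mu})$ for some $\underline{\mu}=(\mu_1,\mu_2)\in(\mathbb{K}^* )^2$, if $\mathcal{N}$ is $X_{11}$-torsion and $X_{22}$-torsion.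
   Context: $\mathbb{K}$ is an algebraically closed field of arbitrary characteristic and $\mathbb{K}^*=\mathbb{K}\setminus\{0\}$; all modules are right modules. For a root of unity $\xi\in\mathbb{K}^*$, $\operatorname{ord}(\xi)$ is its order in the group $\mathbb{K}^*$. For $\alpha,\beta\in\mathbb{K}^*$, the two-parameter quantum matrix algebra $M_2(\alpha,\beta)$ is the associative unital $\mathbb{K}$-algebra generated by $X_{11},X_{12},X_{21},X_{22}$ subject to the relations $X_{12}X_{11}=\alpha X_{11}X_{12}$, $X_{22}X_{21}=\alpha X_{21}X_{22}$, $X_{21}X_{11}=\beta X_{11}X_{21}$, $X_{22}X_{12}=\beta X_{12}X_{22}$, $X_{21}X_{12}=\beta\alpha^{-1}X_{12}X_{21}$, $X_{22}X_{11}-X_{11}X_{22}=(\beta-\alpha^{-1})X_{12}X_{21}$. The quantum determinant is $D:=X_{11}X_{22}-\alpha^{-1}X_{12}X_{21}$. For an element $x$ of the algebra, a module $M$ is $x$-torsion if for every $m\in M$ there is $k\ge0$ with $mx^k=0$, and $x$-torsionfree if $mx^k=0$ for some $k\geq 0$ implies $m=0$. Set $l_1:=\operatorname{ord}(\alpha\beta)$ if $\operatorname{ord}(\beta)\mid\operatorname{ord}(\alpha\beta)\operatorname{ord}(\alpha\beta^{-1})$ and $l_1:=2\operatorname{ord}(\alpha\beta)$ otherwise; set $l_2:=\operatorname{ord}(\alpha\beta^{-1})$. Let $\oplus$ be addition modulo $l_1$ and $\dotplus$ addition modulo $l_2$. Module $\mathscr{V}_1(\underline{\mu})$, $\underline\mu\in(\mathbb{K}^*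 )^4$: the $\mathbb{K}$-space with basis $\{e(a,b):0\le a\le l_1-1,\ 0\le b\le l_2-1\}$ and action $$e(a,b)X_{11}=\mu_1\beta^b e(a\oplus1,b),$$ $$e(a,b)X_{12}=\begin{cases}\mu_2^{-1}\mu_3(\alpha^{-1}\beta)^b(\alpha\beta)^{-a}e(a,b-1)& b\neq0\\ \mu_2^{-1}\mu_3\beta^{al_2}(\alpha\beta)^{-a}e(a,l_2-1)& b=0\end{cases}$$ $$e(a,b)X_{21}=\begin{cases}\mu_2e(a,b+1)& b\neq l_2-1\\ \mu_2\beta^{-al_2}e(a,0)& b=l_2-1\end{cases}$$ $$e(a,b)X_{22}=\mu_1^{-1}\alpha^{-b}\left[\mu_4+\beta(\alpha\beta)^{-a}\mu_3\right]e(a\oplus(-1),b).$$ Module $\mathscr{V}_2(\underline{\mu})$, $\underline\mu\in(\mathbb{K}^* )^3$: the $\mathbb{K}$-space with basis $\{e(a,b):0\le a\le l_1-1,\ 0\le b\le l_2-1\}$ and action $$e(a,b)X_{11}=\begin{cases}\mu_1^{-1}\mu_3\alpha^{-1}(\alpha^{-1}\beta)^b[(\alpha\beta)^a-1]e(a-1,b)& a\neq0\\ 0& a=0\end{cases}$$ $$e(a,b)X_{12}=\mu_2^{-1}\mu_3\beta^a(\alpha^{-1}\beta)^be(a,b\dotplus(-1)),\qquad e(a,b)X_{21}=\mu_2\alpha^ae(a,b\dotplus1),$$ $$e(a,b)X_{22}=\begin{cases}\mu_1e(a+1,b)& a\neq l_1-1\\ \mu_1\alpha^{-bl_1}e(0,b)&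 a=l_1-1.\end{cases}$$ Module $\mathscr{V}_3(\underline{\mu})$, $\underline\mu\in(\mathbb{K}^* )^2$: the $\mathbb{K}$-space with basis $\{e(a,b):0\le a\le\operatorname{ord}(\alpha\beta)-1,\ 0\le b\le l_2-1\}$ and action $$e(a,b)X_{11}=\begin{cases}\mu_2\alpha^{-1}(\alpha^{-1}\beta)^b[(\alpha\beta)^a-1]e(a-1,b)& a\neq0\\ 0& a=0\end{cases}$$ $$e(a,b)X_{12}=\mu_1^{-1}\mu_2\beta^a(\alpha^{-1}\beta)^be(a,b\dotplus(-1)),\qquad e(a,b)X_{21}=\mu_1\alpha^ae(a,b\dotplus1),$$ $$e(a,b)X_{22}=\begin{cases}e(a+1,b)& a\neq\operatorname{ord}(\alpha\beta)-1\\ 0& a=\operatorname{ord}(\alpha\beta)-1.\end{cases}$$ *)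

theory Defs
  imports
    "HOL-Library.Poly_Mapping"
    "HOL-Computational_Algebra.Polynomial"
    "HOL-Algebra.Multiplicative_Group"
    "HOL-Algebra.QuotRing"
begin

section \<open>Right modules over a ring\<close>

text \<open>As for the record of modules in HOL-Algebra, the additive group of a module is stored in a
  ring record, whose fields for multiplication and one are ignored.\<close>

record ('r, 'm) rmodule = "'m ring" +
  ract :: "'m \<Rightarrow> 'r \<Rightarrow> 'm" (infixl \<open>\<star>\<index>\<close> 70)

locale right_module = R: ring R + M: abelian_group M
  for R :: "('r, 'c) ring_scheme" (structure) and M :: "('r, 'm) rmodule" (structure) +
  assumes ract_closed: "\<lbrakk>m \<in> carrier M; r \<in> carrier R\<rbrakk> \<Longrightarrow> m \<star>\<^bsub>M\<^esub> r \<in> carrier M"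
    and ract_add_left: "\<lbrakk>m \<in> carrier M; n \<in> carrier M; r \<in> carrier R\<rbrakk>
      \<Longrightarrow> (m \<oplus>\<^bsub>M\<^esub> n) \<star>\<^bsub>M\<^esub> r = (m \<star>\<^bsub>M\<^esub> r) \<oplus>\<^bsub>M\<^esub> (n \<star>\<^bsub>M\<^esub> r)"
    and ract_add_right: "\<lbrakk>m \<in> carrier M; r \<in> carrier R; s \<in> carrier R\<rbrakk>
      \<Longrightarrow> m \<star>\<^bsub>M\<^esub> (r \<oplus>\<^bsub>R\<^esub> s) = (m \<star>\<^bsub>M\<^esub> r) \<oplus>\<^bsub>M\<^esub> (m \<star>\<^bsub>M\<^esub> s)"
    and ract_mult: "\<lbrakk>m \<in> carrier M; r \<in> carrier R; s \<in> carrier R\<rbrakk>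
      \<Longrightarrow> m \<star>\<^bsub>M\<^esub> (r \<otimes>\<^bsub>R\<^esub> s) = (m \<star>\<^bsub>M\<^esub> r) \<star>\<^bsub>M\<^esub> s"
    and ract_one: "m \<in> carrier M \<Longrightarrow> m \<star>\<^bsub>M\<^esub> \<one>\<^bsub>R\<^esub> = m"

definition right_submodule ::
    "('r, 'c) ring_scheme \<Rightarrow> ('r, 'm) rmodule \<Rightarrow> 'm set \<Rightarrow> bool" where
  "right_submodule R M U \<longleftrightarrow>
     subgroup U (add_monoid M) \<and> (\<forall>u\<in>U. \<forall>r\<in>carrier R. u \<star>\<^bsub>M\<^esub> r \<in> U)"

definition simple_right_module :: "('r, 'c) ring_scheme \<Rightarrow> ('r, 'm) rmodule \<Rightarrow> bool" where
  "simple_right_module R M \<longleftrightarrow>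
     right_module R M \<and> carrier M \<noteq> {\<zero>\<^bsub>M\<^esub>} \<and>
     (\<forall>U. right_submodule R M U \<longrightarrow> U = {\<zero>\<^bsub>M\<^esub>} \<or> U = carrier M)"

definition right_module_iso ::
    "('r, 'c) ring_scheme \<Rightarrow> ('r, 'm) rmodule \<Rightarrow> ('r, 'n) rmodule \<Rightarrow> bool" where
  "right_module_iso R M N \<longleftrightarrow>
     (\<exists>f. bij_betw f (carrier M) (carrier N) \<and>
          (\<forall>m\<in>carrier M. \<forall>m'\<in>carrier M. f (m \<oplus>\<^bsub>M\<^esub> m') = f m \<oplus>\<^bsub>N\<^esub> f m') \<and>
          (\<forall>m\<in>carrier M. \<forall>r\<in>carrier R. f (m \<star>\<^bsub>M\<^esub> r) = f m \<star>\<^bsub>N\<^esub> r))"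

definition torsion :: "('r, 'c) ring_scheme \<Rightarrow> ('r, 'm) rmodule \<Rightarrow> 'r \<Rightarrow> bool" where
  "torsion R M x \<longleftrightarrow> (\<forall>m\<in>carrier M. \<exists>k::nat. m \<star>\<^bsub>M\<^esub> (x [^]\<^bsub>R\<^esub> k) = \<zero>\<^bsub>M\<^esub>)"

definition torsionfree :: "('r, 'c) ring_scheme \<Rightarrow> ('r, 'm) rmodule \<Rightarrow> 'r \<Rightarrow> bool" where
  "torsionfree R M x \<longleftrightarrow>
     (\<forall>m\<in>carrier M. (\<exists>k::nat. m \<star>\<^bsub>M\<^esub> (x [^]\<^bsub>R\<^esub> k) = \<zero>\<^bsub>M\<^esub>) \<longrightarrow> m = \<zero>\<^bsub>M\<^esub>)"


section \<open>The two-parameter quantum matrix algebra\<close>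

datatype gen = X11 | X12 | X21 | X22

datatype word = Word (letters: "gen list")

instantiation word :: monoid_add
begin
definition zero_word :: word where "zero_word = Word []"
definition plus_word :: "word \<Rightarrow> word \<Rightarrow> word" where
  "plus_word u v = Word (letters u @ letters v)"
instance by standard (simp_all add: zero_word_def plus_word_def)
end

text \<open>Since words form a monoid under concatenation, the convolution product of
  \<^typ>\<open>word \<Rightarrow>\<^sub>0 'k::field\<close> makes it the free algebra on the four generators.\<close>

type_synonym 'k falg = "word \<Rightarrow>\<^sub>0 'k"

definition fvar :: "gen \<Rightarrow> 'k::field falg" where
  "fvar g = Poly_Mapping.single (Word [g]) 1"

definition fconst :: "'k \<Rightarrow> 'k::field falg" where
  "fconst c = Poly_Mapping.single 0 c"

definition ring_of_type :: "'a::ring_1 ring" where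
  "ring_of_type = \<lparr>carrier = UNIV, mult = (*), one = 1, zero = 0, add = (+)\<rparr>"

definition M2_relations :: "'k::field \<Rightarrow> 'k \<Rightarrow> 'k falg set" where
  "M2_relations \<alpha> \<beta> =
    {fvar X12 * fvar X11 - fconst \<alpha> * fvar X11 * fvar X12,
     fvar X22 * fvar X21 - fconst \<alpha> * fvar X21 * fvar X22,
     fvar X21 * fvar X11 - fconst \<beta> * fvar X11 * fvar X21,
     fvar X22 * fvar X12 - fconst \<beta> * fvar X12 * fvar X22,
     fvar X21 * fvar X12 - fconst (\<beta> * inverse \<alpha>) * fvar X12 * fvar X21,
     fvar X22 * fvar X11 - fvar X11 * fvar X22
       - fconst (\<beta> - inverse \<alpha>) * fvar X12 * fvar X21}"

definition M2_ideal :: "'k::field \<Rightarrow> 'k \<Rightarrow> 'k falg set" where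
  "M2_ideal \<alpha> \<beta> = Idl\<^bsub>ring_of_type\<^esub> (M2_relations \<alpha> \<beta>)"

text \<open>The base field is contained in the algebra as the classes of the constants, so a right
  module over this ring carries its vector space structure, and maps that are linear over this
  ring are linear over the base field.\<close>

definition M2 :: "'k::field \<Rightarrow> 'k \<Rightarrow> 'k falg set ring" where
  "M2 \<alpha> \<beta> = ring_of_type Quot M2_ideal \<alpha> \<beta>"

definition M2_class :: "'k::field \<Rightarrow> 'k \<Rightarrow> 'k falg \<Rightarrow> 'k falg set" where
  "M2_class \<alpha> \<beta> f = M2_ideal \<alpha> \<beta> +>\<^bsub>ring_of_type\<^esub> f"

definition M2_gen :: "'k::field \<Rightarrow> 'k \<Rightarrow> gen \<Rightarrow> 'k falg set" where
  "M2_gen \<alpha> \<beta> g = M2_class \<alpha> \<beta> (fvar g)"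

definition M2_det :: "'k::field \<Rightarrow> 'k \<Rightarrow> 'k falg set" where
  "M2_det \<alpha> \<beta> =
     M2_class \<alpha> \<beta> (fvar X11 * fvar X22 - fconst (inverse \<alpha>) * fvar X12 * fvar X21)"


section \<open>Modules given by the action of the generators on a basis\<close>

type_synonym 'k vec = "nat \<times> nat \<Rightarrow>\<^sub>0 'k"

abbreviation e_vec :: "'k::zero \<Rightarrow> nat \<times> nat \<Rightarrow> 'k vec" where
  "e_vec c p \<equiv> Poly_Mapping.single p c"

definition vscale :: "'k::field \<Rightarrow> 'k vec \<Rightarrow> 'k vec" where
  "vscale c v = Poly_Mapping.map ((*) c) v"

definition lin_ext :: "(nat \<times> nat \<Rightarrow> 'k::field vec) \<Rightarrow> 'k vec \<Rightarrow> 'k vec" where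
  "lin_ext T v = (\<Sum>p\<in>Poly_Mapping.keys v. vscale (Poly_Mapping.lookup v p) (T p))"

text \<open>As the action is from the right, the first letter of a word acts first.\<close>

definition word_act :: "(gen \<Rightarrow> nat \<times> nat \<Rightarrow> 'k::field vec) \<Rightarrow> word \<Rightarrow> 'k vec \<Rightarrow> 'k vec" where
  "word_act T w v = fold (\<lambda>g. lin_ext (T g)) (letters w) v"

definition falg_act :: "(gen \<Rightarrow> nat \<times> nat \<Rightarrow> 'k::field vec) \<Rightarrow> 'k falg \<Rightarrow> 'k vec \<Rightarrow> 'k vec" where
  "falg_act T f v =
     (\<Sum>w\<in>Poly_Mapping.keys f. vscale (Poly_Mapping.lookup f w) (word_act T w v))"

text \<open>Elements of the quantum matrix algebra are residue classes of the free algebra; they act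
  through an arbitrary representative. The result is a module over the quantum matrix algebra
  only if the operators \<open>T\<close> satisfy the defining relations; this is not built into the
  definition but part of the predicate \<^const>\<open>right_module\<close>.\<close>

definition basis_module ::
    "nat \<Rightarrow> nat \<Rightarrow> (gen \<Rightarrow> nat \<times> nat \<Rightarrow> 'k::field vec) \<Rightarrow> ('k falg set, 'k vec) rmodule" where
  "basis_module n1 n2 T =
     \<lparr>carrier = {v. Poly_Mapping.keys v \<subseteq> {..<n1} \<times> {..<n2}},
      mult = undefined, one = undefined, zero = 0, add = (+),
      ract = (\<lambda>v C. falg_act T (SOME f. f \<in> C) v)\<rparr>"

definition mult_ord :: "'k::field \<Rightarrow> nat" where
  "mult_ord \<xi> = group.ord (units_of ring_of_type) \<xi>"

definition l1 :: "'k::field \<Rightarrow> 'k \<Rightarrow> nat" where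
  "l1 \<alpha> \<beta> =
     (if mult_ord \<beta> dvd mult_ord (\<alpha> * \<beta>) * mult_ord (\<alpha> * inverse \<beta>)
      then mult_ord (\<alpha> * \<beta>) else 2 * mult_ord (\<alpha> * \<beta>))"

definition l2 :: "'k::field \<Rightarrow> 'k \<Rightarrow> nat" where
  "l2 \<alpha> \<beta> = mult_ord (\<alpha> * inverse \<beta>)"

text \<open>Adding \<open>-1\<close> modulo \<open>l\<close> is rendered in the naturals as adding \<open>l - 1\<close> modulo \<open>l\<close>, and
  negative powers are written as powers of inverses.\<close>

fun V1_action :: "'k::field \<Rightarrow> 'k \<Rightarrow> 'k \<Rightarrow> 'k \<Rightarrow> 'k \<Rightarrow> 'k \<Rightarrow> gen \<Rightarrow> nat \<times> nat \<Rightarrow> 'k vec" where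
  "V1_action \<alpha> \<beta> \<mu>1 \<mu>2 \<mu>3 \<mu>4 X11 (a, b) =
     e_vec (\<mu>1 * \<beta> ^ b) ((a + 1) mod l1 \<alpha> \<beta>, b)"
| "V1_action \<alpha> \<beta> \<mu>1 \<mu>2 \<mu>3 \<mu>4 X12 (a, b) =
     (if b \<noteq> 0
      then e_vec (inverse \<mu>2 * \<mu>3 * (inverse \<alpha> * \<beta>) ^ b * inverse (\<alpha> * \<beta>) ^ a) (a, b - 1)
      else e_vec (inverse \<mu>2 * \<mu>3 * \<beta> ^ (a * l2 \<alpha> \<beta>) * inverse (\<alpha> * \<beta>) ^ a)
             (a, l2 \<alpha> \<beta> - 1))"
| "V1_action \<alpha> \<beta> \<mu>1 \<mu>2 \<mu>3 \<mu>4 X21 (a, b) =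
     (if b \<noteq> l2 \<alpha> \<beta> - 1
      then e_vec \<mu>2 (a, b + 1)
      else e_vec (\<mu>2 * inverse \<beta> ^ (a * l2 \<alpha> \<beta>)) (a, 0))"
| "V1_action \<alpha> \<beta> \<mu>1 \<mu>2 \<mu>3 \<mu>4 X22 (a, b) =
     e_vec (inverse \<mu>1 * inverse \<alpha> ^ b * (\<mu>4 + \<beta> * inverse (\<alpha> * \<beta>) ^ a * \<mu>3))
       ((a + (l1 \<alpha> \<beta> - 1)) mod l1 \<alpha> \<beta>, b)"

definition V1 :: "'k::field \<Rightarrow> 'k \<Rightarrow> 'k \<Rightarrow> 'k \<Rightarrow> 'k \<Rightarrow> 'k \<Rightarrow> ('k falg set, 'k vec) rmodule" where
  "V1 \<alpha> \<beta> \<mu>1 \<mu>2 \<mu>3 \<mu>4 =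
     basis_module (l1 \<alpha> \<beta>) (l2 \<alpha> \<beta>) (V1_action \<alpha> \<beta> \<mu>1 \<mu>2 \<mu>3 \<mu>4)"

fun V2_action :: "'k::field \<Rightarrow> 'k \<Rightarrow> 'k \<Rightarrow> 'k \<Rightarrow> 'k \<Rightarrow> gen \<Rightarrow> nat \<times> nat \<Rightarrow> 'k vec" where
  "V2_action \<alpha> \<beta> \<mu>1 \<mu>2 \<mu>3 X11 (a, b) =
     (if a \<noteq> 0
      then e_vec (inverse \<mu>1 * \<mu>3 * inverse \<alpha> * (inverse \<alpha> * \<beta>) ^ b * ((\<alpha> * \<beta>) ^ a - 1)) (a - 1, b)
      else 0)"
| "V2_action \<alpha> \<beta> \<mu>1 \<mu>2 \<mu>3 X12 (a, b) =
     e_vec (inverse \<mu>2 * \<mu>3 * \<beta> ^ a * (inverse \<alpha> * \<beta>) ^ b)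
       (a, (b + (l2 \<alpha> \<beta> - 1)) mod l2 \<alpha> \<beta>)"
| "V2_action \<alpha> \<beta> \<mu>1 \<mu>2 \<mu>3 X21 (a, b) =
     e_vec (\<mu>2 * \<alpha> ^ a) (a, (b + 1) mod l2 \<alpha> \<beta>)"
| "V2_action \<alpha> \<beta> \<mu>1 \<mu>2 \<mu>3 X22 (a, b) =
     (if a \<noteq> l1 \<alpha> \<beta> - 1
      then e_vec \<mu>1 (a + 1, b)
      else e_vec (\<mu>1 * inverse \<alpha> ^ (b * l1 \<alpha> \<beta>)) (0, b))"

definition V2 :: "'k::field \<Rightarrow> 'k \<Rightarrow> 'k \<Rightarrow> 'k \<Rightarrow> 'k \<Rightarrow> ('k falg set, 'k vec) rmodule" where
  "V2 \<alpha> \<beta> \<mu>1 \<mu>2 \<mu>3 = basis_module (l1 \<alpha> \<beta>) (l2 \<alpha> \<beta>) (V2_action \<alpha> \<beta> \<mu>1 \<mu>2 \<mu>3)"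

fun V3_action :: "'k::field \<Rightarrow> 'k \<Rightarrow> 'k \<Rightarrow> 'k \<Rightarrow> gen \<Rightarrow> nat \<times> nat \<Rightarrow> 'k vec" where
  "V3_action \<alpha> \<beta> \<mu>1 \<mu>2 X11 (a, b) =
     (if a \<noteq> 0
      then e_vec (\<mu>2 * inverse \<alpha> * (inverse \<alpha> * \<beta>) ^ b * ((\<alpha> * \<beta>) ^ a - 1)) (a - 1, b)
      else 0)"
| "V3_action \<alpha> \<beta> \<mu>1 \<mu>2 X12 (a, b) =
     e_vec (inverse \<mu>1 * \<mu>2 * \<beta> ^ a * (inverse \<alpha> * \<beta>) ^ b)
       (a, (b + (l2 \<alpha> \<beta> - 1)) mod l2 \<alpha> \<beta>)"
| "V3_action \<alpha> \<beta> \<mu>1 \<mu>2 X21 (a, b) =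
     e_vec (\<mu>1 * \<alpha> ^ a) (a, (b + 1) mod l2 \<alpha> \<beta>)"
| "V3_action \<alpha> \<beta> \<mu>1 \<mu>2 X22 (a, b) =
     (if a \<noteq> mult_ord (\<alpha> * \<beta>) - 1 then e_vec 1 (a + 1, b) else 0)"

definition V3 :: "'k::field \<Rightarrow> 'k \<Rightarrow> 'k \<Rightarrow> 'k \<Rightarrow> ('k falg set, 'k vec) rmodule" where
  "V3 \<alpha> \<beta> \<mu>1 \<mu>2 =
     basis_module (mult_ord (\<alpha> * \<beta>)) (l2 \<alpha> \<beta>) (V3_action \<alpha> \<beta> \<mu>1 \<mu>2)"

definition iso_to_V1 :: "'k::field \<Rightarrow> 'k \<Rightarrow> ('k falg set, 'n) rmodule \<Rightarrow> bool" where
  "iso_to_V1 \<alpha> \<beta> N \<longleftrightarrow>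
     (\<exists>\<mu>1 \<mu>2 \<mu>3 \<mu>4. \<mu>1 \<noteq> 0 \<and> \<mu>2 \<noteq> 0 \<and> \<mu>3 \<noteq> 0 \<and> \<mu>4 \<noteq> 0 \<and>
        right_module_iso (M2 \<alpha> \<beta>) N (V1 \<alpha> \<beta> \<mu>1 \<mu>2 \<mu>3 \<mu>4))"

definition iso_to_V2 :: "'k::field \<Rightarrow> 'k \<Rightarrow> ('k falg set, 'n) rmodule \<Rightarrow> bool" where
  "iso_to_V2 \<alpha> \<beta> N \<longleftrightarrow>
     (\<exists>\<mu>1 \<mu>2 \<mu>3. \<mu>1 \<noteq> 0 \<and> \<mu>2 \<noteq> 0 \<and> \<mu>3 \<noteq> 0 \<and>
        right_module_iso (M2 \<alpha> \<beta>) N (V2 \<alpha> \<beta> \<mu>1 \<mu>2 \<mu>3))"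

definition iso_to_V3 :: "'k::field \<Rightarrow> 'k \<Rightarrow> ('k falg set, 'n) rmodule \<Rightarrow> bool" where
  "iso_to_V3 \<alpha> \<beta> N \<longleftrightarrow>
     (\<exists>\<mu>1 \<mu>2. \<mu>1 \<noteq> 0 \<and> \<mu>2 \<noteq> 0 \<and> right_module_iso (M2 \<alpha> \<beta>) N (V3 \<alpha> \<beta> \<mu>1 \<mu>2))"

end

theory Submission
  imports Defs
begin

text \<open>Let \<open>l = ord (\<alpha>\<beta>)\<close>, let \<open>D\<close> be the quantum determinant and \<open>Y = X12 X21\<close>. The elements
  \<open>X12\<close>, \<open>X21\<close>, \<open>D\<close>, \<open>X11\<^sup>l\<close> and \<open>X22\<^sup>l\<close> commute with the generators up to scalars, so on a
  simple module each of them is zero or injective; moreover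
  \<open>X11 X22 = D + \<alpha>\<^sup>-\<^sup>1 Y\<close> and \<open>X22 X11 = D + \<beta> Y\<close>. If \<open>\<alpha>\<^sup>n = \<beta>\<^sup>n = 1\<close>, then
  \<open>X12\<^sup>n\<close>, \<open>X21\<^sup>n\<close>, \<open>D\<^sup>n\<close>, \<open>X11\<^sup>n\<close> and \<open>X22\<^sup>n\<close> are central, and up to inverting one of them the
  module is finitely generated over the ring of polynomials in four of them. By Zariski's lemma they
  act by scalars. Hence the commuting elements \<open>D\<close>, \<open>Y\<close>, \<open>X11\<^sup>l\<^sup>1\<close>, \<open>X21\<^sup>l\<^sup>2\<close> have a common
  eigenvector or, when \<open>X11\<close> is not injective, \<open>Y\<close>, \<open>X22\<^sup>l\<^sup>1\<close>, \<open>X21\<^sup>l\<^sup>2\<close> have one in the kernel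
  of \<open>X11\<close>. Applying powers of \<open>X11\<close> and \<open>X21\<close>, respectively of \<open>X22\<close> and \<open>X21\<close>, to it gives a
  nonzero homomorphism from one of the explicit modules, which is bijective by Schur's lemma.\<close>

section \<open>Localised finite generation\<close>

text \<open>Nothing bounds the size of \<open>N\<close> in advance and the field may be countable,
  so scalars cannot come from a cardinality argument; finite dimension is an outcome. What is
  available is finite generation over a commutative ring. The polynomial ring is built one variable
  at a time as an iterated \<open>poly\<close>, so that the one-variable step is proved once, over
  any integral domain. That domain does not act faithfully: being zero becomes \<open>kills\<close>,
  and Schur's lemma becomes \<open>kills_or_bij\<close>.

  The case split on \<open>X11\<close> is forced by \<open>X22\<close>. Monomials in
  \<open>X12\<close>, \<open>X21\<close>, \<open>D\<close>, \<open>X11\<close> applied to one vector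
  span a space that need not be stable under \<open>X22\<close>, but a power of \<open>X11\<close>
  leads back into it; hence the localisation. If \<open>X11\<close> kills a vector, monomials in
  \<open>X12\<close>, \<open>X21\<close>, \<open>X22\<close> suffice without it.

  The exponents come from commutation: \<open>X11^l\<close> commutes with \<open>X22\<close>, but
  \<open>X11^l1\<close> must also commute with \<open>X21^l2\<close>, that is \<beta>^(l1 l2) = 1,
  and this is why \<open>l1\<close> may be twice \<open>l\<close>.\<close>

locale ring_action = abelian_group M for M :: "('m, 'x) ring_scheme" (structure) +
  fixes act :: "'m \<Rightarrow> 'r::ring_1 \<Rightarrow> 'm" (infixl \<open>\<bullet>\<close> 70)
  assumes act_closed [simp, intro]: "m \<in> carrier M \<Longrightarrow> m \<bullet> r \<in> carrier M"
    and add_act: "\<lbrakk>m \<in> carrier M; n \<in> carrier M\<rbrakk> \<Longrightarrow> (m \<oplus> n) \<bullet> r = m \<bullet> r \<oplus> n \<bullet> r"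
    and act_add: "m \<in> carrier M \<Longrightarrow> m \<bullet> (r + s) = m \<bullet> r \<oplus> m \<bullet> s"
    and act_mult: "m \<in> carrier M \<Longrightarrow> m \<bullet> (r * s) = m \<bullet> r \<bullet> s"
    and act_one [simp]: "m \<in> carrier M \<Longrightarrow> m \<bullet> 1 = m"
begin

lemma zero_act [simp]: "\<zero> \<bullet> r = \<zero>"
proof -
  have "\<zero> \<bullet> r \<oplus> \<zero> \<bullet> r = \<zero> \<bullet> r"
    using add_act[of \<zero> \<zero> r] by simp
  then show ?thesis by (simp add: add.l_cancel_one')
qed

lemma act_zero [simp]:
  assumes "m \<in> carrier M" shows "m \<bullet> 0 = \<zero>"
proof -
  have "m \<bullet> 0 \<oplus> m \<bullet> 0 = m \<bullet> 0"
    using act_add[of m 0 0] assms by simp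
  then show ?thesis using assms by (simp add: add.l_cancel_one')
qed

lemma act_uminus:
  assumes "m \<in> carrier M" shows "m \<bullet> (- r) = \<ominus> (m \<bullet> r)"
proof -
  have "m \<bullet> (- r) \<oplus> m \<bullet> r = \<zero>"
    using act_add[of m "- r" r] assms by simp
  then show ?thesis using assms by (simp add: minus_equality)
qed

lemma act_diff: "m \<in> carrier M \<Longrightarrow> m \<bullet> (r - s) = m \<bullet> r \<ominus> m \<bullet> s"
  using act_add[of m r "- s"] by (simp add: act_uminus minus_eq)

lemma uminus_act:
  assumes "m \<in> carrier M" shows "(\<ominus> m) \<bullet> r = \<ominus> (m \<bullet> r)"
proof -
  have "(\<ominus> m) \<bullet> r \<oplus> m \<bullet> r = \<zero>"
    using add_act[of "\<ominus> m" m r] assms by (simp add: l_neg)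
  then show ?thesis using assms by (simp add: minus_equality)
qed

lemma diff_act: "\<lbrakk>m \<in> carrier M; n \<in> carrier M\<rbrakk> \<Longrightarrow> (m \<ominus> n) \<bullet> r = m \<bullet> r \<ominus> n \<bullet> r"
  by (simp add: minus_eq add_act uminus_act)

lemma eq_iff_diff_zero:
  assumes "m \<in> carrier M" "n \<in> carrier M" shows "m = n \<longleftrightarrow> m \<ominus> n = \<zero>"
proof
  assume "m \<ominus> n = \<zero>"
  then have "m \<ominus> n \<oplus> n = n" using assms by simp
  then show "m = n" using assms by (simp add: minus_eq a_assoc l_neg)
qed (use assms in \<open>simp add: minus_eq r_neg\<close>)

lemma add_diff_cancel:
  assumes "m \<in> carrier M" "n \<in> carrier M" shows "m \<oplus> n \<ominus> m = n"
  using assms a_lcomm[of "\<ominus> m" m n] by (simp add: minus_eq a_comm r_neg1)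

lemma act_eq_iff: "m \<in> carrier M \<Longrightarrow> m \<bullet> r = m \<bullet> s \<longleftrightarrow> m \<bullet> (r - s) = \<zero>"
  using eq_iff_diff_zero[of "m \<bullet> r" "m \<bullet> s"] by (simp add: act_diff)

text \<open>Membership in the annihilator. It takes the place of \<open>r = 0\<close> throughout,
  because congruence modulo the annihilator is all that the action can see.\<close>

definition kills :: "'r \<Rightarrow> bool" where
  "kills r \<longleftrightarrow> (\<forall>m\<in>carrier M. m \<bullet> r = \<zero>)"

text \<open>Schur's lemma as a property of the action: each ring element acts as zero or invertibly.
  The inverse map need not come from the ring; up to denominators it will, once finite generation is
  known.\<close>

definition kills_or_bij :: bool where
  "kills_or_bij \<longleftrightarrow> (\<forall>r. kills r \<or> bij_betw (\<lambda>m. m \<bullet> r) (carrier M) (carrier M))"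

inductive_set span :: "'m set \<Rightarrow> 'm set" for S where
  span_zero: "\<zero> \<in> span S"
| span_step: "\<lbrakk>s \<in> S; m \<in> span S\<rbrakk> \<Longrightarrow> s \<bullet> r \<oplus> m \<in> span S"

text \<open>Finite generation of the module over the ring with \<open>b\<close> inverted, phrased by
  clearing denominators so that no localised ring has to be formed.\<close>

definition loc_fg :: bool where
  "loc_fg \<longleftrightarrow> (\<exists>b S. \<not> kills b \<and> finite S \<and> S \<subseteq> carrier M \<and>
     (\<forall>m\<in>carrier M. \<exists>k::nat. m \<bullet> b ^ k \<in> span S))"

lemma span_closed: "m \<in> span S \<Longrightarrow> S \<subseteq> carrier M \<Longrightarrow> m \<in> carrier M"
  by (induction rule: span.induct) auto

lemma span_add:
  assumes "m \<in> span S" "n \<in> span S" "S \<subseteq> carrier M" shows "m \<oplus> n \<in> span S"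
  using assms
proof (induction rule: span.induct)
  case (span_step s m r)
  then have "s \<bullet> r \<oplus> m \<oplus> n = s \<bullet> r \<oplus> (m \<oplus> n)"
    using span_closed by (subst a_assoc) auto
  then show ?case using span_step by (simp add: span.span_step)
qed (use span_closed in auto)

lemma span_base: "s \<in> S \<Longrightarrow> S \<subseteq> carrier M \<Longrightarrow> s \<in> span S"
  using span_step[of s S \<zero> 1] span_zero by (simp add: subset_iff)

lemma span_base_act: "s \<in> S \<Longrightarrow> S \<subseteq> carrier M \<Longrightarrow> s \<bullet> r \<in> span S"
  using span_step[of s S \<zero> r] span_zero by (simp add: subset_iff)

lemma span_image:
  assumes m: "m \<in> span S" and "S \<subseteq> carrier M"
    and add: "\<And>m n. m \<in> carrier M \<Longrightarrow> n \<in> carrier M \<Longrightarrow> h (m \<oplus> n) = h m \<oplus> h n"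
    and zero: "h \<zero> = \<zero>"
    and "T \<subseteq> carrier M"
    and base: "\<And>s r. s \<in> S \<Longrightarrow> h (s \<bullet> r) \<in> span T"
  shows "h m \<in> span T"
  using m assms(2)
proof (induction rule: span.induct)
  case span_zero
  then show ?case by (simp add: zero span.span_zero)
next
  case (span_step s m r)
  then have "h (s \<bullet> r \<oplus> m) = h (s \<bullet> r) \<oplus> h m"
    using span_closed by (intro add) auto
  then show ?case using span_step base[of s r] span_add assms(5) by auto
qed

lemma span_insert:
  assumes "m \<in> span (insert t S)" "insert t S \<subseteq> carrier M"
  shows "\<exists>r m'. m' \<in> span S \<and> m = t \<bullet> r \<oplus> m'"
  using assms
proof (induction rule: span.induct)
  case span_zero
  then show ?case by (intro exI[of _ 0] exI[of _ \<zero>]) (auto intro: span.span_zero)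
next
  case (span_step s m r)
  then obtain r' m' where m': "m' \<in> span S" "m = t \<bullet> r' \<oplus> m'" by auto
  have cl: "m' \<in> carrier M" "t \<in> carrier M" "s \<in> carrier M"
    using m' span_step span_closed by auto
  show ?case
  proof (cases "s = t")
    case True
    then have "s \<bullet> r \<oplus> m = t \<bullet> (r + r') \<oplus> m'"
      using cl m' by (simp add: act_add a_assoc)
    then show ?thesis using m' by blast
  next
    case False
    then have "s \<bullet> r \<oplus> m' \<in> span S" using span_step m' by (auto intro: span.span_step)
    moreover have "s \<bullet> r \<oplus> m = t \<bullet> r' \<oplus> (s \<bullet> r \<oplus> m')"
      using cl m' by (simp add: a_lcomm)
    ultimately show ?thesis by blast
  qed
qed

end

section \<open>Commutative actions satisfying Schur's lemma, and minimal generating sets\<close>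

locale comm_ring_action = ring_action M act for M :: "('m, 'x) ring_scheme" (structure) and act :: "'m \<Rightarrow> 'r::comm_ring_1 \<Rightarrow> 'm" (infixl \<open>\<bullet>\<close> 70)
begin

lemma act_commute: "m \<in> carrier M \<Longrightarrow> m \<bullet> r \<bullet> s = m \<bullet> s \<bullet> r"
  by (metis act_mult mult.commute)

lemma span_act:
  assumes "m \<in> span S" "S \<subseteq> carrier M" shows "m \<bullet> r \<in> span S"
proof (rule span_image[OF assms])
  show "s \<bullet> r' \<bullet> r \<in> span S" if "s \<in> S" for s r'
    using span_base_act[OF that assms(2), of "r' * r"] subsetD[OF assms(2) that] by (simp add: act_mult)
qed (use assms in \<open>auto simp: add_act\<close>)

lemma not_kills_surj:
  assumes kills_or_bij "\<not> kills r" "m \<in> carrier M"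
  obtains n where "n \<in> carrier M" "m = n \<bullet> r"
proof -
  have "bij_betw (\<lambda>m. m \<bullet> r) (carrier M) (carrier M)"
    using assms(1,2) unfolding kills_or_bij_def by blast
  then have "m \<in> (\<lambda>m. m \<bullet> r) ` carrier M" using assms(3) by (simp add: bij_betw_imp_surj_on)
  then show ?thesis using that by auto
qed

lemma not_kills_inj:
  assumes kills_or_bij "\<not> kills r" "m \<in> carrier M" "m \<bullet> r = \<zero>"
  shows "m = \<zero>"
proof -
  have "bij_betw (\<lambda>m. m \<bullet> r) (carrier M) (carrier M)"
    using assms(1,2) unfolding kills_or_bij_def by blast
  then have "inj_on (\<lambda>m. m \<bullet> r) (carrier M)" by (simp add: bij_betw_def)
  then show ?thesis by (rule inj_onD) (use assms(3,4) in simp_all)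
qed

text \<open>The annihilator is a prime ideal: since \<open>r\<close> is surjective, a vector that
  \<open>s\<close> does not kill is of the form \<open>n \<bullet> r\<close>, and
  \<open>r * s\<close> does not kill \<open>n\<close>.\<close>

lemma not_kills_mult:
  assumes kills_or_bij "\<not> kills r" "\<not> kills s" shows "\<not> kills (r * s)"
proof -
  obtain m where m: "m \<in> carrier M" "m \<bullet> s \<noteq> \<zero>" using assms(3) kills_def by auto
  obtain n where "n \<in> carrier M" "m = n \<bullet> r"
    using not_kills_surj[OF assms(1,2) m(1)] .
  then have "n \<in> carrier M" "n \<bullet> (r * s) \<noteq> \<zero>" using m by (simp_all add: act_mult)
  then show ?thesis unfolding kills_def by blast
qed

lemma not_kills_one:
  assumes "\<not> kills r" shows "\<not> kills 1"
proof -
  obtain m where "m \<in> carrier M" "m \<bullet> r \<noteq> \<zero>" using assms kills_def by auto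
  then have "m \<in> carrier M" "m \<bullet> 1 \<noteq> \<zero>" by auto
  then show ?thesis unfolding kills_def by blast
qed

lemma not_kills_power:
  assumes kills_or_bij "\<not> kills r" shows "\<not> kills (r ^ k)"
proof (induction k)
  case 0
  then show ?case using assms not_kills_one by simp
next
  case (Suc k)
  then show ?case using not_kills_mult[OF assms] by simp
qed

lemma kills_mult: "kills r \<Longrightarrow> kills (r * s)"
  unfolding kills_def by (simp add: act_mult)

lemma kills_mult': "kills r \<Longrightarrow> kills (s * r)"
  unfolding kills_def by (simp add: act_mult)

lemma kills_diff: "kills r \<Longrightarrow> kills s \<Longrightarrow> kills (r - s)"
  unfolding kills_def by (simp add: act_diff minus_eq)

lemma kills_add: "kills r \<Longrightarrow> kills s \<Longrightarrow> kills (r + s)"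
  unfolding kills_def by (simp add: act_add)

lemma kills_zero: "kills 0"
  unfolding kills_def by simp

lemma not_kills_cong: "kills (r - s) \<Longrightarrow> kills r \<longleftrightarrow> kills s"
  using kills_add[of "r - s" s] kills_diff[of r "r - s"] by fastforce

text \<open>For a generating set of minimal size the generators are independent over the acting ring,
  so comparing coefficients of one generator turns surjectivity of \<open>x\<close> into divisibility.\<close>

lemma loc_fg_imp_divides:
  assumes "kills_or_bij" "loc_fg"
  shows "\<exists>b S. \<not> kills b \<and> finite S \<and> S \<subseteq> carrier M \<and>
     (\<forall>m\<in>carrier M. \<exists>k::nat. m \<bullet> b ^ k \<in> span S) \<and>
     (\<forall>x. \<not> kills x \<longrightarrow> (\<exists>y k. kills (b ^ k - x * y)))"
proof -
  define P where "P b S \<longleftrightarrow> \<not> kills b \<and> finite S \<and> S \<subseteq> carrier M \<and>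
     (\<forall>m\<in>carrier M. \<exists>k::nat. m \<bullet> b ^ k \<in> span S)" for b S
  \<comment> \<open>The minimum runs over the denominator \<open>b\<close> as well as over
    \<open>S\<close>, because discarding a generator will cost a larger denominator.\<close>
  define n where "n = (LEAST n. \<exists>b S. P b S \<and> card S = n)"
  have "\<exists>n b S. P b S \<and> card S = n" using assms(2) unfolding loc_fg_def P_def by blast
  then have "\<exists>b S. P b S \<and> card S = n" unfolding n_def by (rule LeastI_ex)
  then obtain b S where bS: "P b S" and n: "card S = n" by blast
  have min: "card S \<le> card S'" if "P b' S'" for b' S'
    unfolding n n_def using that by (intro Least_le) blast
  have nb: "\<not> kills b" and fin: "finite S" and SC: "S \<subseteq> carrier M"
    and sp: "\<And>m. m \<in> carrier M \<Longrightarrow> \<exists>k::nat. m \<bullet> b ^ k \<in> span S"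
    using bS unfolding P_def by simp_all
  have "S \<noteq> {}"
  proof
    assume "S = {}"
    have "m = \<zero>" if "m \<in> span {}" for m using that by cases auto
    then have "\<exists>k. m \<bullet> b ^ k = \<zero>" if "m \<in> carrier M" for m using sp[OF that] \<open>S = {}\<close> by auto
    moreover obtain m where m: "m \<in> carrier M" "m \<noteq> \<zero>" using nb unfolding kills_def by auto
    ultimately obtain k where k: "m \<bullet> b ^ k = \<zero>" by blast
    then have "m = \<zero>"
      using not_kills_inj[OF assms(1) not_kills_power[OF assms(1) nb] m(1)] by blast
    then show False using m by simp
  qed
  then obtain t where t: "t \<in> S" by auto
  then have tC: "t \<in> carrier M" using SC by auto
  have SC': "S - {t} \<subseteq> carrier M" using SC by auto
  have indep: "kills r" if r: "t \<bullet> r \<in> span (S - {t})" for r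
  proof (rule ccontr)
    assume nr: "\<not> kills r"
    have "P (b * r) (S - {t})" unfolding P_def
    proof (intro conjI ballI)
      show "\<not> kills (b * r)" using not_kills_mult assms nb nr by blast
      show "finite (S - {t})" "S - {t} \<subseteq> carrier M" using fin SC by auto
      fix m assume m: "m \<in> carrier M"
      then obtain k where k: "m \<bullet> b ^ k \<in> span S" using sp by blast
      then have "m \<bullet> b ^ k \<in> span (insert t (S - {t}))" using t by (simp add: insert_absorb)
      then obtain q m' where m': "m' \<in> span (S - {t})" "m \<bullet> b ^ k = t \<bullet> q \<oplus> m'"
        using span_insert[of "m \<bullet> b ^ k" t "S - {t}"] SC tC by auto
      have m'C: "m' \<in> carrier M" using m' SC' span_closed by blast
      \<comment> \<open>The exponent \<open>Suc k\<close> guarantees a factor \<open>r\<close> to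
        convert the \<open>t\<close>-part, even for \<open>k = 0\<close>.\<close>
      have "m \<bullet> (b * r) ^ Suc k = m \<bullet> b ^ k \<bullet> r \<bullet> (b * r ^ k)"
        using m by (simp add: act_mult[symmetric] power_mult_distrib algebra_simps)
      also have "\<dots> = (t \<bullet> r \<bullet> q \<oplus> m' \<bullet> r) \<bullet> (b * r ^ k)"
        using m'C tC by (simp add: m' add_act act_commute[of t q r])
      also have "\<dots> \<in> span (S - {t})"
        by (rule span_act[OF span_add[OF span_act[OF r SC'] span_act[OF m'(1) SC'] SC'] SC'])
      finally show "\<exists>k. m \<bullet> (b * r) ^ k \<in> span (S - {t})" by blast
    qed
    then have "card S \<le> card (S - {t})" by (rule min)
    then show False using t fin by (meson card_Diff1_less not_le)
  qed
  have "\<exists>y k. kills (b ^ k - x * y)" if x: "\<not> kills x" for x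
  proof -
    \<comment> \<open>Dividing \<open>t\<close> by \<open>x\<close> inside the module gives
      \<open>n\<close>. Clearing the denominator of \<open>n\<close> and multiplying by
      \<open>x\<close> again expresses \<open>t \<bullet> b ^ k\<close> with
      \<open>t\<close>-coefficient \<open>x * q\<close>, so \<open>indep\<close> applies to
      \<open>b ^ k - x * q\<close>.\<close>
    obtain n where n: "n \<in> carrier M" "t = n \<bullet> x"
      using not_kills_surj[OF assms(1) x tC] .
    obtain k where k: "n \<bullet> b ^ k \<in> span S" using sp n by blast
    then have "n \<bullet> b ^ k \<in> span (insert t (S - {t}))" using t by (simp add: insert_absorb)
    then obtain q m' where m': "m' \<in> span (S - {t})" "n \<bullet> b ^ k = t \<bullet> q \<oplus> m'"
      using span_insert[of "n \<bullet> b ^ k" t "S - {t}"] SC tC by auto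
    have m'C: "m' \<in> carrier M" using m' SC' span_closed by blast
    have "t \<bullet> b ^ k = n \<bullet> b ^ k \<bullet> x" using n by (simp add: act_commute)
    also have "\<dots> = t \<bullet> (x * q) \<oplus> m' \<bullet> x"
      using m' m'C tC by (simp add: add_act act_mult[symmetric] mult.commute)
    finally have "t \<bullet> (b ^ k - x * q) = m' \<bullet> x"
      using tC m'C by (simp add: act_diff add_diff_cancel)
    moreover have "m' \<bullet> x \<in> span (S - {t})" using m' SC' span_act by blast
    ultimately have "kills (b ^ k - x * q)" using indep by simp
    then show ?thesis by blast
  qed
  then show ?thesis by (intro exI[of _ b] exI[of _ S]) (use nb fin SC sp in simp)
qed

end

section \<open>Polynomial actions and Zariski's lemma\<close>

text \<open>One variable is adjoined and acts as \<open>u\<close>. The polynomials over an integral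
  domain again form one, so the construction can be repeated on its own result.\<close>

locale poly_action = comm_ring_action M act
  for M :: "('m, 'x) ring_scheme" (structure) and act :: "'m \<Rightarrow> 'r::idom \<Rightarrow> 'm" (infixl \<open>\<bullet>\<close> 70) +
  fixes u :: "'m \<Rightarrow> 'm"
  assumes u_closed [simp, intro]: "m \<in> carrier M \<Longrightarrow> u m \<in> carrier M"
    and u_add: "\<lbrakk>m \<in> carrier M; n \<in> carrier M\<rbrakk> \<Longrightarrow> u (m \<oplus> n) = u m \<oplus> u n"
    and u_act: "m \<in> carrier M \<Longrightarrow> u (m \<bullet> r) = u m \<bullet> r"
begin

definition pact :: "'m \<Rightarrow> 'r poly \<Rightarrow> 'm" (infixl \<open>\<diamondop>\<close> 70) where
  "m \<diamondop> p = fold_coeffs (\<lambda>a h m. m \<bullet> a \<oplus> h (u m)) p (\<lambda>_. \<zero>) m"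

lemma u_zero [simp]: "u \<zero> = \<zero>"
  using u_add[of \<zero> \<zero>] by (simp add: add.l_cancel_one')

lemma pact_0 [simp]: "m \<diamondop> 0 = \<zero>"
  by (simp add: pact_def)

lemma pact_pCons: "m \<in> carrier M \<Longrightarrow> m \<diamondop> pCons a p = m \<bullet> a \<oplus> u m \<diamondop> p"
  by (cases "p = 0 \<and> a = 0"; cases "p = 0"; cases "a = 0") (auto simp: pact_def)

lemma pact_closed [simp, intro]: "m \<in> carrier M \<Longrightarrow> m \<diamondop> p \<in> carrier M"
  by (induction p arbitrary: m) (auto simp: pact_pCons)

text \<open>This carries a commuting map one level up the tower of polynomial rings; it is applied
  to the variables still to be adjoined and to the maps for which the module is simple.\<close>

lemma pact_hom:
  assumes "\<And>m. m \<in> carrier M \<Longrightarrow> h m \<in> carrier M"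
    and "\<And>m n. m \<in> carrier M \<Longrightarrow> n \<in> carrier M \<Longrightarrow> h (m \<oplus> n) = h m \<oplus> h n"
    and "\<And>m r. m \<in> carrier M \<Longrightarrow> h (m \<bullet> r) = h m \<bullet> r"
    and "\<And>m. m \<in> carrier M \<Longrightarrow> h (u m) = u (h m)"
    and "m \<in> carrier M"
  shows "h (m \<diamondop> p) = h m \<diamondop> p"
  using assms(5)
proof (induction p arbitrary: m)
  case 0
  have "h \<zero> \<oplus> h \<zero> = h \<zero>" using assms(2)[of \<zero> \<zero>] by simp
  then have "h \<zero> = \<zero>" using assms(1)[of \<zero>] by (simp add: add.l_cancel_one')
  then show ?case by simp
next
  case (pCons a p)
  then show ?case by (simp add: pact_pCons assms(1-4))
qed

lemma pact_u: "m \<in> carrier M \<Longrightarrow> u (m \<diamondop> p) = u m \<diamondop> p"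
  by (rule pact_hom) (auto simp: u_add u_act)

lemma add_pact: "\<lbrakk>m \<in> carrier M; n \<in> carrier M\<rbrakk> \<Longrightarrow> (m \<oplus> n) \<diamondop> p = m \<diamondop> p \<oplus> n \<diamondop> p"
  by (induction p arbitrary: m n) (simp_all add: pact_pCons add_act u_add a_ac)

lemma pact_add: "m \<in> carrier M \<Longrightarrow> m \<diamondop> (p + q) = m \<diamondop> p \<oplus> m \<diamondop> q"
  by (induction p q arbitrary: m rule: poly_induct2) (simp_all add: pact_pCons act_add a_ac)

lemma pact_smult: "m \<in> carrier M \<Longrightarrow> m \<diamondop> (Polynomial.smult a q) = m \<bullet> a \<diamondop> q"
  by (induction q arbitrary: m) (simp_all add: pact_pCons act_mult u_act)

lemma zero_pact [simp]: "\<zero> \<diamondop> p = \<zero>"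
  by (induction p) (simp_all add: pact_pCons)

lemma pact_mult: "m \<in> carrier M \<Longrightarrow> m \<diamondop> (p * q) = m \<diamondop> p \<diamondop> q"
  by (induction p arbitrary: m)
    (simp_all add: pact_pCons pact_add pact_smult add_pact flip: pact_u)

lemma pact_const [simp]: "m \<in> carrier M \<Longrightarrow> m \<diamondop> [:a:] = m \<bullet> a"
  by (simp add: pact_pCons)

lemma pact_X [simp]: "m \<in> carrier M \<Longrightarrow> m \<diamondop> [:0, 1:] = u m"
  by (simp add: pact_pCons)

sublocale P: comm_ring_action M pact
  by unfold_locales
    (auto simp: add_pact pact_add pact_mult one_pCons)

lemma kills_const [simp]: "P.kills [:a:] \<longleftrightarrow> kills a"
  by (simp add: P.kills_def kills_def)

lemma kills_pCons_0: "P.kills p \<Longrightarrow> P.kills (pCons 0 p)"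
  using P.kills_mult[of p "[:0, 1:]"] by (simp add: mult.commute)

lemma kills_or_bij_base:
  assumes "P.kills_or_bij" shows "kills_or_bij"
proof -
  have "kills r \<or> bij_betw (\<lambda>m. m \<bullet> r) (carrier M) (carrier M)" for r
  proof -
    have "bij_betw (\<lambda>m. m \<diamondop> [:r:]) (carrier M) (carrier M) \<longleftrightarrow> bij_betw (\<lambda>m. m \<bullet> r) (carrier M) (carrier M)"
      by (rule bij_betw_cong) simp
    then show ?thesis using assms[unfolded P.kills_or_bij_def, rule_format, of "[:r:]"] by simp
  qed
  then show ?thesis unfolding kills_or_bij_def by blast
qed

text \<open>The ring need not act faithfully, so degrees are only meaningful for polynomials whose
  leading coefficient does not act as zero.\<close>

definition proper :: "'r poly \<Rightarrow> bool" where
  "proper p \<longleftrightarrow> \<not> kills (lead_coeff p)"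

lemma proper_nonzero: "proper p \<Longrightarrow> p \<noteq> 0"
  unfolding proper_def using kills_zero by auto

text \<open>Recursion over the coefficients: a tail that acts as zero is discarded, any other is
  replaced by a proper one, which then supplies the leading coefficient. The degree never
  grows.\<close>

lemma proper_representative:
  "P.kills p \<or> (\<exists>p'. proper p' \<and> P.kills (p - p') \<and> Polynomial.degree p' \<le> Polynomial.degree p)"
proof (induction p)
  case 0
  then show ?case by (simp add: P.kills_zero)
next
  case (pCons a p)
  show ?case
  proof (cases "P.kills p")
    case True
    then have k: "P.kills (pCons 0 p)" by (rule kills_pCons_0)
    show ?thesis
    proof (cases "kills a")
      case True
      then have "P.kills [:a:]" by simp
      from P.kills_add[OF this k] show ?thesis by simp
    next
      case False
      then have "proper [:a:]" by (simp add: proper_def)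
      moreover have "P.kills (pCons a p - [:a:])" using k by simp
      ultimately show ?thesis by (intro disjI2 exI[of _ "[:a:]"]) simp
    qed
  next
    case False
    then obtain q where q: "proper q" "P.kills (p - q)" "Polynomial.degree q \<le> Polynomial.degree p"
      using pCons.IH by blast
    have "p \<noteq> 0" using False P.kills_zero by auto
    have "q \<noteq> 0" using q proper_nonzero by blast
    have "proper (pCons a q)" using q(1) \<open>q \<noteq> 0\<close> by (simp add: proper_def)
    moreover have "P.kills (pCons a p - pCons a q)" using kills_pCons_0[OF q(2)] by simp
    moreover have "Polynomial.degree (pCons a q) \<le> Polynomial.degree (pCons a p)"
      using q(3) \<open>p \<noteq> 0\<close> \<open>q \<noteq> 0\<close> by simp
    ultimately show ?thesis by blast
  qed
qed

lemma kills_diff_power: "P.kills (r - s) \<Longrightarrow> P.kills (r ^ k - s ^ k)"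
proof (induction k)
  case (Suc k)
  have "r ^ Suc k - s ^ Suc k = (r - s) * r ^ k + s * (r ^ k - s ^ k)"
    by (simp add: algebra_simps)
  then show ?case using Suc by (simp add: P.kills_add P.kills_mult P.kills_mult')
qed (simp add: P.kills_zero)

text \<open>If \<open>u\<close> were transcendental, \<open>x = 1 + X b\<close> would be a non-unit prime to \<open>b\<close>.\<close>

lemma killed_proper_exists:
  assumes dich: "P.kills_or_bij" and b: "\<not> P.kills b"
    and dvd: "\<And>x. \<not> P.kills x \<Longrightarrow> \<exists>y k. P.kills (b ^ k - x * y)"
  shows "\<exists>f. proper f \<and> P.kills f"
proof (rule ccontr)
  assume "\<nexists>f. proper f \<and> P.kills f"
  then have nex: "\<not> P.kills f" if "proper f" for f using that by blast
  obtain b' where b': "proper b'" "P.kills (b - b')" using proper_representative[of b] b by blast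
  \<comment> \<open>The proper representative \<open>b'\<close> replaces \<open>b\<close> so that
    \<open>1 + X b'\<close>, whose leading coefficient is that of \<open>b'\<close>, is proper of
    positive degree.\<close>
  define x where "x = pCons 1 b'"
  have "b' \<noteq> 0" using b' proper_nonzero by blast
  then have x: "proper x" "Polynomial.degree x > 0" using b' by (simp_all add: proper_def x_def)
  obtain y k where yk: "P.kills (b ^ k - x * y)" using dvd[OF nex[OF x(1)]] by blast
  have "P.kills (b' ^ k - b ^ k)"
    using kills_diff_power[OF b'(2), of k] P.kills_diff[of 0 "b ^ k - b' ^ k"] P.kills_zero by simp
  from P.kills_add[OF this yk] have yk': "P.kills (b' ^ k - x * y)" by simp
  \<comment> \<open>Modulo \<open>x\<close> the product \<open>X b'\<close> is -1. Since
    \<open>x\<close> divides \<open>b' ^ k\<close> up to the annihilator, it divides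
    \<open>X^k b'^k\<close> and hence 1: an inverse \<open>v\<close> of \<open>x\<close>
    results.\<close>
  have "\<exists>w. (x - 1) ^ j = x * w + (- 1) ^ j" for j
  proof (induction j)
    case 0
    then show ?case by (intro exI[of _ 0]) simp
  next
    case (Suc j)
    then obtain w where "(x - 1) ^ j = x * w + (- 1) ^ j" by blast
    then have "(x - 1) ^ Suc j = x * ((x - 1) * w + (- 1) ^ j) + (- 1) ^ Suc j"
      by (simp add: algebra_simps)
    then show ?case by blast
  qed
  then obtain w where w: "(x - 1) ^ k = x * w + (- 1) ^ k" by blast
  have "x - 1 = [:0, 1:] * b'" by (simp add: x_def one_pCons)
  then have "(x - 1) ^ k = [:0, 1:] ^ k * b' ^ k" by (simp only: power_mult_distrib)
  then have "[:0, 1:] ^ k * (b' ^ k - x * y) = x * (w - [:0, 1:] ^ k * y) + (- 1) ^ k"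
    using w by (simp add: algebra_simps)
  then have "P.kills ((- 1) ^ k * (x * (w - [:0, 1:] ^ k * y) + (- 1) ^ k))"
    using P.kills_mult'[OF yk'] P.kills_mult' by metis
  moreover define v where "v = - ((- 1) ^ k * (w - [:0, 1:] ^ k * y))"
  moreover have "(- 1) ^ k * (- 1) ^ k = (1 :: 'r poly)"
    by (metis minus_one_mult_self)
  then have "(- 1) ^ k * (x * (w - [:0, 1:] ^ k * y) + (- 1) ^ k) = 1 - x * v"
    by (simp add: v_def algebra_simps)
  ultimately have v: "P.kills (1 - x * v)" by simp
  have "\<not> P.kills 1" using b P.not_kills_one by blast
  then have "\<not> P.kills v" using v P.kills_mult'[of v x] P.not_kills_cong by blast
  then obtain v' where v': "proper v'" "P.kills (v - v')" using proper_representative by blast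
  have "P.kills (1 - x * v + x * (v - v'))" using v v' P.kills_add P.kills_mult' by blast
  then have k: "P.kills (1 - x * v')" by (simp add: algebra_simps)
  \<comment> \<open>As both factors are proper, the leading coefficient of \<open>1 - x * v'\<close>
    is minus the product of theirs, so this polynomial is proper although it acts as zero.\<close>
  have "v' \<noteq> 0" "x \<noteq> 0" using x v' proper_nonzero by blast+
  then have deg: "Polynomial.degree (x * v') > 0" using x(2) by (simp add: degree_mult_eq)
  then have "lead_coeff (1 + - (x * v')) = lead_coeff (- (x * v'))"
    by (intro lead_coeff_add_le) simp
  then have l: "lead_coeff (1 - x * v') = - (lead_coeff x * lead_coeff v')"
    by (simp add: lead_coeff_minus lead_coeff_mult)
  have "\<not> kills (lead_coeff x * lead_coeff v')"
    using not_kills_mult kills_or_bij_base dich x(1) v'(1) unfolding proper_def by blast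
  then have "\<not> kills (- (lead_coeff x * lead_coeff v'))"
    using kills_mult'[of "- (lead_coeff x * lead_coeff v')" "- 1"] by auto
  then have "proper (1 - x * v')" unfolding proper_def l .
  then show False using nex k by blast
qed

lemma pseudo_division:
  assumes "g \<noteq> 0"
  obtains k q r where "[:lead_coeff g ^ k:] * f = g * q + (r :: 'r poly)"
    and "r = 0 \<or> Polynomial.degree r < Polynomial.degree g"
proof -
  obtain q r where "pseudo_divmod f g = (q, r)" by (cases "pseudo_divmod f g")
  from pseudo_divmod[OF assms this] show ?thesis by (intro that) auto
qed

text \<open>Below, \<open>g\<close> plays the minimal polynomial of \<open>u\<close>, and
  \<open>p\<close> is, modulo the annihilator, a nonzero multiple of \<open>b\<close> of least
  degree. Pseudo-division of \<open>g\<close> by \<open>p\<close> leaves a remainder that acts as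
  zero; if \<open>p\<close> were not constant, the quotient would be a proper killed polynomial of
  smaller degree than \<open>g\<close>.\<close>

lemma divides_const:
  assumes dich: "P.kills_or_bij" and b: "\<not> P.kills b"
    and f: "proper f" "P.kills f"
  shows "\<exists>w r. \<not> kills r \<and> P.kills (w * b - [:r:])"
proof -
  have base: kills_or_bij using dich by (rule kills_or_bij_base)
  have "\<exists>f. (proper f \<and> P.kills f) \<and>
      (\<forall>y. proper y \<and> P.kills y \<longrightarrow> Polynomial.degree f \<le> Polynomial.degree y)"
    using f by (intro ex_has_least_nat[of _ f]) simp
  then obtain g where g: "proper g" "P.kills g"
    and gmin: "\<And>y. proper y \<Longrightarrow> P.kills y \<Longrightarrow> Polynomial.degree g \<le> Polynomial.degree y"
    by blast
  \<comment> \<open>Nonzero multiples of \<open>b\<close>, both notions taken modulo the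
    annihilator.\<close>
  define J where "J p \<longleftrightarrow> \<not> P.kills p \<and> (\<exists>w. P.kills (w * b - p))" for p
  have J_rep: "\<exists>p'. (proper p' \<and> J p') \<and> Polynomial.degree p' \<le> Polynomial.degree p" if p: "J p" for p
  proof -
    obtain w where w: "P.kills (w * b - p)" using p J_def by blast
    have "\<not> P.kills p" using p J_def by blast
    then obtain p' where p': "proper p'" "P.kills (p - p')"
        "Polynomial.degree p' \<le> Polynomial.degree p"
      using proper_representative by blast
    have "\<not> P.kills p'" using P.not_kills_cong p'(2) \<open>\<not> P.kills p\<close> by blast
    moreover have "P.kills (w * b - p')" using P.kills_add[OF w p'(2)] by simp
    ultimately show ?thesis using p' J_def by blast
  qed
  have "J b" unfolding J_def using b P.kills_zero by (intro conjI exI[of _ 1]) auto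
  then obtain p0 where "proper p0 \<and> J p0" using J_rep by blast
  then have "\<exists>p. (proper p \<and> J p) \<and> (\<forall>y. proper y \<and> J y \<longrightarrow> Polynomial.degree p \<le> Polynomial.degree y)"
    by (intro ex_has_least_nat[of _ p0])
  then obtain p where p: "proper p" "J p"
    and pmin: "\<And>y. proper y \<Longrightarrow> J y \<Longrightarrow> Polynomial.degree p \<le> Polynomial.degree y"
    by blast
  have pmin': "Polynomial.degree p \<le> Polynomial.degree y" if "J y" for y
    using J_rep[OF that] pmin order_trans by blast
  have nz: "p \<noteq> 0" "g \<noteq> 0" using p g proper_nonzero by blast+
  obtain w where w: "P.kills (w * b - p)" using p J_def by blast
  have np: "\<not> P.kills p" using p J_def by blast
  have J_cong: "J r" if "\<not> P.kills r" "P.kills (p * q - r)" for q r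
  proof -
    have "P.kills (q * (w * b - p) + (p * q - r))"
      using w that P.kills_add P.kills_mult' by blast
    then have "P.kills (q * w * b - r)" by (simp add: algebra_simps)
    then show ?thesis using that J_def by blast
  qed
  have dp: "Polynomial.degree p < Polynomial.degree g"
  proof -
    obtain k q r where r: "[:lead_coeff g ^ k:] * p = g * q + r"
      "r = 0 \<or> Polynomial.degree r < Polynomial.degree g" using pseudo_division nz(2) by blast
    have "\<not> P.kills [:lead_coeff g ^ k:]"
      using not_kills_power[OF base] g(1) by (simp add: proper_def)
    then have n1: "\<not> P.kills ([:lead_coeff g ^ k:] * p)" using P.not_kills_mult[OF dich] np by blast
    have eq: "[:lead_coeff g ^ k:] * p - r = g * q" using r(1) by simp
    have k1: "P.kills ([:lead_coeff g ^ k:] * p - r)" unfolding eq using g(2) by (rule P.kills_mult)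
    then have "\<not> P.kills r" using n1 P.not_kills_cong by blast
    moreover have "J r" using J_cong[of r "[:lead_coeff g ^ k:]"] k1 calculation by (simp add: mult.commute)
    ultimately have "Polynomial.degree p \<le> Polynomial.degree r" "r \<noteq> 0"
      using pmin' P.kills_zero by auto
    then show ?thesis using r(2) by simp
  qed
  have "Polynomial.degree p = 0"
  proof (rule ccontr)
    assume pos: "Polynomial.degree p \<noteq> 0"
    obtain k q r where r: "[:lead_coeff p ^ k:] * g = p * q + r"
      "r = 0 \<or> Polynomial.degree r < Polynomial.degree p" using pseudo_division nz(1) by blast
    have rk: "P.kills r"
    proof (rule ccontr)
      assume nr: "\<not> P.kills r"
      have "P.kills ([:lead_coeff p ^ k:] * g)" using g(2) by (rule P.kills_mult')
      then have "P.kills (p * q + r)" by (simp only: r(1))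
      then have "P.kills (p * (- q) - r)"
        using P.kills_mult'[of "p * q + r" "-1"] by simp
      then have "J r" using J_cong nr by blast
      then show False using pmin'[of r] r(2) nr P.kills_zero by auto
    qed
    have eq: "[:lead_coeff p ^ k:] * g + - r = p * q" using r(1) by simp
    have c: "\<not> kills (lead_coeff p ^ k)" using not_kills_power[OF base] p(1) by (simp add: proper_def)
    then have cnz: "lead_coeff p ^ k \<noteq> 0" using kills_zero by metis
    have "P.kills ([:lead_coeff p ^ k:] * g - r)"
      using P.kills_diff[OF P.kills_mult'[OF g(2)] rk] .
    then have "P.kills (p * q)" using eq by simp
    then have qk: "P.kills q" using P.not_kills_mult[OF dich np] by blast
    have dg: "Polynomial.degree ([:lead_coeff p ^ k:] * g) = Polynomial.degree g"
      using cnz nz by simp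
    \<comment> \<open>The chain degree r < degree p < degree g is the reason for \<open>dp\<close>:
      subtracting \<open>r\<close> leaves degree and leading coefficient of the multiple of
      \<open>g\<close> unchanged.\<close>
    have dr: "Polynomial.degree (- r) < Polynomial.degree ([:lead_coeff p ^ k:] * g)"
      using r(2) dp dg by auto
    have "Polynomial.degree (p * q) = Polynomial.degree g"
      using degree_add_eq_left[OF dr] dg eq by simp
    moreover have lq: "lead_coeff (p * q) = lead_coeff p ^ k * lead_coeff g"
    proof -
      have "lead_coeff (p * q) = lead_coeff ([:lead_coeff p ^ k:] * g)"
        using lead_coeff_add_le[OF dr] unfolding eq[symmetric] by (simp only: add.commute)
      then show ?thesis by (simp only: lead_coeff_mult) simp
    qed
    moreover have nk: "\<not> kills (lead_coeff p ^ k * lead_coeff g)"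
      using c g(1) not_kills_mult[OF base] by (simp add: proper_def)
    have "\<not> kills (lead_coeff p * lead_coeff q)"
      using nk lq by (simp add: lead_coeff_mult)
    then have "proper q" unfolding proper_def using kills_mult' by blast
    then have "Polynomial.degree g \<le> Polynomial.degree q" "q \<noteq> 0" using gmin qk proper_nonzero by auto
    ultimately show False using pos nz by (simp add: degree_mult_eq)
  qed
  then obtain r where r: "p = [:r:]" by (rule degree_eq_zeroE)
  then show ?thesis using w p(1) by (intro exI[of _ w] exI[of _ r]) (simp add: proper_def)
qed

text \<open>Because a proper polynomial \<open>f\<close> acts as zero, the finitely many products of
  old generators with powers of the variable below \<open>degree f\<close> suffice, once the leading
  coefficient \<open>c\<close> of \<open>f\<close> is inverted. The old denominator \<open>b\<close>
  is traded for a constant \<open>r\<close> that it divides modulo the annihilator.\<close>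

lemma loc_fg_descend:
  assumes dich: "P.kills_or_bij" and "P.loc_fg"
  shows "loc_fg"
proof -
  have base: kills_or_bij using dich by (rule kills_or_bij_base)
  obtain b S where b: "\<not> P.kills b" and fin: "finite S" and SC: "S \<subseteq> carrier M"
    and sp: "\<And>m. m \<in> carrier M \<Longrightarrow> \<exists>k::nat. m \<diamondop> b ^ k \<in> P.span S"
    and dvd: "\<And>x. \<not> P.kills x \<Longrightarrow> \<exists>y k. P.kills (b ^ k - x * y)"
    using P.loc_fg_imp_divides[OF assms] by blast
  obtain f where f: "proper f" "P.kills f"
    using killed_proper_exists[OF dich b dvd] by blast
  obtain w r where w: "\<not> kills r" "P.kills (w * b - [:r:])" using divides_const[OF dich b f] by blast
  define c where "c = lead_coeff f"
  have c: "\<not> kills c" using f by (simp add: proper_def c_def)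
  define T where "T = (\<lambda>(s, i). s \<diamondop> [:0, 1:] ^ i) ` (S \<times> {..<Polynomial.degree f})"
  have TC: "T \<subseteq> carrier M" using SC by (auto simp: T_def)
  have low: "s \<diamondop> ([:0, 1:] ^ j * p) \<in> span T"
    if "s \<in> S" "p = 0 \<or> j + Polynomial.degree p < Polynomial.degree f" for s j p
    using that(2)
  proof (induction p arbitrary: j)
    case 0
    have "s \<in> carrier M" using SC that by auto
    then show ?case by (simp add: span_zero)
  next
    case (pCons a p)
    have s: "s \<in> carrier M" using SC that by auto
    have j: "j < Polynomial.degree f" "p = 0 \<or> Suc j + Polynomial.degree p < Polynomial.degree f"
      using pCons by (auto split: if_splits)
    have "[:0, 1:] ^ j * pCons a p = [:0, 1:] ^ j * [:a:] + [:0, 1:] ^ Suc j * p"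
      by (simp add: algebra_simps)
    then have "s \<diamondop> ([:0, 1:] ^ j * pCons a p) = s \<diamondop> [:0, 1:] ^ j \<bullet> a \<oplus> s \<diamondop> ([:0, 1:] ^ Suc j * p)"
      using s by (simp only: P.act_add P.act_mult pact_const P.act_closed)
    moreover have "s \<diamondop> [:0, 1:] ^ j \<bullet> a \<in> span T"
      using j that TC by (intro span_base_act) (auto simp: T_def)
    ultimately show ?case using pCons.IH[OF j(2)] TC by (simp only: span_add)
  qed
  have red: "\<exists>k. n \<bullet> c ^ k \<in> span T" if "n \<in> P.span S" for n
    using that
  proof (induction rule: P.span.induct)
    case span_zero
    then show ?case by (simp add: span.span_zero)
  next
    case (span_step s n p)
    have s: "s \<in> carrier M" "n \<in> carrier M" using SC span_step P.span_closed by auto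
    obtain k where k: "n \<bullet> c ^ k \<in> span T" using span_step by blast
    obtain j q p' where p': "[:c ^ j:] * p = f * q + p'"
      "p' = 0 \<or> Polynomial.degree p' < Polynomial.degree f"
      using pseudo_division proper_nonzero f unfolding c_def by blast
    have "s \<diamondop> p \<bullet> c ^ j = s \<diamondop> (p * [:c ^ j:])" using s by (simp only: P.act_mult pact_const P.act_closed)
    also have "\<dots> = s \<diamondop> (f * q) \<oplus> s \<diamondop> p'" using p' s by (simp only: mult.commute P.act_add)
    also have "s \<diamondop> (f * q) = \<zero>" using f(2) s by (simp only: P.act_mult) (simp add: P.kills_def)
    finally have "s \<diamondop> p \<bullet> c ^ j = s \<diamondop> p'" using s by simp
    moreover have "s \<diamondop> p' \<in> span T" using low[of s p' 0] p' span_step by simp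
    ultimately have *: "s \<diamondop> p \<bullet> c ^ j \<bullet> c ^ k \<in> span T" using span_act TC by simp
    have "(s \<diamondop> p \<oplus> n) \<bullet> c ^ (j + k) = s \<diamondop> p \<bullet> c ^ j \<bullet> c ^ k \<oplus> n \<bullet> c ^ k \<bullet> c ^ j"
      using s by (simp add: power_add add_act act_mult act_commute[of n])
    also have "\<dots> \<in> span T" using * span_act[OF k TC] span_add TC by blast
    finally show ?case by blast
  qed
  have "\<exists>k. m \<bullet> (r * c) ^ k \<in> span T" if m: "m \<in> carrier M" for m
  proof -
    obtain k where k: "m \<diamondop> b ^ k \<in> P.span S" using sp m by blast
    have "P.kills ((w * b) ^ k - [:r:] ^ k)" using kills_diff_power w(2) by blast
    then have "m \<diamondop> (w * b) ^ k = m \<diamondop> [:r:] ^ k" using m by (simp add: P.act_eq_iff P.kills_def)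
    also have "[:r:] ^ k = [:r ^ k:]" by (simp add: poly_const_pow)
    finally have "m \<bullet> r ^ k = m \<diamondop> b ^ k \<diamondop> w ^ k"
      using m by (simp add: power_mult_distrib P.act_mult[symmetric] mult.commute)
    also have "\<dots> \<in> P.span S" using k SC by (rule P.span_act)
    finally obtain j where "m \<bullet> r ^ k \<bullet> c ^ j \<in> span T" using red by blast
    \<comment> \<open>The extra factor \<open>r ^ j * c ^ k\<close> evens out the exponents, so that
      a power of the single denominator \<open>r * c\<close> appears.\<close>
    then have "m \<bullet> r ^ k \<bullet> c ^ j \<bullet> (r ^ j * c ^ k) \<in> span T" using TC by (rule span_act)
    also have "m \<bullet> r ^ k \<bullet> c ^ j \<bullet> (r ^ j * c ^ k) = m \<bullet> (r * c) ^ (k + j)"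
      using m by (simp add: act_mult[symmetric] power_add power_mult_distrib algebra_simps)
    finally show ?thesis by blast
  qed
  moreover have "\<not> kills (r * c)" using w c not_kills_mult[OF base] by blast
  moreover have "finite T" using fin by (simp add: T_def)
  ultimately show ?thesis unfolding loc_fg_def using TC by blast
qed

text \<open>\<open>\<iota>\<close> stands for the embedding of the base field as nested constant
  polynomials. A killed proper polynomial is congruent to one over the field, which splits into
  linear factors by algebraic closedness; as the annihilator is prime, one of them,
  \<open>X - l\<close>, acts as zero, and then \<open>u\<close> is multiplication by
  \<open>l\<close>.\<close>

lemma scalar_ascend:
  fixes \<iota> :: "'k::alg_closed_field \<Rightarrow> 'r"
  assumes dich: "P.kills_or_bij" and "P.loc_fg"
    and \<iota>: "\<iota> 1 = 1" "\<And>a b. \<iota> (a + b) = \<iota> a + \<iota> b" "\<And>a b. \<iota> (a * b) = \<iota> a * \<iota> b"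
    and scal: "\<And>r. \<exists>c. kills (r - \<iota> c)"
  shows "\<exists>c. P.kills (p - [:\<iota> c:])"
proof -
  obtain b S where b: "\<not> P.kills b"
    and dvd: "\<And>x. \<not> P.kills x \<Longrightarrow> \<exists>y k. P.kills (b ^ k - x * y)"
    using P.loc_fg_imp_divides[OF assms(1,2)] by blast
  obtain f where f: "proper f" "P.kills f"
    using killed_proper_exists[OF dich b dvd] by blast
  have \<iota>0: "\<iota> 0 = 0" using \<iota>(2)[of 0 0] by (metis add.right_neutral add_left_cancel)
  have \<iota>m: "\<iota> (- a) = - \<iota> a" for a using \<iota>(2)[of a "- a"] \<iota>0 by (simp add: eq_neg_iff_add_eq_0 add.commute)
  have \<iota>d: "\<iota> (a - b) = \<iota> a - \<iota> b" for a b using \<iota>(2)[of a "- b"] \<iota>m by simp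
  have \<iota>k: "\<not> kills (\<iota> c)" if "c \<noteq> 0" for c
  proof
    assume "kills (\<iota> c)"
    then have "kills (\<iota> c * \<iota> (inverse c))" by (rule kills_mult)
    then have "kills 1" using that \<iota> by (simp flip: \<iota>(3))
    then show False using b P.not_kills_one kills_const[of 1] by (simp add: one_pCons)
  qed
  have "\<exists>g. P.kills (p - map_poly \<iota> g) \<and> (\<forall>i. kills (Polynomial.coeff p i - \<iota> (Polynomial.coeff g i)))" for p
  proof (induction p)
    case 0
    show ?case by (intro exI[of _ 0]) (simp add: P.kills_zero kills_zero \<iota>0)
  next
    case (pCons a p)
    then obtain g where g: "P.kills (p - map_poly \<iota> g)"
      "\<And>i. kills (Polynomial.coeff p i - \<iota> (Polynomial.coeff g i))" by blast
    obtain c where c: "kills (a - \<iota> c)" using scal by blast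
    then have "P.kills [:a - \<iota> c:]" by simp
    from P.kills_add[OF this kills_pCons_0[OF g(1)]]
    have "P.kills (pCons a p - map_poly \<iota> (pCons c g))"
      by (simp add: map_poly_pCons \<iota>0)
    then show ?case using g(2) c by (intro exI[of _ "pCons c g"]) (auto simp: coeff_pCons split: nat.split)
  qed
  then obtain g where g: "P.kills (f - map_poly \<iota> g)"
      "\<And>i. kills (Polynomial.coeff f i - \<iota> (Polynomial.coeff g i))" by blast
  have "g \<noteq> 0"
  proof
    assume "g = 0"
    then show False using g(2)[of "Polynomial.degree f"] f(1) by (simp add: proper_def \<iota>0)
  qed
  moreover have "P.kills (map_poly \<iota> g)" using P.not_kills_cong[OF g(1)] f(2) by blast
  ultimately have "\<exists>l. P.kills [:- \<iota> l, 1:]"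
  proof (induction "Polynomial.degree g" arbitrary: g rule: less_induct)
    case less
    show ?case
    proof (cases "Polynomial.degree g = 0")
      case True
      then obtain c where "g = [:c:]" by (rule degree_eq_zeroE)
      then show ?thesis using less.prems \<iota>k[of c] by (simp add: map_poly_pCons \<iota>0)
    next
      case False
      then obtain l where "poly g l = 0" using alg_closed_imp_poly_has_root[of g] by blast
      then obtain h where h: "g = [:- l, 1:] * h" by (auto simp: poly_eq_0_iff_dvd dvd_def)
      have "h \<noteq> 0" using less.prems h by auto
      then have d: "Polynomial.degree h < Polynomial.degree g"
        using h by (simp add: degree_mult_eq del: mult_pCons_left)
      have "map_poly \<iota> g = [:- \<iota> l, 1:] * map_poly \<iota> h"
        by (intro poly_eqI)
          (simp add: h coeff_map_poly coeff_pCons \<iota>0 \<iota> \<iota>m \<iota>d split: nat.split)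
      then have "P.kills [:- \<iota> l, 1:] \<or> P.kills (map_poly \<iota> h)"
        using less.prems P.not_kills_mult[OF dich] by metis
      then show ?thesis using less.hyps[OF d \<open>h \<noteq> 0\<close>] by blast
    qed
  qed
  then obtain l where l: "P.kills [:- \<iota> l, 1:]" by blast
  show ?thesis
  proof (induction p)
    case 0
    show ?case by (intro exI[of _ 0]) (simp add: P.kills_zero \<iota>0)
  next
    case (pCons a p)
    then obtain c where c: "P.kills (p - [:\<iota> c:])" by blast
    obtain a' where "kills (a - \<iota> a')" using scal by blast
    then have "P.kills [:a - \<iota> a':]" by simp
    from P.kills_add[OF P.kills_add[OF this kills_pCons_0[OF c]] P.kills_mult[OF l, of "[:\<iota> c:]"]]
    have "P.kills (pCons a p - [:\<iota> (a' + l * c):])"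
      by (simp add: \<iota> algebra_simps)
    then show ?case by blast
  qed
qed

end

section \<open>Schur's lemma and scalar action of commuting endomorphisms\<close>

context ring_action
begin

text \<open>Kernel and image of \<open>r\<close> are stable under the maps in \<open>H\<close>,
  which commute with the action. \<open>H\<close> is kept apart from the acting ring because
  simplicity will hold for the whole noncommutative algebra, while the acting ring is only a
  commutative part.\<close>

lemma kills_or_bijI:
  assumes simple: "\<And>U. \<lbrakk>U \<subseteq> carrier M; \<zero> \<in> U; \<And>m n. m \<in> U \<Longrightarrow> n \<in> U \<Longrightarrow> m \<ominus> n \<in> U;
      \<And>h m. h \<in> H \<Longrightarrow> m \<in> U \<Longrightarrow> h m \<in> U\<rbrakk> \<Longrightarrow> U = {\<zero>} \<or> U = carrier M"
    and H_closed: "\<And>h m. h \<in> H \<Longrightarrow> m \<in> carrier M \<Longrightarrow> h m \<in> carrier M"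
    and H_zero: "\<And>h. h \<in> H \<Longrightarrow> h \<zero> = \<zero>"
    and H_act: "\<And>h m r. h \<in> H \<Longrightarrow> m \<in> carrier M \<Longrightarrow> h (m \<bullet> r) = h m \<bullet> r"
  shows kills_or_bij
  unfolding kills_or_bij_def disj_imp
proof (intro allI impI)
  fix r assume nk: "\<not> kills r"
  have ker: "{m \<in> carrier M. m \<bullet> r = \<zero>} = {\<zero>} \<or> {m \<in> carrier M. m \<bullet> r = \<zero>} = carrier M"
  proof (rule simple)
    fix h m assume "h \<in> H" "m \<in> {m \<in> carrier M. m \<bullet> r = \<zero>}"
    then show "h m \<in> {m \<in> carrier M. m \<bullet> r = \<zero>}"
      using H_closed[of h m] H_act[of h m r] H_zero[of h] by (metis (mono_tags, lifting) mem_Collect_eq)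
  qed (auto simp: diff_act minus_eq add_act uminus_act)
  have im: "(\<lambda>m. m \<bullet> r) ` carrier M = {\<zero>} \<or> (\<lambda>m. m \<bullet> r) ` carrier M = carrier M"
  proof (rule simple)
    show "\<zero> \<in> (\<lambda>m. m \<bullet> r) ` carrier M" by (rule image_eqI[of _ _ \<zero>]) simp_all
  next
    fix m n assume "m \<in> (\<lambda>m. m \<bullet> r) ` carrier M" "n \<in> (\<lambda>m. m \<bullet> r) ` carrier M"
    then obtain m' n' where "m = m' \<bullet> r" "n = n' \<bullet> r" "m' \<in> carrier M" "n' \<in> carrier M" by auto
    then show "m \<ominus> n \<in> (\<lambda>m. m \<bullet> r) ` carrier M"
      by (intro image_eqI[of _ _ "m' \<ominus> n'"]) (simp_all add: diff_act)
  next
    fix h m assume "h \<in> H" "m \<in> (\<lambda>m. m \<bullet> r) ` carrier M"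
    then obtain m' where "m = m' \<bullet> r" "m' \<in> carrier M" by auto
    then show "h m \<in> (\<lambda>m. m \<bullet> r) ` carrier M"
      using \<open>h \<in> H\<close> by (intro image_eqI[of _ _ "h m'"]) (auto simp: H_act H_closed)
  qed auto
  obtain m where m: "m \<in> carrier M" "m \<bullet> r \<noteq> \<zero>" using nk unfolding kills_def by blast
  show "bij_betw (\<lambda>m. m \<bullet> r) (carrier M) (carrier M)"
    unfolding bij_betw_def
  proof
    show "(\<lambda>m. m \<bullet> r) ` carrier M = carrier M" using im m by blast
    have k: "{m \<in> carrier M. m \<bullet> r = \<zero>} = {\<zero>}" using ker m by blast
    show "inj_on (\<lambda>m. m \<bullet> r) (carrier M)"
    proof (rule inj_onI)
      fix m n assume mn: "m \<in> carrier M" "n \<in> carrier M" "m \<bullet> r = n \<bullet> r"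
      then have "m \<ominus> n \<in> {m \<in> carrier M. m \<bullet> r = \<zero>}"
        using eq_iff_diff_zero[of "m \<bullet> r" "n \<bullet> r"] by (simp add: diff_act)
      then have "m \<ominus> n = \<zero>" using k by blast
      then show "m = n" using mn eq_iff_diff_zero by blast
    qed
  qed
qed

end

text \<open>Zariski's lemma in module form: the variables are eliminated one at a time while finite
  generation descends, and then each of them is seen to act by a scalar on the way back up.\<close>

theorem commuting_endomorphisms_scalar:
  fixes M :: "('m, 'x) ring_scheme" (structure) and act :: "'m \<Rightarrow> 'k::alg_closed_field \<Rightarrow> 'm"
  assumes "comm_ring_action M act"
    and u_closed: "\<And>u m. u \<in> {u1, u2, u3, u4} \<Longrightarrow> m \<in> carrier M \<Longrightarrow> u m \<in> carrier M"
    and u_add: "\<And>u m n. u \<in> {u1, u2, u3, u4} \<Longrightarrow> m \<in> carrier M \<Longrightarrow> n \<in> carrier M \<Longrightarrow>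
      u (m \<oplus> n) = u m \<oplus> u n"
    and u_act: "\<And>u m c. u \<in> {u1, u2, u3, u4} \<Longrightarrow> m \<in> carrier M \<Longrightarrow> u (act m c) = act (u m) c"
    and u_comm: "\<And>u v m. u \<in> {u1, u2, u3, u4} \<Longrightarrow> v \<in> {u1, u2, u3, u4} \<Longrightarrow> m \<in> carrier M \<Longrightarrow>
      u (v m) = v (u m)"
    and simple: "\<And>U. \<lbrakk>U \<subseteq> carrier M; \<zero> \<in> U; \<And>m n. m \<in> U \<Longrightarrow> n \<in> U \<Longrightarrow> m \<ominus> n \<in> U;
      \<And>h m. h \<in> H \<Longrightarrow> m \<in> U \<Longrightarrow> h m \<in> U\<rbrakk> \<Longrightarrow> U = {\<zero>} \<or> U = carrier M"
    and H_closed: "\<And>h m. h \<in> H \<Longrightarrow> m \<in> carrier M \<Longrightarrow> h m \<in> carrier M"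
    and H_add: "\<And>h m n. h \<in> H \<Longrightarrow> m \<in> carrier M \<Longrightarrow> n \<in> carrier M \<Longrightarrow> h (m \<oplus> n) = h m \<oplus> h n"
    and H_act: "\<And>h m c. h \<in> H \<Longrightarrow> m \<in> carrier M \<Longrightarrow> h (act m c) = act (h m) c"
    and H_u: "\<And>h u m. h \<in> H \<Longrightarrow> u \<in> {u1, u2, u3, u4} \<Longrightarrow> m \<in> carrier M \<Longrightarrow> h (u m) = u (h m)"
    and S: "finite S" "S \<subseteq> carrier M"
    and gen: "\<And>T m. \<lbrakk>S \<subseteq> T; T \<subseteq> carrier M; \<zero> \<in> T; \<And>m n. m \<in> T \<Longrightarrow> n \<in> T \<Longrightarrow> m \<oplus> n \<in> T;
      \<And>m c. m \<in> T \<Longrightarrow> act m c \<in> T; \<And>u m. u \<in> {u1, u2, u3, u4} \<Longrightarrow> m \<in> T \<Longrightarrow> u m \<in> T;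
      m \<in> carrier M\<rbrakk> \<Longrightarrow> \<exists>k. (u4 ^^ k) m \<in> T"
    and nz: "\<exists>m\<in>carrier M. u4 m \<noteq> \<zero>"
  shows "\<forall>u\<in>{u1, u2, u3, u4}. \<exists>c. \<forall>m\<in>carrier M. u m = act m c"
proof -
  interpret A0: comm_ring_action M act by fact
  interpret A1: poly_action M act u1
    by unfold_locales (auto intro: u_closed u_add u_act)
  \<comment> \<open>A further polynomial ring can only be formed once the next variable is known to
    commute with the polynomials in the previous ones.\<close>
  have u_A1: "u (A1.pact m p) = A1.pact (u m) p"
    if "u \<in> {u1, u2, u3, u4}" "m \<in> carrier M" for u m p
    by (rule A1.pact_hom) (use that in \<open>auto intro: u_closed u_add u_act u_comm\<close>)
  interpret A2: poly_action M A1.pact u2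
    by unfold_locales (auto intro: u_closed u_add u_A1)
  have u_A2: "u (A2.pact m p) = A2.pact (u m) p"
    if "u \<in> {u1, u2, u3, u4}" "m \<in> carrier M" for u m p
    by (rule A2.pact_hom) (use that in \<open>auto intro: u_closed u_add u_A1 u_comm\<close>)
  interpret A3: poly_action M A2.pact u3
    by unfold_locales (auto intro: u_closed u_add u_A2)
  have u_A3: "u (A3.pact m p) = A3.pact (u m) p"
    if "u \<in> {u1, u2, u3, u4}" "m \<in> carrier M" for u m p
    by (rule A3.pact_hom) (use that in \<open>auto intro: u_closed u_add u_A2 u_comm\<close>)
  interpret A4: poly_action M A3.pact u4
    by unfold_locales (auto intro: u_closed u_add u_A3)
  have H_A1: "h (A1.pact m p) = A1.pact (h m) p" if "h \<in> H" "m \<in> carrier M" for h m p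
    by (rule A1.pact_hom) (use that in \<open>auto intro: H_closed H_add H_act H_u\<close>)
  have H_A2: "h (A2.pact m p) = A2.pact (h m) p" if "h \<in> H" "m \<in> carrier M" for h m p
    by (rule A2.pact_hom) (use that in \<open>auto intro: H_closed H_add H_A1 H_u\<close>)
  have H_A3: "h (A3.pact m p) = A3.pact (h m) p" if "h \<in> H" "m \<in> carrier M" for h m p
    by (rule A3.pact_hom) (use that in \<open>auto intro: H_closed H_add H_A2 H_u\<close>)
  have H_A4: "h (A4.pact m p) = A4.pact (h m) p" if "h \<in> H" "m \<in> carrier M" for h m p
    by (rule A4.pact_hom) (use that in \<open>auto intro: H_closed H_add H_A3 H_u\<close>)
  have H_zero: "h \<zero> = \<zero>" if "h \<in> H" for h
    using H_add[OF that, of \<zero> \<zero>] H_closed[OF that, of \<zero>] by (simp add: A0.add.l_cancel_one')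
  \<comment> \<open>Simplicity enters only here, at the top of the tower; the lower rings inherit
    the property through their constants.\<close>
  have d4: A4.P.kills_or_bij
    using simple H_closed H_zero H_A4 by (rule A4.P.kills_or_bijI)
  then have d3: A3.P.kills_or_bij by (rule A4.kills_or_bij_base)
  then have d2: A2.P.kills_or_bij by (rule A3.kills_or_bij_base)
  then have d1: A1.P.kills_or_bij by (rule A2.kills_or_bij_base)
  have u4_power: "A4.pact m ([:0, 1:] ^ k) = (u4 ^^ k) m" if "m \<in> carrier M" for m k
    using that
  proof (induction k arbitrary: m)
    case (Suc k)
    then show ?case by (simp add: A4.P.act_mult[of m "[:0, 1:]"] funpow_swap1 del: mult_pCons_left)
  qed simp
  have up0: "act m p = A4.pact m [:[:[:[:p:]:]:]:]" if "m \<in> carrier M" for m p using that by simp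
  have u4: "u4 m = A4.pact m [:0, 1:]" if "m \<in> carrier M" for m using that by simp
  have u3: "u3 m = A4.pact m [:[:0, 1:]:]" if "m \<in> carrier M" for m using that by simp
  have u2: "u2 m = A4.pact m [:[:[:0, 1:]:]:]" if "m \<in> carrier M" for m using that by simp
  have u1: "u1 m = A4.pact m [:[:[:[:0, 1:]:]:]:]" if "m \<in> carrier M" for m using that by simp
  have sp: "\<exists>k. A4.pact m ([:0, 1:] ^ k) \<in> A4.P.span S" if m: "m \<in> carrier M" for m
  proof -
    have closed: "A4.pact n p \<in> A4.P.span S" if "n \<in> A4.P.span S" for n p
      using that S(2) by (rule A4.P.span_act)
    have C: "n \<in> carrier M" if "n \<in> A4.P.span S" for n using A4.P.span_closed[OF that S(2)] .
    have "\<exists>k. (u4 ^^ k) m \<in> A4.P.span S"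
    proof (rule gen[OF _ _ _ _ _ _ m])
      show "S \<subseteq> A4.P.span S" using A4.P.span_base[OF _ S(2)] by blast
      show "A4.P.span S \<subseteq> carrier M" using C by blast
      show "\<zero> \<in> A4.P.span S" by (rule A4.P.span_zero)
      show "m \<oplus> n \<in> A4.P.span S" if "m \<in> A4.P.span S" "n \<in> A4.P.span S" for m n
        using that S(2) by (rule A4.P.span_add)
      show "act n c \<in> A4.P.span S" if "n \<in> A4.P.span S" for n c
        using closed[OF that] up0[OF C[OF that]] by simp
      show "u n \<in> A4.P.span S" if "u \<in> {u1, u2, u3, u4}" "n \<in> A4.P.span S" for u n
        using that(1) closed[OF that(2)] u1[OF C[OF that(2)]] u2[OF C[OF that(2)]]
          u3[OF C[OF that(2)]] u4[OF C[OF that(2)]] by auto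
    qed
    then show ?thesis using u4_power[OF m] by simp
  qed
  have "\<not> A4.P.kills [:0, 1:]"
  proof
    assume "A4.P.kills [:0, 1:]"
    then have "u4 m = \<zero>" if "m \<in> carrier M" for m using that unfolding A4.P.kills_def by auto
    then show False using nz by blast
  qed
  \<comment> \<open>Spanning up to powers of \<open>u4\<close>, as granted by \<open>gen\<close>, is
    finite generation with the fourth variable itself as denominator.\<close>
  then have f4: A4.P.loc_fg unfolding A4.P.loc_fg_def
    by (intro exI[of _ "[:0, 1:]"] exI[of _ S]) (simp add: sp S)
  then have f3: A3.P.loc_fg using d4 by (intro A4.loc_fg_descend)
  then have f2: A2.P.loc_fg using d3 by (intro A3.loc_fg_descend)
  then have f1: A1.P.loc_fg using d2 by (intro A2.loc_fg_descend)
  have s0: "\<exists>c. A0.kills (r - c)" for r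
    by (rule exI[of _ r]) (simp add: A0.kills_zero)
  have s1: "\<exists>c. A1.P.kills (p - [:c:])" for p
    by (rule A1.scalar_ascend[OF d1 f1, where \<iota> = "\<lambda>c. c"]) (use s0 in simp_all)
  have s2: "\<exists>c. A2.P.kills (p - [:[:c:]:])" for p
    by (rule A2.scalar_ascend[OF d2 f2, where \<iota> = "\<lambda>c. [:c:]"]) (use s1 in \<open>auto simp: one_pCons\<close>)
  have s3: "\<exists>c. A3.P.kills (p - [:[:[:c:]:]:])" for p
    by (rule A3.scalar_ascend[OF d3 f3, where \<iota> = "\<lambda>c. [:[:c:]:]"]) (use s2 in \<open>auto simp: one_pCons\<close>)
  have s4: "\<exists>c. A4.P.kills (p - [:[:[:[:c:]:]:]:])" for p
    by (rule A4.scalar_ascend[OF d4 f4, where \<iota> = "\<lambda>c. [:[:[:c:]:]:]"]) (use s3 in \<open>auto simp: one_pCons\<close>)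
  have s: "\<exists>c. \<forall>m\<in>carrier M. A4.pact m p = act m c" for p
  proof -
    obtain c where "A4.P.kills (p - [:[:[:[:c:]:]:]:])" using s4 by blast
    then have "A4.pact m p = A4.pact m [:[:[:[:c:]:]:]:]" if "m \<in> carrier M" for m
      using that by (simp only: A4.P.act_eq_iff A4.P.kills_def)
    then have "\<forall>m\<in>carrier M. A4.pact m p = act m c" by simp
    then show ?thesis by blast
  qed
  have "\<exists>c. \<forall>m\<in>carrier M. u m = act m c" if "\<And>m. m \<in> carrier M \<Longrightarrow> u m = A4.pact m p" for u p
    using s[of p] that by simp
  from this[OF u1] this[OF u2] this[OF u3] this[OF u4] show ?thesis by blast
qed

section \<open>The quantum matrix algebra\<close>

lemma ring_of_type_simps [simp]:
  "carrier ring_of_type = UNIV" "mult ring_of_type = (*)" "one ring_of_type = 1"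
  "zero ring_of_type = 0" "add ring_of_type = (+)"
  by (simp_all add: ring_of_type_def)

lemma ring_ring_of_type: "ring (ring_of_type :: 'a::ring_1 ring)"
proof (rule ringI)
  show "abelian_group (ring_of_type :: 'a ring)"
    by (rule abelian_groupI) (auto simp: add.assoc add.commute intro: exI[of _ "- x" for x])
  show "monoid (ring_of_type :: 'a ring)"
    by (rule monoidI) (auto simp: mult.assoc)
qed (auto simp: algebra_simps)

lemma fconst_add: "fconst (a + b) = fconst a + fconst b"
  by (simp add: fconst_def single_add)

lemma fconst_mult: "fconst (a * b) = fconst a * fconst b"
  by (simp add: fconst_def mult_single)

lemma fconst_1 [simp]: "fconst 1 = 1"
  by (simp add: fconst_def)

lemma fconst_0 [simp]: "fconst 0 = 0"
  by (simp add: fconst_def)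

lemma single_word_eq:
  "Poly_Mapping.single w c = fconst c * Poly_Mapping.single w (1 :: 'k::field)"
  by (simp add: fconst_def mult_single)

lemma single_word_Cons:
  "Poly_Mapping.single (Word (g # gs)) (1 :: 'k::field) = fvar g * Poly_Mapping.single (Word gs) 1"
  by (simp add: fvar_def mult_single plus_word_def)

lemma update_eq_add_single:
  assumes "k \<notin> Poly_Mapping.keys f"
  shows "Poly_Mapping.update k v f = f + Poly_Mapping.single k (v :: 'b::comm_monoid_add)"
  using assms
  by (intro poly_mapping_eqI) (auto simp: lookup_update lookup_add lookup_single when_def in_keys_iff)

lemma poly_mapping_single_induct:
  assumes "P 0" and "\<And>k c. k \<in> A \<Longrightarrow> P (Poly_Mapping.single k c)"
    and "\<And>f g. Poly_Mapping.keys f \<subseteq> A \<Longrightarrow> Poly_Mapping.keys g \<subseteq> A \<Longrightarrow> P f \<Longrightarrow> P g \<Longrightarrow> P (f + g)"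
    and "Poly_Mapping.keys f \<subseteq> A"
  shows "P (f :: 'a \<Rightarrow>\<^sub>0 'b::comm_monoid_add)"
  using assms(4)
proof (induction f rule: update_induct)
  case const
  show ?case by (rule assms(1))
next
  case (update f k c)
  then have "Poly_Mapping.keys f \<subseteq> A" "k \<in> A" by (auto simp: keys_update split: if_splits)
  moreover from this have "Poly_Mapping.keys (Poly_Mapping.single k c) \<subseteq> A" by auto
  ultimately show ?case using update assms(2,3) by (simp add: update_eq_add_single)
qed

text \<open>Every element is a sum of scaled words and every word a product of variables; thus
  centrality of scalars, stability of subspaces and homomorphism properties are checked on constants
  and variables only.\<close>

lemma falg_induct [case_names const var add mult]:
  assumes const: "\<And>c. P (fconst c)" and var: "\<And>g. P (fvar g)"
    and add: "\<And>f g. P f \<Longrightarrow> P g \<Longrightarrow> P (f + g)" and mult: "\<And>f g. P f \<Longrightarrow> P g \<Longrightarrow> P (f * g)"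
  shows "P (f :: 'k::field falg)"
proof (rule poly_mapping_single_induct[of P UNIV])
  show "P 0" using const[of 0] by simp
  show "P (Poly_Mapping.single w c)" for w c
  proof -
    have "P (Poly_Mapping.single (Word gs) 1)" for gs
    proof (induction gs)
      case Nil
      then show ?case using const[of 1] by (simp flip: zero_word_def)
    next
      case (Cons g gs)
      then show ?case unfolding single_word_Cons by (intro mult var)
    qed
    then show ?thesis using const mult by (cases w) (simp add: single_word_eq[of _ c])
  qed
qed (use add in auto)

lemma fconst_commute: "fconst c * f = f * fconst c"
proof (induction f rule: falg_induct)
  case (const d)
  then show ?case by (simp flip: fconst_mult add: mult.commute)
next
  case (var g)
  then show ?case by (simp add: fconst_def fvar_def mult_single)
next
  case (add f g)
  then show ?case by (simp add: algebra_simps)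
next
  case (mult f g)
  then show ?case by (metis mult.assoc)
qed

interpretation falg_ring: ring "ring_of_type :: 'k::field falg ring"
  by (rule ring_ring_of_type)

lemma ideal_M2_ideal: "ideal (M2_ideal \<alpha> \<beta>) ring_of_type"
  unfolding M2_ideal_def by (rule falg_ring.genideal_ideal) simp

lemma ring_M2: "ring (M2 \<alpha> \<beta>)"
  unfolding M2_def using ideal_M2_ideal by (rule ideal.quotient_is_ring)

lemma M2_class_hom: "M2_class \<alpha> \<beta> \<in> ring_hom ring_of_type (M2 \<alpha> \<beta>)"
proof -
  have "M2_class \<alpha> \<beta> = (+>\<^bsub>ring_of_type\<^esub>) (M2_ideal \<alpha> \<beta>)"
    by (simp add: fun_eq_iff M2_class_def)
  then show ?thesis
    unfolding M2_def by (simp only: ideal.rcos_ring_hom[OF ideal_M2_ideal])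
qed

lemma M2_class_simps:
  "M2_class \<alpha> \<beta> (f + g) = M2_class \<alpha> \<beta> f \<oplus>\<^bsub>M2 \<alpha> \<beta>\<^esub> M2_class \<alpha> \<beta> g"
  "M2_class \<alpha> \<beta> (f * g) = M2_class \<alpha> \<beta> f \<otimes>\<^bsub>M2 \<alpha> \<beta>\<^esub> M2_class \<alpha> \<beta> g"
  "M2_class \<alpha> \<beta> 1 = \<one>\<^bsub>M2 \<alpha> \<beta>\<^esub>"
  using ring_hom_add[OF M2_class_hom] ring_hom_mult[OF M2_class_hom] ring_hom_one[OF M2_class_hom]
  by simp_all

lemma M2_class_closed [simp]: "M2_class \<alpha> \<beta> f \<in> carrier (M2 \<alpha> \<beta>)"
  using ring_hom_closed[OF M2_class_hom] by simp

lemma M2_class_power: "M2_class \<alpha> \<beta> (f ^ k) = M2_class \<alpha> \<beta> f [^]\<^bsub>M2 \<alpha> \<beta>\<^esub> k"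
proof -
  interpret ring "M2 \<alpha> \<beta>" by (rule ring_M2)
  show ?thesis by (induction k) (simp_all add: M2_class_simps power_Suc2 del: power_Suc)
qed

lemma carrier_M2: "carrier (M2 \<alpha> \<beta>) = range (M2_class \<alpha> \<beta>)"
  unfolding M2_def M2_class_def by (auto simp: FactRing_def A_RCOSETS_def')

lemma M2_class_eq_iff: "M2_class \<alpha> \<beta> f = M2_class \<alpha> \<beta> g \<longleftrightarrow> f - g \<in> M2_ideal \<alpha> \<beta>"
proof -
  interpret ideal "M2_ideal \<alpha> \<beta>" ring_of_type by (rule ideal_M2_ideal)
  have minus: "\<ominus>\<^bsub>ring_of_type\<^esub> g = - g" by (rule falg_ring.minus_equality) simp_all
  have "f - g \<in> M2_ideal \<alpha> \<beta> \<longleftrightarrow> f \<in> M2_ideal \<alpha> \<beta> +>\<^bsub>ring_of_type\<^esub> g"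
    using a_rcos_module[of g f] minus by (simp add: a_minus_def)
  also have "\<dots> \<longleftrightarrow> M2_ideal \<alpha> \<beta> +>\<^bsub>ring_of_type\<^esub> f = M2_ideal \<alpha> \<beta> +>\<^bsub>ring_of_type\<^esub> g"
    using a_repr_independence'[of f g] a_rcos_self[of f] by auto
  finally show ?thesis unfolding M2_class_def by simp
qed

lemma M2_relation_class: "f \<in> M2_relations \<alpha> \<beta> \<Longrightarrow> M2_class \<alpha> \<beta> f = M2_class \<alpha> \<beta> 0"
  unfolding M2_class_eq_iff M2_ideal_def
  using falg_ring.genideal_self[of "M2_relations \<alpha> \<beta>"] by auto

lemma in_M2_class_iff: "g \<in> M2_class \<alpha> \<beta> f \<longleftrightarrow> M2_class \<alpha> \<beta> g = M2_class \<alpha> \<beta> f"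
proof -
  interpret ideal "M2_ideal \<alpha> \<beta>" ring_of_type by (rule ideal_M2_ideal)
  show ?thesis unfolding M2_class_def
    using a_repr_independence'[of g f] a_rcos_self[of g] by auto
qed

text \<open>Every element of the quotient is the class of an element of the free algebra, so a
  module over the quotient is handled as a right action of the free algebra under which the
  relations act as zero. This avoids arithmetic with cosets.\<close>

abbreviation falg_ract ::
    "'k::field \<Rightarrow> 'k \<Rightarrow> ('k falg set, 'm) rmodule \<Rightarrow> 'm \<Rightarrow> 'k falg \<Rightarrow> 'm" where
  "falg_ract \<alpha> \<beta> N m f \<equiv> m \<star>\<^bsub>N\<^esub> M2_class \<alpha> \<beta> f"

lemma falg_ract_ring_action:
  assumes "right_module (M2 \<alpha> \<beta>) N"
  shows "ring_action N (falg_ract \<alpha> \<beta> N)"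
proof -
  interpret right_module "M2 \<alpha> \<beta>" N by fact
  show ?thesis
    by unfold_locales
      (simp_all add: ract_closed ract_add_left ract_add_right ract_mult ract_one M2_class_simps)
qed

lemma fconst_ract_comm_ring_action:
  assumes "right_module (M2 \<alpha> \<beta>) N"
  shows "comm_ring_action N (\<lambda>m c. falg_ract \<alpha> \<beta> N m (fconst c))"
proof -
  interpret ring_action N "falg_ract \<alpha> \<beta> N" using assms by (rule falg_ract_ring_action)
  show ?thesis
    by unfold_locales (simp_all add: fconst_add fconst_mult add_act act_add act_mult)
qed

lemma right_submoduleI:
  assumes N: "right_module (M2 \<alpha> \<beta>) N"
    and U: "U \<subseteq> carrier N" "\<zero>\<^bsub>N\<^esub> \<in> U" "\<And>m n. m \<in> U \<Longrightarrow> n \<in> U \<Longrightarrow> m \<oplus>\<^bsub>N\<^esub> n \<in> U"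
    and const: "\<And>m c. m \<in> U \<Longrightarrow> falg_ract \<alpha> \<beta> N m (fconst c) \<in> U"
    and var: "\<And>m g. m \<in> U \<Longrightarrow> falg_ract \<alpha> \<beta> N m (fvar g) \<in> U"
  shows "right_submodule (M2 \<alpha> \<beta>) N U"
  unfolding right_submodule_def
proof
  interpret ring_action N "falg_ract \<alpha> \<beta> N" using N by (rule falg_ract_ring_action)
  have all: "m \<in> U \<Longrightarrow> falg_ract \<alpha> \<beta> N m f \<in> U" for m f
  proof (induction f arbitrary: m rule: falg_induct)
    case (add f g)
    then show ?case using U by (subst act_add) auto
  next
    case (mult f g)
    then show ?case using U by (subst act_mult) auto
  qed (use const var in auto)
  show "subgroup U (add_monoid N)"
  proof
    fix m assume m: "m \<in> U"
    then have "\<ominus>\<^bsub>N\<^esub> m = falg_ract \<alpha> \<beta> N m (- 1)" using U by (subst act_uminus) auto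
    then show "inv\<^bsub>add_monoid N\<^esub> m \<in> U" using all[OF m, of "- 1"] by (simp add: a_inv_def)
  qed (use U in auto)
  show "\<forall>u\<in>U. \<forall>r\<in>carrier (M2 \<alpha> \<beta>). u \<star>\<^bsub>N\<^esub> r \<in> U" using all by (auto simp: carrier_M2)
qed

lemma right_submoduleD:
  assumes "right_submodule (M2 \<alpha> \<beta>) N U"
  shows "U \<subseteq> carrier N" "\<zero>\<^bsub>N\<^esub> \<in> U" "\<And>m n. m \<in> U \<Longrightarrow> n \<in> U \<Longrightarrow> m \<oplus>\<^bsub>N\<^esub> n \<in> U"
    "\<And>m f. m \<in> U \<Longrightarrow> falg_ract \<alpha> \<beta> N m f \<in> U"
  using assms subgroup.subset[of U "add_monoid N"] subgroup.one_closed[of U "add_monoid N"]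
    subgroup.m_closed[of U "add_monoid N"]
  unfolding right_submodule_def by auto

text \<open>The homomorphism starts at the explicit module, where prescribing images of basis
  vectors defines it; the isomorphism asked for is its inverse. Being nonzero, it has zero kernel
  because \<open>V\<close> is simple and full image because \<open>N\<close> is.\<close>

lemma simple_hom_imp_iso:
  assumes V: "simple_right_module (M2 \<alpha> \<beta>) V" and N: "simple_right_module (M2 \<alpha> \<beta>) N"
    and closed: "\<And>v. v \<in> carrier V \<Longrightarrow> \<Phi> v \<in> carrier N"
    and add: "\<And>v w. v \<in> carrier V \<Longrightarrow> w \<in> carrier V \<Longrightarrow> \<Phi> (v \<oplus>\<^bsub>V\<^esub> w) = \<Phi> v \<oplus>\<^bsub>N\<^esub> \<Phi> w"
    and hom: "\<And>v f. v \<in> carrier V \<Longrightarrow> \<Phi> (falg_ract \<alpha> \<beta> V v f) = falg_ract \<alpha> \<beta> N (\<Phi> v) f"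
    and nz: "\<exists>v\<in>carrier V. \<Phi> v \<noteq> \<zero>\<^bsub>N\<^esub>"
  shows "right_module_iso (M2 \<alpha> \<beta>) N V"
proof -
  have rm: "right_module (M2 \<alpha> \<beta>) V" "right_module (M2 \<alpha> \<beta>) N"
    using V N unfolding simple_right_module_def by auto
  interpret V: ring_action V "falg_ract \<alpha> \<beta> V" using rm(1) by (rule falg_ract_ring_action)
  interpret N: ring_action N "falg_ract \<alpha> \<beta> N" using rm(2) by (rule falg_ract_ring_action)
  have zero: "\<Phi> \<zero>\<^bsub>V\<^esub> = \<zero>\<^bsub>N\<^esub>"
    using add[of "\<zero>\<^bsub>V\<^esub>" "\<zero>\<^bsub>V\<^esub>"] closed[of "\<zero>\<^bsub>V\<^esub>"] by (simp add: N.add.l_cancel_one')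
  have minus: "\<Phi> (v \<ominus>\<^bsub>V\<^esub> w) = \<Phi> v \<ominus>\<^bsub>N\<^esub> \<Phi> w" if "v \<in> carrier V" "w \<in> carrier V" for v w
  proof -
    have "\<ominus>\<^bsub>V\<^esub> w = falg_ract \<alpha> \<beta> V w (- 1)" using that by (simp add: V.act_uminus)
    then have "\<Phi> (\<ominus>\<^bsub>V\<^esub> w) = \<ominus>\<^bsub>N\<^esub> \<Phi> w" using that closed by (simp add: hom N.act_uminus)
    then show ?thesis using that by (simp add: V.minus_eq N.minus_eq add)
  qed
  have "right_submodule (M2 \<alpha> \<beta>) V {v \<in> carrier V. \<Phi> v = \<zero>\<^bsub>N\<^esub>}"
    by (rule right_submoduleI[OF rm(1)]) (auto simp: zero add hom)
  then have ker: "{v \<in> carrier V. \<Phi> v = \<zero>\<^bsub>N\<^esub>} = {\<zero>\<^bsub>V\<^esub>}"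
    using V nz unfolding simple_right_module_def by blast
  have "right_submodule (M2 \<alpha> \<beta>) N (\<Phi> ` carrier V)"
  proof (rule right_submoduleI[OF rm(2)])
    show "\<zero>\<^bsub>N\<^esub> \<in> \<Phi> ` carrier V" using zero by (metis V.zero_closed imageI)
    show "m \<oplus>\<^bsub>N\<^esub> n \<in> \<Phi> ` carrier V" if "m \<in> \<Phi> ` carrier V" "n \<in> \<Phi> ` carrier V" for m n
      using that by (auto simp flip: add)
  qed (use closed in \<open>auto simp flip: hom\<close>)
  then have im: "\<Phi> ` carrier V = carrier N"
    using N nz unfolding simple_right_module_def by blast
  have inj: "inj_on \<Phi> (carrier V)"
  proof (rule inj_onI)
    fix v w assume vw: "v \<in> carrier V" "w \<in> carrier V" "\<Phi> v = \<Phi> w"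
    then have "\<Phi> (v \<ominus>\<^bsub>V\<^esub> w) = \<zero>\<^bsub>N\<^esub>" using minus N.eq_iff_diff_zero closed by metis
    then have "v \<ominus>\<^bsub>V\<^esub> w = \<zero>\<^bsub>V\<^esub>" using ker vw by auto
    then show "v = w" using V.eq_iff_diff_zero vw by blast
  qed
  define \<Psi> where "\<Psi> = inv_into (carrier V) \<Phi>"
  have bij: "bij_betw \<Psi> (carrier N) (carrier V)"
    unfolding \<Psi>_def using inj im by (intro bij_betw_inv_into) (simp add: bij_betw_def)
  have \<Psi>: "\<Psi> m \<in> carrier V" "\<Phi> (\<Psi> m) = m" if "m \<in> carrier N" for m
    using that im unfolding \<Psi>_def by (auto simp: inv_into_into f_inv_into_f)
  have \<Psi>\<Phi>: "\<Psi> (\<Phi> v) = v" if "v \<in> carrier V" for v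
    using that inj unfolding \<Psi>_def by simp
  show ?thesis unfolding right_module_iso_def
  proof (intro exI[of _ \<Psi>] conjI ballI bij)
    fix m n assume "m \<in> carrier N" "n \<in> carrier N"
    then show "\<Psi> (m \<oplus>\<^bsub>N\<^esub> n) = \<Psi> m \<oplus>\<^bsub>V\<^esub> \<Psi> n"
      using \<Psi> \<Psi>\<Phi>[of "\<Psi> m \<oplus>\<^bsub>V\<^esub> \<Psi> n"] by (simp add: add)
  next
    fix m r assume "m \<in> carrier N" "r \<in> carrier (M2 \<alpha> \<beta>)"
    moreover then obtain f where "r = M2_class \<alpha> \<beta> f" by (auto simp: carrier_M2)
    ultimately show "\<Psi> (m \<star>\<^bsub>N\<^esub> r) = \<Psi> m \<star>\<^bsub>V\<^esub> r"
      using \<Psi> \<Psi>\<Phi>[of "falg_ract \<alpha> \<beta> V (\<Psi> m) f"] by (simp add: hom)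
  qed
qed

section \<open>Modules with a basis\<close>

lemma lookup_vscale [simp]: "Poly_Mapping.lookup (vscale c v) p = c * Poly_Mapping.lookup v p"
  by (simp add: vscale_def Poly_Mapping.map.rep_eq when_def)

lemma vscale_add_right: "vscale c (v + w) = vscale c v + vscale c w"
  by (rule poly_mapping_eqI) (simp add: lookup_add algebra_simps)

lemma vscale_add_left: "vscale (c + d) v = vscale c v + vscale d v"
  by (rule poly_mapping_eqI) (simp add: lookup_add algebra_simps)

lemma vscale_vscale [simp]: "vscale c (vscale d v) = vscale (c * d) v"
  by (rule poly_mapping_eqI) (simp add: algebra_simps)

lemma vscale_simps [simp]: "vscale 1 v = v" "vscale 0 v = 0" "vscale c 0 = 0"
  by (rule poly_mapping_eqI, simp)+

lemma vscale_single [simp]: "vscale c (Poly_Mapping.single p d) = Poly_Mapping.single p (c * d)"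
  by (rule poly_mapping_eqI) (simp add: lookup_single when_def)

lemma vscale_sum: "vscale c (sum f A) = (\<Sum>x\<in>A. vscale c (f x))"
  by (induction A rule: infinite_finite_induct) (simp_all add: vscale_add_right)

lemma keys_vscale: "Poly_Mapping.keys (vscale c v) \<subseteq> Poly_Mapping.keys v"
  by (auto simp: in_keys_iff)

lemma keys_add_subset:
  "Poly_Mapping.keys v \<subseteq> A \<Longrightarrow> Poly_Mapping.keys w \<subseteq> A \<Longrightarrow> Poly_Mapping.keys (v + w) \<subseteq> A"
  using Poly_Mapping.keys_add[of v w] by (meson Un_least order_trans)

lemma lin_ext_superset:
  assumes "finite A" "Poly_Mapping.keys v \<subseteq> A"
  shows "lin_ext T v = (\<Sum>p\<in>A. vscale (Poly_Mapping.lookup v p) (T p))"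
  unfolding lin_ext_def
  by (rule sum.mono_neutral_left) (use assms in \<open>auto simp: in_keys_iff\<close>)

lemma lin_ext_add: "lin_ext T (v + w) = lin_ext T v + lin_ext T w"
proof -
  let ?A = "Poly_Mapping.keys v \<union> Poly_Mapping.keys w"
  have "Poly_Mapping.keys (v + w) \<subseteq> ?A" by (rule Poly_Mapping.keys_add)
  then show ?thesis
    by (simp add: lin_ext_superset[of ?A] lookup_add vscale_add_left sum.distrib)
qed

lemma lin_ext_vscale: "lin_ext T (vscale c v) = vscale c (lin_ext T v)"
  by (simp add: lin_ext_superset[OF _ keys_vscale] vscale_sum) (simp add: lin_ext_def vscale_sum)

lemma lin_ext_single [simp]: "lin_ext T (Poly_Mapping.single p c) = vscale c (T p)"
  by (simp add: lin_ext_superset[of "{p}"])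

lemma lin_ext_zero [simp]: "lin_ext T 0 = 0"
  by (simp add: lin_ext_def)

lemma word_act_add: "word_act T w (u + v) = word_act T w u + word_act T w v"
proof -
  have "fold (\<lambda>g. lin_ext (T g)) gs (u + v)
      = fold (\<lambda>g. lin_ext (T g)) gs u + fold (\<lambda>g. lin_ext (T g)) gs v" for gs
    by (induction gs arbitrary: u v) (simp_all add: lin_ext_add)
  then show ?thesis by (simp add: word_act_def)
qed

lemma word_act_vscale: "word_act T w (vscale c v) = vscale c (word_act T w v)"
proof -
  have "fold (\<lambda>g. lin_ext (T g)) gs (vscale c v) = vscale c (fold (\<lambda>g. lin_ext (T g)) gs v)" for gs
    by (induction gs arbitrary: v) (simp_all add: lin_ext_vscale)
  then show ?thesis by (simp add: word_act_def)
qed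

lemma word_act_plus: "word_act T (u + w) v = word_act T w (word_act T u v)"
  by (simp add: word_act_def plus_word_def)

lemma falg_act_superset:
  assumes "finite A" "Poly_Mapping.keys f \<subseteq> A"
  shows "falg_act T f v = (\<Sum>w\<in>A. vscale (Poly_Mapping.lookup f w) (word_act T w v))"
  unfolding falg_act_def
  by (rule sum.mono_neutral_left) (use assms in \<open>auto simp: in_keys_iff\<close>)

lemma falg_act_add_left: "falg_act T f (u + v) = falg_act T f u + falg_act T f v"
  by (simp add: falg_act_def word_act_add vscale_add_right sum.distrib)

lemma falg_act_vscale: "falg_act T f (vscale c v) = vscale c (falg_act T f v)"
  by (simp add: falg_act_def word_act_vscale vscale_sum mult.commute)

lemma falg_act_add_right: "falg_act T (f + g) v = falg_act T f v + falg_act T g v"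
proof -
  let ?A = "Poly_Mapping.keys f \<union> Poly_Mapping.keys g"
  have "Poly_Mapping.keys (f + g) \<subseteq> ?A" by (rule Poly_Mapping.keys_add)
  then show ?thesis
    by (simp add: falg_act_superset[of ?A] lookup_add vscale_add_left sum.distrib)
qed

lemma falg_act_single: "falg_act T (Poly_Mapping.single w c) v = vscale c (word_act T w v)"
  by (simp add: falg_act_superset[of "{w}"])

lemma falg_act_zero [simp]: "falg_act T 0 v = 0" "falg_act T f 0 = 0"
  using falg_act_add_left[of T f 0 0] by (simp_all add: falg_act_def)

lemma falg_act_minus: "falg_act T (f - g) v = falg_act T f v - falg_act T g v"
  using falg_act_add_right[of T "f - g" g v] by (simp add: eq_diff_eq)

text \<open>Both sides are additive in \<open>f\<close> and in \<open>g\<close>, which reduces the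
  claim to scaled words; there concatenation means that the letters of the left factor act before
  those of the right one.\<close>

lemma falg_act_mult: "falg_act T (f * g) v = falg_act T g (falg_act T f v)"
proof (rule poly_mapping_single_induct[of "\<lambda>f. falg_act T (f * g) v = falg_act T g (falg_act T f v)" UNIV])
  show "falg_act T (Poly_Mapping.single u c * g) v = falg_act T g (falg_act T (Poly_Mapping.single u c) v)" for u c
  proof (rule poly_mapping_single_induct[of "\<lambda>g. falg_act T (Poly_Mapping.single u c * g) v
      = falg_act T g (falg_act T (Poly_Mapping.single u c) v)" UNIV])
    show "falg_act T (Poly_Mapping.single u c * Poly_Mapping.single w d) v
        = falg_act T (Poly_Mapping.single w d) (falg_act T (Poly_Mapping.single u c) v)" for w d
      by (simp add: mult_single falg_act_single word_act_plus word_act_vscale mult.commute)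
  qed (simp_all add: distrib_left falg_act_add_right)
qed (simp_all add: distrib_right falg_act_add_right falg_act_add_left)

lemma falg_act_fconst [simp]: "falg_act T (fconst c) v = vscale c v"
  by (simp add: fconst_def falg_act_single word_act_def zero_word_def)

lemma falg_act_one [simp]: "falg_act T 1 v = v"
  using falg_act_fconst[of T 1 v] by simp

lemma falg_act_fvar [simp]: "falg_act T (fvar g) v = lin_ext (T g) v"
  by (simp add: fvar_def falg_act_single word_act_def)

text \<open>\<open>T\<close> is a function on all pairs, also outside the box, so closure and
  relations are demanded on basis vectors of the box only; linearity then covers all vectors
  supported there.\<close>

locale basis_action =
  fixes \<alpha> \<beta> :: "'k::field" and n1 n2 :: nat and T :: "gen \<Rightarrow> nat \<times> nat \<Rightarrow> 'k vec"
  assumes T_closed: "\<And>g p. p \<in> {..<n1} \<times> {..<n2} \<Longrightarrow> Poly_Mapping.keys (T g p) \<subseteq> {..<n1} \<times> {..<n2}"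
    and T_rel: "\<And>r p. r \<in> M2_relations \<alpha> \<beta> \<Longrightarrow> p \<in> {..<n1} \<times> {..<n2} \<Longrightarrow> falg_act T r (e_vec 1 p) = 0"
begin

abbreviation box :: "(nat \<times> nat) set" where "box \<equiv> {..<n1} \<times> {..<n2}"

abbreviation V :: "('k falg set, 'k vec) rmodule" where "V \<equiv> basis_module n1 n2 T"

lemma V_simps [simp]:
  "carrier V = {v. Poly_Mapping.keys v \<subseteq> box}" "\<zero>\<^bsub>V\<^esub> = 0" "add V = (+)"
  by (simp_all add: basis_module_def)

lemma abelian_group_V: "abelian_group V"
proof (rule abelian_groupI)
  fix v assume "v \<in> carrier V"
  then show "\<exists>w\<in>carrier V. w \<oplus>\<^bsub>V\<^esub> v = \<zero>\<^bsub>V\<^esub>"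
    by (intro bexI[of _ "- v"]) (auto simp: in_keys_iff)
qed (simp_all add: add_ac keys_add_subset)

lemma vec_induct [consumes 1, case_names zero single add]:
  assumes "Poly_Mapping.keys v \<subseteq> box" "P 0" "\<And>p c. p \<in> box \<Longrightarrow> P (e_vec c p)"
    "\<And>v w. Poly_Mapping.keys v \<subseteq> box \<Longrightarrow> Poly_Mapping.keys w \<subseteq> box \<Longrightarrow> P v \<Longrightarrow> P w \<Longrightarrow> P (v + w)"
  shows "P (v :: 'k vec)"
  using assms(2-4,1) by (rule poly_mapping_single_induct)

lemma e_vec_vscale: "e_vec c p = vscale c (e_vec 1 p)"
  by simp

lemma falg_act_closed:
  "Poly_Mapping.keys v \<subseteq> box \<Longrightarrow> Poly_Mapping.keys (falg_act T f v) \<subseteq> box"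
proof (induction f arbitrary: v rule: falg_induct)
  case (const c)
  then show ?case using keys_vscale[of c v] by auto
next
  case (var g)
  have "Poly_Mapping.keys (lin_ext (T g) v) \<subseteq> box" using var
  proof (induction v rule: vec_induct)
    case (single p c)
    then show ?case using keys_vscale[of c "T g p"] T_closed[of p g] by auto
  next
    case (add v w)
    then show ?case unfolding lin_ext_add by (intro keys_add_subset)
  qed simp
  then show ?case by simp
next
  case (add f g)
  then show ?case unfolding falg_act_add_right by (intro keys_add_subset)
next
  case (mult f g)
  then show ?case by (simp add: falg_act_mult)
qed

lemma falg_act_relation:
  assumes "r \<in> M2_relations \<alpha> \<beta>" "Poly_Mapping.keys v \<subseteq> box"
  shows "falg_act T r v = 0"
  using assms(2)
proof (induction v rule: vec_induct)
  case (single p c)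
  then show ?case using T_rel[OF assms(1)] by (subst e_vec_vscale) (simp only: falg_act_vscale, simp)
qed (simp_all add: falg_act_add_left)

text \<open>The elements acting as zero on vectors supported in the box form a two-sided ideal that
  contains the relations. That the box is preserved is what makes this ideal absorb factors on the
  left.\<close>

lemma falg_act_ideal:
  assumes "r \<in> M2_ideal \<alpha> \<beta>" "Poly_Mapping.keys v \<subseteq> box"
  shows "falg_act T r v = 0"
proof -
  define I where "I = {f. \<forall>v. Poly_Mapping.keys v \<subseteq> box \<longrightarrow> falg_act T f v = 0}"
  have minus: "\<ominus>\<^bsub>ring_of_type\<^esub> f = - f" for f :: "'k falg"
    by (rule falg_ring.minus_equality) simp_all
  have "ideal I ring_of_type"
  proof (rule idealI[OF ring_ring_of_type])
    show "subgroup I (add_monoid ring_of_type)"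
    proof
      fix f :: "'k falg" assume f: "f \<in> I"
      have "falg_act T (- f) v = - falg_act T f v" for v using falg_act_minus[of T 0 f v] by simp
      then have "- f \<in> I" using f by (simp add: I_def)
      then show "inv\<^bsub>add_monoid ring_of_type\<^esub> f \<in> I" using minus by (simp add: a_inv_def)
    qed (auto simp: I_def falg_act_add_right)
  qed (auto simp: I_def falg_act_mult falg_act_closed)
  moreover have "M2_relations \<alpha> \<beta> \<subseteq> I" using falg_act_relation by (auto simp: I_def)
  ultimately have "M2_ideal \<alpha> \<beta> \<subseteq> I" unfolding M2_ideal_def by (rule falg_ring.genideal_minimal)
  then show ?thesis using assms by (auto simp: I_def)
qed

text \<open>The coset acts through a representative picked by \<open>SOME\<close>; any two
  representatives differ by an element of the ideal, which acts as zero.\<close>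

lemma V_ract:
  assumes "Poly_Mapping.keys v \<subseteq> box"
  shows "falg_ract \<alpha> \<beta> V v f = falg_act T f v"
proof -
  define f' where "f' = (SOME g. g \<in> M2_class \<alpha> \<beta> f)"
  have "f' \<in> M2_class \<alpha> \<beta> f" unfolding f'_def
    by (rule someI[of _ f]) (simp add: in_M2_class_iff)
  then have "f' - f \<in> M2_ideal \<alpha> \<beta>" by (simp add: in_M2_class_iff M2_class_eq_iff)
  then have "falg_act T f' v = falg_act T f v"
    using falg_act_ideal[OF _ assms, of "f' - f"] by (simp add: falg_act_minus)
  then show ?thesis by (simp add: basis_module_def f'_def)
qed

lemma right_module_V: "right_module (M2 \<alpha> \<beta>) V"
proof (intro right_module.intro right_module_axioms.intro ring_M2 abelian_group_V)
  fix v w r s assume v: "v \<in> carrier V" and r: "r \<in> carrier (M2 \<alpha> \<beta>)"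
  obtain f where f: "r = M2_class \<alpha> \<beta> f" using r by (auto simp: carrier_M2)
  show "v \<star>\<^bsub>V\<^esub> r \<in> carrier V" using v by (simp add: f V_ract falg_act_closed)
  show "(v \<oplus>\<^bsub>V\<^esub> w) \<star>\<^bsub>V\<^esub> r = v \<star>\<^bsub>V\<^esub> r \<oplus>\<^bsub>V\<^esub> w \<star>\<^bsub>V\<^esub> r" if "w \<in> carrier V"
  proof -
    have "Poly_Mapping.keys (v + w) \<subseteq> box" using v that by (simp add: keys_add_subset)
    then show ?thesis using v that by (simp add: f V_ract falg_act_add_left)
  qed
  assume "s \<in> carrier (M2 \<alpha> \<beta>)"
  then obtain g where g: "s = M2_class \<alpha> \<beta> g" by (auto simp: carrier_M2)
  show "v \<star>\<^bsub>V\<^esub> (r \<oplus>\<^bsub>M2 \<alpha> \<beta>\<^esub> s) = v \<star>\<^bsub>V\<^esub> r \<oplus>\<^bsub>V\<^esub> v \<star>\<^bsub>V\<^esub> s"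
    using v by (simp add: f g V_ract falg_act_add_right flip: M2_class_simps)
  show "v \<star>\<^bsub>V\<^esub> (r \<otimes>\<^bsub>M2 \<alpha> \<beta>\<^esub> s) = v \<star>\<^bsub>V\<^esub> r \<star>\<^bsub>V\<^esub> s"
    using v by (simp add: f g V_ract falg_act_mult falg_act_closed flip: M2_class_simps)
next
  fix v assume "v \<in> carrier V"
  then show "v \<star>\<^bsub>V\<^esub> \<one>\<^bsub>M2 \<alpha> \<beta>\<^esub> = v" by (simp add: V_ract flip: M2_class_simps)
qed

definition reaches :: "nat \<times> nat \<Rightarrow> nat \<times> nat \<Rightarrow> bool" where
  "reaches p q \<longleftrightarrow> (\<exists>f c. c \<noteq> 0 \<and> falg_act T f (e_vec 1 p) = e_vec c q)"

lemma reaches_refl: "reaches p p"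
  unfolding reaches_def by (intro exI[of _ 1]) simp

lemma reachesI: "T g p = e_vec c q \<Longrightarrow> c \<noteq> 0 \<Longrightarrow> reaches p q"
  unfolding reaches_def by (intro exI[of _ "fvar g"] exI[of _ c]) simp

lemma reaches_trans:
  assumes "reaches p q" "reaches q r" shows "reaches p r"
proof -
  obtain f c where f: "c \<noteq> 0" "falg_act T f (e_vec 1 p) = e_vec c q"
    using assms(1) by (auto simp: reaches_def)
  obtain g d where g: "d \<noteq> 0" "falg_act T g (e_vec 1 q) = e_vec d r"
    using assms(2) by (auto simp: reaches_def)
  have "falg_act T (f * g) (e_vec 1 p) = e_vec (c * d) r"
    by (simp add: falg_act_mult f) (subst e_vec_vscale, simp only: falg_act_vscale g, simp)
  then show ?thesis unfolding reaches_def using f g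
    by (intro exI[of _ "f * g"] exI[of _ "c * d"]) simp
qed

lemma reaches_cycle:
  assumes step: "\<And>i. i < n \<Longrightarrow> reaches (p i) (p (Suc i mod n))" and "i < n" "j < n"
  shows "reaches (p i) (p j)"
proof -
  have "reaches (p i) (p ((i + k) mod n))" for k
  proof (induction k)
    case (Suc k)
    have "reaches (p ((i + k) mod n)) (p (Suc ((i + k) mod n) mod n))"
      using assms by (intro step) simp
    with Suc show ?case by (auto intro: reaches_trans simp: mod_Suc_eq)
  qed (use assms reaches_refl in simp)
  \<comment> \<open>Going round the cycle: \<open>i + (n - i + j)\<close> is \<open>n + j\<close>,
    which is \<open>j\<close> modulo \<open>n\<close>.\<close>
  from this[of "n - i + j"] show ?thesis using assms by simp
qed

text \<open>Elements acting diagonally with joint eigenvalues that separate the basis vectors force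
  every nonzero submodule to contain a basis vector.\<close>

lemma simple_V:
  assumes pos: "n1 > 0" "n2 > 0"
    and sep: "\<And>p q. p \<in> box \<Longrightarrow> q \<in> box \<Longrightarrow> p \<noteq> q \<Longrightarrow>
      \<exists>d ev. ev p \<noteq> ev q \<and> (\<forall>r\<in>box. falg_act T d (e_vec 1 r) = e_vec (ev r) r)"
    and reach: "\<And>p q. p \<in> box \<Longrightarrow> q \<in> box \<Longrightarrow> reaches p q"
  shows "simple_right_module (M2 \<alpha> \<beta>) V"
  unfolding simple_right_module_def
proof (intro conjI allI impI right_module_V)
  have "e_vec 1 (0, 0) \<in> carrier V" "e_vec 1 (0, 0) \<noteq> \<zero>\<^bsub>V\<^esub>"
    using pos by (auto dest: arg_cong[of _ _ "\<lambda>v. Poly_Mapping.lookup v (0, 0)"])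
  then show "carrier V \<noteq> {\<zero>\<^bsub>V\<^esub>}" by blast
next
  fix U assume sub: "right_submodule (M2 \<alpha> \<beta>) V U"
  have UV: "Poly_Mapping.keys v \<subseteq> box" if "v \<in> U" for v using right_submoduleD(1)[OF sub] that by auto
  have U0: "0 \<in> U" using right_submoduleD(2)[OF sub] by simp
  have Uadd: "v + w \<in> U" if "v \<in> U" "w \<in> U" for v w using right_submoduleD(3)[OF sub that] by simp
  have Uact: "falg_act T f v \<in> U" if "v \<in> U" for v f
    using right_submoduleD(4)[OF sub that] V_ract UV that by simp
  have Uscale: "vscale c v \<in> U" if "v \<in> U" for v c using Uact[OF that, of "fconst c"] by simp
  have Udiff: "v - w \<in> U" if "v \<in> U" "w \<in> U" for v w
  proof -
    have "v - w = v + vscale (- 1) w" by (rule poly_mapping_eqI) (simp add: lookup_add lookup_minus)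
    then show ?thesis using Uadd[OF that(1) Uscale[OF that(2), of "- 1"]] by (simp only:)
  qed
  have lookup_diag: "Poly_Mapping.lookup (falg_act T d v) p = ev p * Poly_Mapping.lookup v p"
    if "\<And>r. r \<in> box \<Longrightarrow> falg_act T d (e_vec 1 r) = e_vec (ev r) r" "Poly_Mapping.keys v \<subseteq> box" for d ev v p
    using that(2)
  proof (induction v rule: vec_induct)
    case (single q c)
    then have "falg_act T d (e_vec c q) = e_vec (c * ev q) q"
      using that(1) by (subst e_vec_vscale) (simp only: falg_act_vscale, simp)
    then show ?case by (simp add: lookup_single when_def)
  qed (simp_all add: falg_act_add_left lookup_add distrib_left)
  show "U = {\<zero>\<^bsub>V\<^esub>} \<or> U = carrier V"
  proof (cases "U = {0}")
    case False
    then obtain v0 where v0: "v0 \<in> U \<and> v0 \<noteq> 0" using U0 by blast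
    have "\<exists>v. (v \<in> U \<and> v \<noteq> 0) \<and>
      (\<forall>w. w \<in> U \<and> w \<noteq> 0 \<longrightarrow> card (Poly_Mapping.keys v) \<le> card (Poly_Mapping.keys w))"
      using v0 by (rule ex_has_least_nat)
    then obtain v where v: "v \<in> U" "v \<noteq> 0"
      and min: "\<And>w. w \<in> U \<Longrightarrow> w \<noteq> 0 \<Longrightarrow> card (Poly_Mapping.keys v) \<le> card (Poly_Mapping.keys w)"
      by blast
    obtain p where p: "p \<in> Poly_Mapping.keys v" using v(2) by (metis all_not_in_conv keys_eq_empty)
    have single: "q = p" if q: "q \<in> Poly_Mapping.keys v" for q
    proof (rule ccontr)
      assume "q \<noteq> p"
      then obtain d ev where d: "ev q \<noteq> ev p"
        "\<And>r. r \<in> box \<Longrightarrow> falg_act T d (e_vec 1 r) = e_vec (ev r) r"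
        using sep[of q p] UV[OF v(1)] p q by blast
      \<comment> \<open>A second basis vector \<open>q\<close> in the support contradicts
        minimality: \<open>w\<close> loses the coordinate at \<open>p\<close> and keeps the one at
        \<open>q\<close>.\<close>
      define w where "w = falg_act T d v - vscale (ev p) v"
      have w: "Poly_Mapping.lookup w r = (ev r - ev p) * Poly_Mapping.lookup v r" for r
        using lookup_diag[OF d(2) UV[OF v(1)]] by (simp add: w_def lookup_minus algebra_simps)
      have "w \<in> U" unfolding w_def using Uact Uscale Udiff v by blast
      moreover have "Poly_Mapping.lookup w q \<noteq> 0" using w d q by (simp add: in_keys_iff)
      then have "w \<noteq> 0" by auto
      ultimately have "card (Poly_Mapping.keys v) \<le> card (Poly_Mapping.keys w)" by (rule min)
      moreover have "Poly_Mapping.keys w \<subseteq> Poly_Mapping.keys v - {p}" using w by (auto simp: in_keys_iff)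
      then have "card (Poly_Mapping.keys w) \<le> card (Poly_Mapping.keys v - {p})" by (intro card_mono) auto
      moreover have "card (Poly_Mapping.keys v - {p}) < card (Poly_Mapping.keys v)"
        using p by (intro card_Diff1_less) auto
      ultimately show False by simp
    qed
    have "v = e_vec (Poly_Mapping.lookup v p) p"
    proof (rule poly_mapping_eqI)
      fix q
      show "Poly_Mapping.lookup v q = Poly_Mapping.lookup (e_vec (Poly_Mapping.lookup v p) p) q"
        using single[of q] by (cases "q = p") (auto simp: lookup_single in_keys_iff)
    qed
    then have "vscale (inverse (Poly_Mapping.lookup v p)) v = e_vec 1 p"
      using p by (metis field_class.field_inverse in_keys_iff vscale_single)
    then have ep: "e_vec 1 p \<in> U" using Uscale[OF v(1)] by metis
    have eq: "e_vec c q \<in> U" if q: "q \<in> box" for c q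
    proof -
      obtain f d where d: "d \<noteq> 0" "falg_act T f (e_vec 1 p) = e_vec d q"
        using reach[OF _ q] UV[OF v(1)] p unfolding reaches_def by blast
      then have "e_vec d q \<in> U" using Uact[OF ep, of f] by simp
      then have "vscale (c * inverse d) (e_vec d q) \<in> U" by (rule Uscale)
      then show ?thesis using d(1) by (simp add: mult.assoc)
    qed
    have "w \<in> U" if "Poly_Mapping.keys w \<subseteq> box" for w
      using that by (induction w rule: vec_induct) (auto intro: U0 eq Uadd)
    then show ?thesis using UV by auto
  qed simp
qed

text \<open>In the explicit modules a generator sends each basis vector to a multiple, possibly
  zero, of one basis vector. Matching these single terms on the chosen images \<open>E p\<close>
  makes the linear extension a homomorphism.\<close>

lemma iso_V:
  assumes V: "simple_right_module (M2 \<alpha> \<beta>) V" and N: "simple_right_module (M2 \<alpha> \<beta>) N"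
    and E: "\<And>p. p \<in> box \<Longrightarrow> E p \<in> carrier N"
    and nz: "p0 \<in> box" "E p0 \<noteq> \<zero>\<^bsub>N\<^esub>"
    and hom: "\<And>g p. p \<in> box \<Longrightarrow> \<exists>c q. q \<in> box \<and> T g p = e_vec c q \<and>
      falg_ract \<alpha> \<beta> N (E p) (fvar g) = falg_ract \<alpha> \<beta> N (E q) (fconst c)"
  shows "right_module_iso (M2 \<alpha> \<beta>) N V"
proof -
  have rm: "right_module (M2 \<alpha> \<beta>) N"
    using N unfolding simple_right_module_def by auto
  interpret N: ring_action N "falg_ract \<alpha> \<beta> N" using rm by (rule falg_ract_ring_action)
  interpret F: comm_ring_action N "\<lambda>m c. falg_ract \<alpha> \<beta> N m (fconst c)"
    using rm by (rule fconst_ract_comm_ring_action)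
  define \<Phi> where "\<Phi> v = finsum N (\<lambda>p. falg_ract \<alpha> \<beta> N (E p) (fconst (Poly_Mapping.lookup v p))) box" for v
  have closed: "\<Phi> v \<in> carrier N" for v
    unfolding \<Phi>_def by (intro N.finsum_closed) (use E in auto)
  have \<Phi>_add: "\<Phi> (v + w) = \<Phi> v \<oplus>\<^bsub>N\<^esub> \<Phi> w" for v w
  proof -
    let ?t = "\<lambda>v p. falg_ract \<alpha> \<beta> N (E p) (fconst (Poly_Mapping.lookup v p))"
    have t: "?t v \<in> box \<rightarrow> carrier N" for v using E by auto
    have "\<Phi> (v + w) = finsum N (\<lambda>p. ?t v p \<oplus>\<^bsub>N\<^esub> ?t w p) box"
      unfolding \<Phi>_def lookup_add
      by (intro N.finsum_cong' refl Pi_I F.act_add N.a_closed F.act_closed E)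
    then show ?thesis unfolding \<Phi>_def using N.finsum_addf[OF t t] by simp
  qed
  have \<Phi>_single: "\<Phi> (e_vec c p) = falg_ract \<alpha> \<beta> N (E p) (fconst c)" if p: "p \<in> box" for c p
  proof -
    have "\<Phi> (e_vec c p) = finsum N (\<lambda>q. if p = q then falg_ract \<alpha> \<beta> N (E q) (fconst c) else \<zero>\<^bsub>N\<^esub>) box"
      unfolding \<Phi>_def by (intro N.finsum_cong') (use E in \<open>auto simp: lookup_single when_def\<close>)
    also have "\<dots> = falg_ract \<alpha> \<beta> N (E p) (fconst c)"
      using p E by (intro N.finsum_singleton) auto
    finally show ?thesis .
  qed
  have \<Phi>_zero: "\<Phi> 0 = \<zero>\<^bsub>N\<^esub>" using \<Phi>_single[OF nz(1), of 0] E nz by simp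
  have scale: "\<Phi> (vscale c v) = falg_ract \<alpha> \<beta> N (\<Phi> v) (fconst c)" if "Poly_Mapping.keys v \<subseteq> box" for c v
    using that
  proof (induction v rule: vec_induct)
    case (single p d)
    then show ?case using E F.act_mult[of "E p" d c] \<Phi>_single by (simp add: mult.commute)
  qed (simp_all add: \<Phi>_zero \<Phi>_add vscale_add_right closed F.add_act)
  have gen: "\<Phi> (lin_ext (T g) v) = falg_ract \<alpha> \<beta> N (\<Phi> v) (fvar g)" if "Poly_Mapping.keys v \<subseteq> box" for g v
    using that
  proof (induction v rule: vec_induct)
    case (single p d)
    obtain c q where q: "q \<in> box" "T g p = e_vec c q"
      "falg_ract \<alpha> \<beta> N (E p) (fvar g) = falg_ract \<alpha> \<beta> N (E q) (fconst c)" using hom[OF single] by blast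
    have "\<Phi> (lin_ext (T g) (e_vec d p)) = falg_ract \<alpha> \<beta> N (E q) (fconst (c * d))"
      using q(1) by (simp add: q \<Phi>_single mult.commute)
    also have "\<dots> = falg_ract \<alpha> \<beta> N (E p) (fvar g * fconst d)"
      using q single E by (simp add: N.act_mult fconst_mult)
    also have "\<dots> = falg_ract \<alpha> \<beta> N (\<Phi> (e_vec d p)) (fvar g)"
      using single E by (simp add: \<Phi>_single N.act_mult flip: fconst_commute)
    finally show ?case .
  qed (simp_all add: \<Phi>_zero \<Phi>_add lin_ext_add closed N.add_act)
  have hom': "\<Phi> (falg_act T f v) = falg_ract \<alpha> \<beta> N (\<Phi> v) f" if "Poly_Mapping.keys v \<subseteq> box" for f v
    using that
  proof (induction f arbitrary: v rule: falg_induct)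
    case (add f g)
    then show ?case by (simp add: falg_act_add_right \<Phi>_add N.act_add closed)
  next
    case (mult f g)
    then show ?case by (simp add: falg_act_mult falg_act_closed N.act_mult closed)
  qed (simp_all add: scale gen)
  show ?thesis
  proof (rule simple_hom_imp_iso[OF V N])
    show "\<exists>v\<in>carrier V. \<Phi> v \<noteq> \<zero>\<^bsub>N\<^esub>"
      using nz E by (intro bexI[of _ "e_vec 1 p0"]) (auto simp: \<Phi>_single)
  qed (auto simp: closed \<Phi>_add V_ract hom')
qed

end

section \<open>Simplicity of the modules\<close>

lemma mult_ord_dvd_iff:
  assumes "\<xi> \<noteq> (0 :: 'k::field)" shows "\<xi> ^ k = 1 \<longleftrightarrow> mult_ord \<xi> dvd k"
proof -
  interpret R: ring "ring_of_type :: 'k ring" by (rule ring_ring_of_type)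
  interpret G: group "units_of (ring_of_type :: 'k ring)" by (rule R.units_group)
  have "\<xi> \<in> Units (ring_of_type :: 'k ring)"
    unfolding Units_def using assms by (auto intro!: exI[of _ "inverse \<xi>"])
  then have \<xi>: "\<xi> \<in> carrier (units_of (ring_of_type :: 'k ring))" by (simp add: units_of_carrier)
  have "\<xi> [^]\<^bsub>units_of (ring_of_type :: 'k ring)\<^esub> k = \<xi> ^ k"
    by (induction k) (simp_all add: units_of_one units_of_mult power_commutes)
  then show ?thesis using G.pow_eq_id[OF \<xi>, of k] by (simp add: mult_ord_def units_of_one)
qed

lemma power_mod_period: "x ^ n = 1 \<Longrightarrow> x ^ (k mod n) = (x :: 'a::monoid_mult) ^ k"
  by (metis mod_mult_div_eq mult_1_right power_add power_mult power_one)

lemma power_pred_mod_period: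
  assumes "x ^ n = 1" "(x :: 'a::field) \<noteq> 0" "n > 0"
  shows "x ^ ((k + (n - 1)) mod n) = x ^ k / x"
proof -
  have "x ^ ((k + (n - 1)) mod n) * x = x ^ (k + n)"
    using assms by (simp add: power_mod_period flip: power_Suc2)
  then show ?thesis using assms by (simp add: power_add field_simps)
qed

lemma power_pred_period:
  assumes "x ^ n = 1" "(x :: 'a::field) \<noteq> 0" "n > 0"
  shows "x ^ (k + n - Suc 0) = x ^ k / x"
  using power_pred_mod_period[OF assms, of k] assms by (simp add: power_mod_period)

lemma mod_succ_pred:
  assumes "a < n"
  shows "(Suc a mod n + n - Suc 0) mod n = a" "Suc ((a + n - Suc 0) mod n) mod n = a"
proof -
  have "(Suc a mod n + (n - Suc 0)) mod n = (Suc a + (n - Suc 0)) mod n" by (rule mod_add_left_eq)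
  then show "(Suc a mod n + n - Suc 0) mod n = a" using assms by simp
  have "Suc ((a + (n - Suc 0)) mod n) mod n = Suc (a + (n - Suc 0)) mod n" by (rule mod_Suc_eq)
  then show "Suc ((a + n - Suc 0) mod n) mod n = a" using assms by simp
qed

locale roots_of_unity =
  fixes \<alpha> \<beta> :: "'k::field"
  assumes \<alpha>_nz [simp]: "\<alpha> \<noteq> 0" and \<alpha>_root: "\<exists>n>0. \<alpha> ^ n = 1"
    and \<beta>_nz [simp]: "\<beta> \<noteq> 0" and \<beta>_root: "\<exists>n>0. \<beta> ^ n = 1"
    and \<alpha>\<beta>_neq: "\<alpha> * \<beta> \<noteq> 1"
begin

abbreviation "l \<equiv> mult_ord (\<alpha> * \<beta>)"
abbreviation "m1 \<equiv> l1 \<alpha> \<beta>"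
abbreviation "m2 \<equiv> l2 \<alpha> \<beta>"

lemma common_period: obtains n where "n > 0" "\<alpha> ^ n = 1" "\<beta> ^ n = 1"
proof -
  obtain i j where "i > 0" "\<alpha> ^ i = 1" "j > 0" "\<beta> ^ j = 1" using \<alpha>_root \<beta>_root by blast
  then have "i * j > 0" "\<alpha> ^ (i * j) = 1" "\<beta> ^ (j * i) = 1"
    by (simp_all add: power_mult)
  then show ?thesis by (intro that[of "i * j"]) (simp_all add: mult.commute)
qed

lemma \<alpha>\<beta>_power_iff: "(\<alpha> * \<beta>) ^ k = 1 \<longleftrightarrow> l dvd k"
  by (rule mult_ord_dvd_iff) simp

lemma ratio_power_iff: "(\<alpha> * inverse \<beta>) ^ k = 1 \<longleftrightarrow> m2 dvd k"
  unfolding l2_def by (rule mult_ord_dvd_iff) simp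

lemma l_pos: "l > 0"
proof -
  obtain n where "n > 0" "\<alpha> ^ n = 1" "\<beta> ^ n = 1" by (rule common_period)
  then have "l dvd n" by (simp add: power_mult_distrib flip: \<alpha>\<beta>_power_iff)
  then show ?thesis using \<open>n > 0\<close> by (auto intro: Nat.gr0I)
qed

lemma m2_pos: "m2 > 0"
proof -
  obtain n where "n > 0" "\<alpha> ^ n = 1" "\<beta> ^ n = 1" by (rule common_period)
  then have "m2 dvd n" by (simp add: power_mult_distrib power_inverse flip: ratio_power_iff)
  then show ?thesis using \<open>n > 0\<close> by (auto intro: Nat.gr0I)
qed

lemma m1_pos: "m1 > 0"
  using l_pos by (simp add: l1_def)

lemma l_dvd_m1: "l dvd m1"
  by (simp add: l1_def)

lemma \<alpha>\<beta>_power_l: "(\<alpha> * \<beta>) ^ l = 1"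
  by (simp add: \<alpha>\<beta>_power_iff)

lemma \<alpha>\<beta>_power_m1: "(\<alpha> * \<beta>) ^ m1 = 1"
  using l_dvd_m1 by (simp add: \<alpha>\<beta>_power_iff)

lemma \<alpha>_power_m2: "\<alpha> ^ m2 = \<beta> ^ m2"
proof -
  have "(\<alpha> * inverse \<beta>) ^ m2 = 1" by (simp add: ratio_power_iff)
  then show ?thesis by (simp add: power_mult_distrib power_inverse field_simps)
qed

text \<open>If \<open>mult_ord \<beta>\<close> does not divide \<open>l * m2\<close>, the doubling
  gives \<beta>^(2 l m2) = (\<alpha>\<beta>)^(l m2) = 1, since \<alpha>^m2 = \<beta>^m2.\<close>

lemma \<beta>_power_m12: "\<beta> ^ (m1 * m2) = 1"
proof (cases "mult_ord \<beta> dvd l * m2")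
  case True
  then have "m1 = l" by (simp add: l1_def l2_def)
  with True show ?thesis by (simp add: mult_ord_dvd_iff)
next
  case False
  then have m1: "m1 = 2 * l" by (simp add: l1_def l2_def)
  have "\<beta> ^ (m1 * m2) = \<beta> ^ (l * m2) * (\<beta> ^ m2) ^ l"
    by (simp add: m1 mult_2 add_mult_distrib power_add flip: power_mult) (simp add: mult.commute)
  also have "\<dots> = (\<alpha> * \<beta>) ^ (l * m2)"
    by (simp add: \<alpha>_power_m2[symmetric] power_mult_distrib mult.commute flip: power_mult)
  also have "\<dots> = 1" by (simp add: \<alpha>\<beta>_power_iff)
  finally show ?thesis .
qed

lemma \<alpha>_power_m12: "\<alpha> ^ (m1 * m2) = 1"
  using \<beta>_power_m12 by (simp add: \<alpha>_power_m2 mult.commute[of m1] power_mult)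

text \<open>The difference of the two exponents is a multiple of \<open>l\<close> below
  \<open>m1\<close>. It can be nonzero only if \<open>m1 = 2 * l\<close> and it equals
  \<open>l\<close>, but then \<beta>^(l m2) = 1 contradicts the case in which the doubling takes
  place.\<close>

lemma power_separates:
  assumes "a < m1" "a' < m1" "(\<alpha> * \<beta>) ^ a = (\<alpha> * \<beta>) ^ a'" "\<beta> ^ (a * m2) = \<beta> ^ (a' * m2)"
  shows "a = a'"
proof -
  have *: "k = 0" if "a' + k < m1" "(\<alpha> * \<beta>) ^ (a' + k) = (\<alpha> * \<beta>) ^ a'"
    "\<beta> ^ ((a' + k) * m2) = \<beta> ^ (a' * m2)" for a' k
  proof (rule ccontr)
    assume "k \<noteq> 0"
    have "(\<alpha> * \<beta>) ^ k = 1" using that(2) by (simp add: power_add)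
    then have dvd: "l dvd k" by (simp add: \<alpha>\<beta>_power_iff)
    then have "l \<le> k" using \<open>k \<noteq> 0\<close> by (auto dest: dvd_imp_le)
    then have m1: "\<not> mult_ord \<beta> dvd l * m2" "m1 = 2 * l"
      using that(1) by (auto simp: l1_def l2_def split: if_splits)
    then have "k < 2 * l" using that by simp
    obtain c where c: "k = l * c" using dvd by blast
    then have "c < 2" "c \<noteq> 0" using \<open>k < 2 * l\<close> \<open>k \<noteq> 0\<close> by auto
    then have "k = l" using c by simp
    moreover have "\<beta> ^ (k * m2) = 1" using that(3) by (simp add: power_add add_mult_distrib)
    ultimately show False using m1 by (simp add: mult_ord_dvd_iff)
  qed
  show ?thesis
  proof (cases "a' \<le> a")
    case True
    then show ?thesis using *[of a' "a - a'"] assms by simp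
  next
    case False
    then show ?thesis using *[of a "a' - a"] assms by simp
  qed
qed

lemma ratio_separates:
  assumes "b < m2" "b' < m2" "(inverse \<alpha> * \<beta>) ^ b = (inverse \<alpha> * \<beta>) ^ b'"
  shows "b = b'"
proof -
  have inv: "(inverse \<alpha> * \<beta>) = inverse (\<alpha> * inverse \<beta>)" by simp
  have eq: "(\<alpha> * inverse \<beta>) ^ b = (\<alpha> * inverse \<beta>) ^ b'"
    using assms(3) unfolding inv by (metis inverse_inverse_eq power_inverse)
  have *: "k = 0" if "b' + k < m2" "(\<alpha> * inverse \<beta>) ^ (b' + k) = (\<alpha> * inverse \<beta>) ^ b'" for b' k
  proof -
    have "(\<alpha> * inverse \<beta>) ^ k = 1" using that(2) by (simp add: power_add)
    then have "m2 dvd k" by (simp add: ratio_power_iff)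
    then show ?thesis using that(1) by (auto dest: dvd_imp_le intro: ccontr)
  qed
  show ?thesis
  proof (cases "b' \<le> b")
    case True
    then show ?thesis using *[of b' "b - b'"] assms eq by simp
  next
    case False
    then show ?thesis using *[of b "b' - b"] assms eq by simp
  qed
qed

end

lemma single_eq_single_iff [simp]: "Poly_Mapping.single p c = Poly_Mapping.single p d \<longleftrightarrow> c = d"
  by (metis lookup_single_eq)

text \<open>The actions on \<open>V2\<close> and \<open>V3\<close> differ only in the height \<open>n\<close> of the basis and in the
  coefficient \<open>\<kappa>\<close> with which \<open>X22\<close> returns from the top row to the bottom row.\<close>

fun hw_action :: "'k::field \<Rightarrow> 'k \<Rightarrow> nat \<Rightarrow> 'k \<Rightarrow> 'k \<Rightarrow> 'k \<Rightarrow> 'k \<Rightarrow> gen \<Rightarrow> nat \<times> nat \<Rightarrow> 'k vec" where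
  "hw_action \<alpha> \<beta> n \<mu>1 \<mu>2 \<mu>3 \<kappa> X11 (a, b) =
     e_vec (inverse \<mu>1 * \<mu>3 * inverse \<alpha> * (inverse \<alpha> * \<beta>) ^ b * ((\<alpha> * \<beta>) ^ a - 1)) (a - 1, b)"
| "hw_action \<alpha> \<beta> n \<mu>1 \<mu>2 \<mu>3 \<kappa> X12 (a, b) =
     e_vec (inverse \<mu>2 * \<mu>3 * \<beta> ^ a * (inverse \<alpha> * \<beta>) ^ b) (a, (b + (l2 \<alpha> \<beta> - 1)) mod l2 \<alpha> \<beta>)"
| "hw_action \<alpha> \<beta> n \<mu>1 \<mu>2 \<mu>3 \<kappa> X21 (a, b) = e_vec (\<mu>2 * \<alpha> ^ a) (a, (b + 1) mod l2 \<alpha> \<beta>)"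
| "hw_action \<alpha> \<beta> n \<mu>1 \<mu>2 \<mu>3 \<kappa> X22 (a, b) =
     (if a \<noteq> n - 1 then e_vec \<mu>1 (a + 1, b) else e_vec (\<kappa> * inverse \<alpha> ^ (b * n)) (0, b))"

text \<open>The case a = 0 of \<open>X11\<close> disappears because its coefficient contains the
  factor (\<alpha>\<beta>)^0 - 1; the truncated index \<open>0 - 1\<close> is then harmless.\<close>

lemma V2_action_eq: "V2_action \<alpha> \<beta> \<mu>1 \<mu>2 \<mu>3 = hw_action \<alpha> \<beta> (l1 \<alpha> \<beta>) \<mu>1 \<mu>2 \<mu>3 \<mu>1"
  by (intro ext, rename_tac g p, case_tac g; case_tac p) auto

lemma V3_action_eq:
  "V3_action \<alpha> \<beta> \<mu>1 \<mu>2 = hw_action \<alpha> \<beta> (mult_ord (\<alpha> * \<beta>)) 1 \<mu>1 \<mu>2 0"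
  by (intro ext, rename_tac g p, case_tac g; case_tac p) auto

section \<open>The explicit operators: defining relations and simplicity\<close>

context roots_of_unity
begin

text \<open>In the interior of the box the relations are identities between monomials in \<alpha>
  and \<beta>. Crossing an edge is consistent because the powers of \<open>P\<close> and
  \<open>B\<close> have period \<open>m1\<close>, and \<alpha>^m2 and \<beta>^m2 have the same value
  \<open>B\<close>.\<close>

lemma basis_action_V1:
  assumes nz: "\<mu>1 \<noteq> 0" "\<mu>2 \<noteq> 0"
  shows "basis_action \<alpha> \<beta> m1 m2 (V1_action \<alpha> \<beta> \<mu>1 \<mu>2 \<mu>3 \<mu>4)"
proof
  fix g p assume "p \<in> {..<m1} \<times> {..<m2}"
  then show "Poly_Mapping.keys (V1_action \<alpha> \<beta> \<mu>1 \<mu>2 \<mu>3 \<mu>4 g p) \<subseteq> {..<m1} \<times> {..<m2}"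
    using m1_pos m2_pos by (cases g; cases p) auto
next
  fix r p assume r: "r \<in> M2_relations \<alpha> \<beta>" and p: "p \<in> {..<m1} \<times> {..<m2}"
  obtain a b where ab: "p = (a, b)" "a < m1" "b < m2" using p by auto
  define P where "P = inverse (\<alpha> * \<beta>)"
  define B where "B = \<beta> ^ m2"
  have P: "P ^ m1 = 1" "P \<noteq> 0" using \<alpha>\<beta>_power_m1 unfolding P_def by (simp_all only: power_inverse) simp_all
  have [simp]: "inverse \<alpha> * inverse \<beta> = P" by (simp add: P_def)
  have B: "B ^ m1 = 1" "B \<noteq> 0" using \<beta>_power_m12 by (simp_all add: B_def mult.commute flip: power_mult)
  have Bi: "inverse B ^ m1 = 1" using B by (simp add: power_inverse)
  have [simp]: "\<beta> ^ (k * m2) = B ^ k" "inverse \<beta> ^ (k * m2) = inverse B ^ k" for k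
    by (simp_all add: B_def mult.commute[of k] power_mult power_inverse)
  have Bi': "inverse B \<noteq> 0" using B by simp
  note simps = falg_act_minus falg_act_mult power_mod_period[OF P(1)] power_mod_period[OF B(1)]
    power_mod_period[OF Bi] power_pred_period[OF P m1_pos] power_pred_period[OF B m1_pos]
    power_pred_period[OF Bi Bi' m1_pos] mod_succ_pred[OF ab(2)] single_diff[symmetric]
  have \<beta>_last: "\<beta> ^ (m2 - Suc 0) = B / \<beta>" and \<alpha>_last: "\<alpha> ^ (m2 - Suc 0) = B / \<alpha>"
    using m2_pos by (simp_all add: B_def power_diff \<alpha>_power_m2)
  then have last: "\<beta> ^ (m2 - Suc 0) = B / \<beta>" "inverse \<alpha> ^ (m2 - Suc 0) = \<alpha> / B"
    "(inverse \<alpha> * \<beta>) ^ (m2 - Suc 0) = \<alpha> / \<beta>"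
    using B(2) by (simp_all add: power_inverse power_mult_distrib)
  have "falg_act (V1_action \<alpha> \<beta> \<mu>1 \<mu>2 \<mu>3 \<mu>4) r (e_vec 1 (a, b)) = 0"
  proof (cases b)
    case 0
    \<comment> \<open>For \<open>m2 = 1\<close> the row b = 0 is also the last one, and both edge
      cases apply at once; then \<alpha> and \<beta> coincide.\<close>
    have *: "\<alpha> = B" "\<beta> = B" if "m2 \<le> Suc 0"
    proof -
      have "m2 = 1" using that m2_pos by simp
      then show "\<alpha> = B" "\<beta> = B" using \<alpha>_power_m2 by (simp_all add: B_def)
    qed
    show ?thesis using r 0 ab nz m2_pos m1_pos P B
      by (auto simp: M2_relations_def simps last)
        (use * in \<open>auto simp: P_def field_simps\<close>)
  next
    case (Suc b')
    \<comment> \<open>Here \<open>b\<close> is the last row, so \<open>b'\<close> is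
      \<open>m2 - 2\<close> and its powers must be expressed through the common value
      \<open>B\<close>.\<close>
    have *: "\<beta> ^ b' = B / \<beta> / \<beta>" "inverse \<alpha> ^ b' = \<alpha> * \<alpha> / B"
      "(inverse \<alpha> * \<beta>) ^ b' = \<alpha> * \<alpha> / (\<beta> * \<beta>)" if "Suc b' = m2 - Suc 0"
    proof -
      show 1: "\<beta> ^ b' = B / \<beta> / \<beta>" "inverse \<alpha> ^ b' = \<alpha> * \<alpha> / B"
        using \<beta>_last \<alpha>_last B(2) unfolding that[symmetric] by (simp_all add: power_inverse field_simps)
      show "(inverse \<alpha> * \<beta>) ^ b' = \<alpha> * \<alpha> / (\<beta> * \<beta>)"
        unfolding power_mult_distrib 1 using B(2) by simp
    qed
    show ?thesis using r Suc ab nz m2_pos m1_pos P B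
      by (auto simp: M2_relations_def simps last *)
        (auto simp: P_def field_simps)
  qed
  then show "falg_act (V1_action \<alpha> \<beta> \<mu>1 \<mu>2 \<mu>3 \<mu>4) r (e_vec 1 p) = 0" using ab by simp
qed

text \<open>Because of \<alpha>\<beta> \<noteq> 1 the height is at least 2, so top and bottom row
  differ. The last equation is claimed only when \<open>X22\<close> does lead from top to bottom,
  that is for \<open>\<kappa> \<noteq> 0\<close>.\<close>

lemma hw_height:
  assumes "\<kappa> = 0 \<and> n = l \<or> \<kappa> \<noteq> 0 \<and> n = m1"
  shows "n > 0" "(\<alpha> * \<beta>) ^ n = 1" "n > Suc 0" "\<kappa> \<noteq> 0 \<Longrightarrow> \<alpha> ^ (n * m2) = 1"
proof -
  show n: "n > 0" "(\<alpha> * \<beta>) ^ n = 1" using assms l_pos m1_pos \<alpha>\<beta>_power_l \<alpha>\<beta>_power_m1 by auto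
  have "n \<noteq> 1" using n(2) \<alpha>\<beta>_neq by auto
  then show "n > Suc 0" using n(1) by simp
  show "\<alpha> ^ (n * m2) = 1" if "\<kappa> \<noteq> 0" using assms that \<alpha>_power_m12 by simp
qed

text \<open>The relation between \<open>X11\<close> and \<open>X22\<close> at the top row needs
  (\<alpha>\<beta>)^n = 1, by which the coefficient of \<open>X11\<close> would vanish one row above
  the top just as it does at the bottom.\<close>

lemma basis_action_hw:
  assumes nz: "\<mu>1 \<noteq> 0" "\<mu>2 \<noteq> 0" and n: "\<kappa> = 0 \<and> n = l \<or> \<kappa> \<noteq> 0 \<and> n = m1"
  shows "basis_action \<alpha> \<beta> n m2 (hw_action \<alpha> \<beta> n \<mu>1 \<mu>2 \<mu>3 \<kappa>)"
proof
  note n_pos = hw_height(1)[OF n]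
  fix g p assume "p \<in> {..<n} \<times> {..<m2}"
  then show "Poly_Mapping.keys (hw_action \<alpha> \<beta> n \<mu>1 \<mu>2 \<mu>3 \<kappa> g p) \<subseteq> {..<n} \<times> {..<m2}"
    using n_pos m2_pos by (cases g; cases p) auto
next
  note n_pos = hw_height(1)[OF n] and period = hw_height(2)[OF n]
  fix r p assume r: "r \<in> M2_relations \<alpha> \<beta>" and p: "p \<in> {..<n} \<times> {..<m2}"
  obtain a b where ab: "p = (a, b)" "a < n" "b < m2" using p by auto
  define Q where "Q = inverse \<alpha> * \<beta>"
  define A where "A = inverse \<alpha> ^ n"
  have Q: "Q ^ m2 = 1" "Q \<noteq> 0"
    using \<alpha>_power_m2 by (simp_all add: Q_def power_mult_distrib power_inverse)
  have A: "A \<noteq> 0" by (simp add: A_def)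
  have A_period: "A ^ m2 = 1" if "\<kappa> \<noteq> 0"
    using hw_height(4)[OF n that] by (simp add: A_def power_inverse flip: power_mult)
  \<comment> \<open>\<open>A ^ m2 = 1\<close> is known only for \<open>\<kappa> \<noteq> 0\<close>,
    but the powers of \<open>A\<close> indexed by \<open>b\<close> come from the return of
    \<open>X22\<close> to the bottom and carry the factor \<open>\<kappa>\<close>; with this factor
    the identities hold in both cases.\<close>
  have A_mod: "\<kappa> * A ^ (k mod m2) = \<kappa> * A ^ k" "\<kappa> * A ^ (k + m2 - Suc 0) = \<kappa> * A ^ k / A" for k
    using power_mod_period[of A m2 k] power_pred_period[of A m2 k] A A_period m2_pos by (cases "\<kappa> = 0"; simp)+
  have [simp]: "inverse \<alpha> ^ (k * n) = A ^ k" for k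
    by (simp add: A_def mult.commute[of k] power_mult)
  note simps = falg_act_minus falg_act_mult power_mod_period[OF Q(1)]
    power_pred_period[OF Q m2_pos] A_mod mult.left_commute[of _ \<kappa>]
    mod_succ_pred[OF ab(3)] single_diff[symmetric] single_uminus[symmetric] Q_def[symmetric]
  have last: "\<alpha> ^ (n - Suc 0) = 1 / (A * \<alpha>)" "\<beta> ^ (n - Suc 0) = A / \<beta>"
    "(\<alpha> * \<beta>) ^ (n - Suc 0) = 1 / (\<alpha> * \<beta>)"
  proof -
    show 1: "\<alpha> ^ (n - Suc 0) = 1 / (A * \<alpha>)"
      using n_pos by (simp add: A_def power_diff power_inverse field_simps)
    show 2: "\<beta> ^ (n - Suc 0) = A / \<beta>"
      using n_pos period by (simp add: A_def power_diff power_inverse power_mult_distrib field_simps)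
    show "(\<alpha> * \<beta>) ^ (n - Suc 0) = 1 / (\<alpha> * \<beta>)"
      unfolding power_mult_distrib 1 2 using A by simp
  qed
  have "falg_act (hw_action \<alpha> \<beta> n \<mu>1 \<mu>2 \<mu>3 \<kappa>) r (e_vec 1 (a, b)) = 0"
  proof (cases a)
    case 0
    have *: "\<not> n \<le> Suc 0" using hw_height(3)[OF n] by simp
    show ?thesis using r 0 ab nz m2_pos n_pos Q A
      by (auto simp: M2_relations_def simps last *)
        (auto simp: Q_def field_simps)
  next
    case (Suc a')
    have *: "\<alpha> ^ a' = 1 / (A * \<alpha> * \<alpha>)" "\<beta> ^ a' = A / (\<beta> * \<beta>)"
      "(\<alpha> * \<beta>) ^ a' = 1 / (\<alpha> * \<beta> * (\<alpha> * \<beta>))" if "Suc a' = n - Suc 0"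
    proof -
      show 1: "\<alpha> ^ a' = 1 / (A * \<alpha> * \<alpha>)" "\<beta> ^ a' = A / (\<beta> * \<beta>)"
        using last A unfolding that[symmetric] by (simp_all add: field_simps)
      show "(\<alpha> * \<beta>) ^ a' = 1 / (\<alpha> * \<beta> * (\<alpha> * \<beta>))"
        unfolding power_mult_distrib 1 using A by simp
    qed
    show ?thesis using r Suc ab nz m2_pos n_pos Q A
      by (auto simp: M2_relations_def simps last *)
        (auto simp: Q_def field_simps)
  qed
  then show "falg_act (hw_action \<alpha> \<beta> n \<mu>1 \<mu>2 \<mu>3 \<kappa>) r (e_vec 1 p) = 0" using ab by simp
qed

lemma \<alpha>\<beta>_separates:
  assumes "a < l" "a' < l" "(\<alpha> * \<beta>) ^ a = (\<alpha> * \<beta>) ^ a'"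
  shows "a = a'"
proof -
  have *: "k = 0" if "a' + k < l" "(\<alpha> * \<beta>) ^ (a' + k) = (\<alpha> * \<beta>) ^ a'" for a' k
  proof -
    have "(\<alpha> * \<beta>) ^ k = 1" using that(2) by (simp add: power_add)
    then have "l dvd k" by (simp add: \<alpha>\<beta>_power_iff)
    then show ?thesis using that(1) by (auto dest: dvd_imp_le intro: ccontr)
  qed
  show ?thesis
  proof (cases "a' \<le> a")
    case True
    then show ?thesis using *[of a' "a - a'"] assms by simp
  next
    case False
    then show ?thesis using *[of a "a' - a"] assms by simp
  qed
qed

definition det where
  "det = fvar X11 * fvar X22 - fconst (inverse \<alpha>) * fvar X12 * fvar X21"

text \<open>\<open>det\<close> separates the values of b by the powers of \<beta>/\<alpha>. For
  equal b, \<open>X12 X21\<close> sees (\<alpha>\<beta>)^(-a) and \<open>X21^m2\<close> sees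
  \<beta>^(-a m2), which together determine a. \<open>X11\<close> runs through the cycle of all a,
  and \<open>X21\<close> through that of all b.\<close>

lemma V1_simple:
  assumes nz: "\<mu>1 \<noteq> 0" "\<mu>2 \<noteq> 0" "\<mu>3 \<noteq> 0" "\<mu>4 \<noteq> 0"
  shows "simple_right_module (M2 \<alpha> \<beta>) (V1 \<alpha> \<beta> \<mu>1 \<mu>2 \<mu>3 \<mu>4)"
proof -
  let ?T = "V1_action \<alpha> \<beta> \<mu>1 \<mu>2 \<mu>3 \<mu>4"
  interpret basis_action \<alpha> \<beta> m1 m2 ?T using nz(1,2) by (rule basis_action_V1)
  define P where "P = inverse (\<alpha> * \<beta>)"
  define B where "B = \<beta> ^ m2"
  have P: "P ^ m1 = 1" "P \<noteq> 0" using \<alpha>\<beta>_power_m1 unfolding P_def by (simp_all only: power_inverse) simp_all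
  have [simp]: "inverse \<alpha> * inverse \<beta> = P" by (simp add: P_def)
  have B: "B ^ m1 = 1" "B \<noteq> 0" using \<beta>_power_m12 by (simp_all add: B_def mult.commute flip: power_mult)
  have [simp]: "\<beta> ^ (k * m2) = B ^ k" "inverse \<beta> ^ (k * m2) = inverse B ^ k" for k
    by (simp_all add: B_def mult.commute[of k] power_mult power_inverse)
  have d1: "falg_act ?T (fvar X12 * fvar X21) (e_vec 1 (a, b)) = e_vec (\<mu>3 * (inverse \<alpha> * \<beta>) ^ b * P ^ a) (a, b)"
    if "a < m1" "b < m2" for a b
    using that nz B m2_pos by (auto simp: falg_act_mult P_def field_simps)
  have d2: "falg_act ?T det (e_vec 1 (a, b)) = e_vec (\<mu>4 * (inverse \<alpha> * \<beta>) ^ b) (a, b)"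
    if "a < m1" "b < m2" for a b
  proof -
    have fc: "fconst (inverse \<alpha>) * fvar X12 * fvar X21 = fvar X12 * fvar X21 * fconst (inverse \<alpha>)"
      by (simp add: fconst_commute mult.assoc)
    show ?thesis unfolding det_def fc falg_act_minus falg_act_mult[of _ _ "fconst (inverse \<alpha>)"] d1[OF that]
      using that nz P m1_pos
      by (simp add: falg_act_mult mod_succ_pred power_mod_period[OF P(1)] single_diff[symmetric])
        (simp add: P_def field_simps)
  qed
  have up: "falg_act ?T (fvar X21 ^ k) (e_vec c (a, b)) = e_vec (c * \<mu>2 ^ k) (a, b + k)" if "b + k < m2" for a b c k
    using that
  proof (induction k arbitrary: c b)
    case (Suc k)
    then have "b \<noteq> m2 - Suc 0" by simp
    then show ?case using Suc by (simp add: falg_act_mult mult_ac)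
  qed simp
  have d3: "falg_act ?T (fvar X21 ^ m2) (e_vec 1 (a, b)) = e_vec (\<mu>2 ^ m2 * inverse B ^ a) (a, b)"
    if "a < m1" "b < m2" for a b
  proof -
    \<comment> \<open>A full turn of \<open>X21\<close> is cut at the only step with an extra
      factor: \<open>m2 - Suc b\<close> steps to the last row, the step back to row 0, then
      \<open>b\<close> steps.\<close>
    have m2: "m2 = (m2 - Suc b) + Suc b" using that by simp
    have "falg_act ?T (fvar X21 ^ m2) (e_vec 1 (a, b)) =
        falg_act ?T (fvar X21 ^ Suc b) (falg_act ?T (fvar X21 ^ (m2 - Suc b)) (e_vec 1 (a, b)))"
      by (subst m2) (simp only: power_add falg_act_mult)
    also have "\<dots> = falg_act ?T (fvar X21 ^ b) (e_vec (\<mu>2 ^ (m2 - Suc b) * \<mu>2 * inverse B ^ a) (a, 0))"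
      using that up[where b = b and k = "m2 - Suc b" and c = 1 and a = a] by (simp add: falg_act_mult mult.assoc)
    also have "\<dots> = e_vec (\<mu>2 ^ (m2 - Suc b) * \<mu>2 * inverse B ^ a * \<mu>2 ^ b) (a, b)"
      using that up[where b = 0 and k = b] by simp
    also have "\<mu>2 ^ (m2 - Suc b) * \<mu>2 * inverse B ^ a * \<mu>2 ^ b = \<mu>2 ^ m2 * inverse B ^ a"
      by (subst (2) m2) (simp add: power_add mult_ac)
    finally show ?thesis .
  qed
  show ?thesis unfolding V1_def
  proof (rule simple_V[OF m1_pos m2_pos])
    fix p q assume pq: "p \<in> {..<m1} \<times> {..<m2}" "q \<in> {..<m1} \<times> {..<m2}"
    obtain a b a' b' where ab: "p = (a, b)" "q = (a', b')" "a < m1" "a' < m1" "b < m2" "b' < m2"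
      using pq by auto
    show "\<exists>d ev. ev p \<noteq> ev q \<and> (\<forall>r\<in>{..<m1} \<times> {..<m2}. falg_act ?T d (e_vec 1 r) = e_vec (ev r) r)"
      if neq: "p \<noteq> q"
    proof (cases "b = b'")
      case False
      then have "(inverse \<alpha> * \<beta>) ^ b \<noteq> (inverse \<alpha> * \<beta>) ^ b'" using ratio_separates ab by blast
      then show ?thesis using ab nz d2
        by (intro exI[of _ det] exI[of _ "\<lambda>(a, b). \<mu>4 * (inverse \<alpha> * \<beta>) ^ b"]) auto
    next
      case b: True
      show ?thesis
      proof (cases "P ^ a = P ^ a'")
        case False
        then show ?thesis using ab nz d1 b
          by (intro exI[of _ "fvar X12 * fvar X21"] exI[of _ "\<lambda>(a, b). \<mu>3 * (inverse \<alpha> * \<beta>) ^ b * P ^ a"]) auto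
      next
        case True
        then have "(\<alpha> * \<beta>) ^ a = (\<alpha> * \<beta>) ^ a'" unfolding P_def power_inverse by (rule inverse_eq_imp_eq)
        then have "inverse B ^ a \<noteq> inverse B ^ a'"
          using power_separates[OF ab(3,4)] b neq ab by (auto simp: power_inverse)
        then show ?thesis using ab nz d3 b
          by (intro exI[of _ "fvar X21 ^ m2"] exI[of _ "\<lambda>(a, b). \<mu>2 ^ m2 * inverse B ^ a"]) auto
      qed
    qed
    have "reaches (i, b) (Suc i mod m1, b)" for i by (rule reachesI[of X11, where c = "\<mu>1 * \<beta> ^ b"]) (use nz in auto)
    then have 1: "reaches (a, b) (a', b)" using ab reaches_cycle[of m1 "\<lambda>i. (i, b)" a a'] by simp
    have "reaches (a', i) (a', Suc i mod m2)" if "i < m2" for i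
      by (rule reachesI[of X21, where c = "if Suc i = m2 then \<mu>2 * inverse B ^ a' else \<mu>2"])
        (use nz that B in \<open>auto simp: mod_Suc\<close>)
    then have "reaches (a', b) (a', b')" using ab reaches_cycle[of m2 "\<lambda>i. (a', i)" b b'] by simp
    with 1 show "reaches p q" unfolding ab by (rule reaches_trans)
  qed
qed

text \<open>The same three elements separate the basis. For connectedness in the direction of a,
  \<open>X22\<close> goes up and, when \<open>\<kappa> \<noteq> 0\<close>, also back from the top;
  for \<open>\<kappa> = 0\<close> the way back is by \<open>X11\<close>.\<close>

lemma hw_simple:
  assumes nz: "\<mu>1 \<noteq> 0" "\<mu>2 \<noteq> 0" "\<mu>3 \<noteq> 0" and n: "\<kappa> = 0 \<and> n = l \<or> \<kappa> \<noteq> 0 \<and> n = m1"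
  shows "simple_right_module (M2 \<alpha> \<beta>) (basis_module n m2 (hw_action \<alpha> \<beta> n \<mu>1 \<mu>2 \<mu>3 \<kappa>))"
proof -
  let ?T = "hw_action \<alpha> \<beta> n \<mu>1 \<mu>2 \<mu>3 \<kappa>"
  interpret basis_action \<alpha> \<beta> n m2 ?T using nz(1,2) n by (rule basis_action_hw)
  note n_pos = hw_height(1)[OF n]
  define Q where "Q = inverse \<alpha> * \<beta>"
  have Q: "Q ^ m2 = 1" "Q \<noteq> 0"
    using \<alpha>_power_m2 by (simp_all add: Q_def power_mult_distrib power_inverse)
  have d1: "falg_act ?T (fvar X12 * fvar X21) (e_vec 1 (a, b)) = e_vec (\<mu>3 * Q ^ b * (\<alpha> * \<beta>) ^ a) (a, b)"
    if "a < n" "b < m2" for a b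
    using that nz m2_pos by (simp add: falg_act_mult mod_succ_pred power_mult_distrib flip: Q_def)
  have d2: "falg_act ?T det (e_vec 1 (a, b)) = e_vec (- inverse \<alpha> * \<mu>3 * Q ^ b) (a, b)"
    if "a < n" "b < m2" for a b
  proof -
    have fc: "fconst (inverse \<alpha>) * fvar X12 * fvar X21 = fvar X12 * fvar X21 * fconst (inverse \<alpha>)"
      by (simp add: fconst_commute mult.assoc)
    have *: "falg_act ?T (fvar X11 * fvar X22) (e_vec 1 (a, b))
        = e_vec (inverse \<alpha> * \<mu>3 * Q ^ b * ((\<alpha> * \<beta>) ^ a - 1)) (a, b)"
      using that nz by (cases a) (auto simp: falg_act_mult simp flip: Q_def)
    show ?thesis unfolding det_def fc falg_act_minus falg_act_mult[of _ _ "fconst (inverse \<alpha>)"] d1[OF that] *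
      using that nz
      by (simp add: single_diff[symmetric]) (simp add: algebra_simps)
  qed
  have d3': "falg_act ?T (fvar X21 ^ k) (e_vec c (a, b)) = e_vec (c * \<mu>2 ^ k * (\<alpha> ^ a) ^ k) (a, (b + k) mod m2)"
    if "b < m2" for a b c k
    using that
  proof (induction k arbitrary: c b)
    case (Suc k)
    then show ?case using m2_pos by (simp add: falg_act_mult mult_ac mod_add_left_eq)
  qed simp
  have d3: "falg_act ?T (fvar X21 ^ m2) (e_vec 1 (a, b)) = e_vec (\<mu>2 ^ m2 * \<beta> ^ (a * m2)) (a, b)"
    if "b < m2" for a b
    using d3'[where b = b and k = m2 and c = 1 and a = a, OF that] that
    by (simp add: mult.commute[of a] power_mult \<alpha>_power_m2 flip: power_mult)
      (simp add: power_mult \<alpha>_power_m2)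
  show ?thesis
  proof (rule simple_V[OF n_pos m2_pos])
    fix p q assume pq: "p \<in> {..<n} \<times> {..<m2}" "q \<in> {..<n} \<times> {..<m2}"
    obtain a b a' b' where ab: "p = (a, b)" "q = (a', b')" "a < n" "a' < n" "b < m2" "b' < m2"
      using pq by auto
    show "\<exists>d ev. ev p \<noteq> ev q \<and> (\<forall>r\<in>{..<n} \<times> {..<m2}. falg_act ?T d (e_vec 1 r) = e_vec (ev r) r)"
      if neq: "p \<noteq> q"
    proof (cases "b = b'")
      case False
      then have "Q ^ b \<noteq> Q ^ b'" using ratio_separates ab unfolding Q_def by blast
      then show ?thesis using ab nz d2
        by (intro exI[of _ det] exI[of _ "\<lambda>(a, b). - inverse \<alpha> * \<mu>3 * Q ^ b"]) auto
    next
      case b: True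
      show ?thesis
      proof (cases "(\<alpha> * \<beta>) ^ a = (\<alpha> * \<beta>) ^ a'")
        case False
        then show ?thesis using ab nz d1 b Q
          by (intro exI[of _ "fvar X12 * fvar X21"] exI[of _ "\<lambda>(a, b). \<mu>3 * Q ^ b * (\<alpha> * \<beta>) ^ a"]) auto
      next
        case True
        have "\<beta> ^ (a * m2) \<noteq> \<beta> ^ (a' * m2)"
          using n power_separates[of a a'] \<alpha>\<beta>_separates[of a a'] True b neq ab by auto
        then show ?thesis using ab nz d3 b
          by (intro exI[of _ "fvar X21 ^ m2"] exI[of _ "\<lambda>(a, b). \<mu>2 ^ m2 * \<beta> ^ (a * m2)"]) auto
      qed
    qed
    \<comment> \<open>The coefficient of \<open>X11\<close> at row \<open>i\<close> contains
      (\<alpha>\<beta>)^i - 1, which is nonzero for 0 < i < l. This reaches every row when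
      \<open>\<kappa> = 0\<close>, the height then being \<open>l\<close>.\<close>
    have down: "reaches (i, b) (0, b)" if "i < l" for i
      using that
    proof (induction i)
      case (Suc i)
      have "(\<alpha> * \<beta>) ^ Suc i \<noteq> 1" using Suc.prems unfolding \<alpha>\<beta>_power_iff by (auto dest: dvd_imp_le)
      then have "reaches (Suc i, b) (i, b)"
        by (intro reachesI[of X11, where c =
          "inverse \<mu>1 * \<mu>3 * inverse \<alpha> * (inverse \<alpha> * \<beta>) ^ b * ((\<alpha> * \<beta>) ^ Suc i - 1)"])
          (use nz in auto)
      then show ?case using Suc by (auto intro: reaches_trans)
    qed (rule reaches_refl)
    have "reaches (i, b) (Suc i mod n, b)" if i: "i < n" for i
    proof (cases "Suc i = n \<and> \<kappa> = 0")
      case True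
      then show ?thesis using down[of i] n i by auto
    next
      case False
      then show ?thesis using nz(1) i
        by (intro reachesI[of X22, where c = "if Suc i = n then \<kappa> * inverse \<alpha> ^ (b * n) else \<mu>1"])
          (auto simp: mod_Suc)
    qed
    then have 1: "reaches (a, b) (a', b)" using ab reaches_cycle[of n "\<lambda>i. (i, b)" a a'] by simp
    have "reaches (a', i) (a', Suc i mod m2)" for i
      by (rule reachesI[of X21, where c = "\<mu>2 * \<alpha> ^ a'"]) (use nz in auto)
    then have "reaches (a', b) (a', b')" using ab reaches_cycle[of m2 "\<lambda>i. (a', i)" b b'] by simp
    with 1 show "reaches p q" unfolding ab by (rule reaches_trans)
  qed
qed

lemma V2_simple:
  "\<mu>1 \<noteq> 0 \<Longrightarrow> \<mu>2 \<noteq> 0 \<Longrightarrow> \<mu>3 \<noteq> 0 \<Longrightarrow> simple_right_module (M2 \<alpha> \<beta>) (V2 \<alpha> \<beta> \<mu>1 \<mu>2 \<mu>3)"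
  unfolding V2_def V2_action_eq by (rule hw_simple) simp_all

lemma V3_simple:
  "\<mu>1 \<noteq> 0 \<Longrightarrow> \<mu>2 \<noteq> 0 \<Longrightarrow> simple_right_module (M2 \<alpha> \<beta>) (V3 \<alpha> \<beta> \<mu>1 \<mu>2)"
  unfolding V3_def V3_action_eq by (rule hw_simple) simp_all

end

section \<open>Simple torsionfree modules\<close>

locale simple_M2_module = roots_of_unity \<alpha> \<beta> for \<alpha> \<beta> :: "'k::alg_closed_field" +
  fixes N :: "('k falg set, 'm) rmodule" (structure)
  assumes simple: "simple_right_module (M2 \<alpha> \<beta>) N"
    and torsionfree_x12: "torsionfree (M2 \<alpha> \<beta>) N (M2_gen \<alpha> \<beta> X12)"
    and torsionfree_x21: "torsionfree (M2 \<alpha> \<beta>) N (M2_gen \<alpha> \<beta> X21)"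
    and torsionfree_det: "torsionfree (M2 \<alpha> \<beta>) N (M2_det \<alpha> \<beta>)"
begin

lemma right_module_N: "right_module (M2 \<alpha> \<beta>) N"
  using simple unfolding simple_right_module_def by blast

abbreviation fract :: "'m \<Rightarrow> 'k falg \<Rightarrow> 'm" (infixl \<open>\<bullet>\<close> 70) where
  "m \<bullet> f \<equiv> falg_ract \<alpha> \<beta> N m f"

sublocale ring_action N "falg_ract \<alpha> \<beta> N"
  using right_module_N by (rule falg_ract_ring_action)

definition sm :: "'k \<Rightarrow> 'm \<Rightarrow> 'm" (infixr \<open>\<rhd>\<close> 75) where
  "c \<rhd> m = m \<bullet> fconst c"

sublocale F: comm_ring_action N "\<lambda>m c. c \<rhd> m"
  unfolding sm_def using right_module_N by (rule fconst_ract_comm_ring_action)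

lemma sm_act [simp]: "m \<in> carrier N \<Longrightarrow> (c \<rhd> m) \<bullet> f = c \<rhd> (m \<bullet> f)"
  by (simp add: sm_def fconst_commute flip: act_mult)

lemma sm_sm [simp]: "m \<in> carrier N \<Longrightarrow> c \<rhd> d \<rhd> m = (c * d) \<rhd> m"
  using F.act_mult[of m d c] by (simp add: mult.commute)

lemma sm_add: "m \<in> carrier N \<Longrightarrow> n \<in> carrier N \<Longrightarrow> c \<rhd> (m \<oplus> n) = c \<rhd> m \<oplus> c \<rhd> n"
  by (rule F.add_act)

lemma add_sm: "m \<in> carrier N \<Longrightarrow> (c + d) \<rhd> m = c \<rhd> m \<oplus> d \<rhd> m"
  by (rule F.act_add)

lemma act_fconst: "m \<bullet> fconst c = c \<rhd> m"
  by (simp add: sm_def)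

lemma sm_eq_zero: "c \<rhd> m = \<zero> \<Longrightarrow> c \<noteq> 0 \<Longrightarrow> m \<in> carrier N \<Longrightarrow> m = \<zero>"
  using sm_sm[of m "inverse c" c] by simp

lemma sm_cancel: "m \<in> carrier N \<Longrightarrow> c \<noteq> 0 \<Longrightarrow> n = c \<rhd> m \<Longrightarrow> m = inverse c \<rhd> n"
  by simp

lemma submodule_cases:
  assumes "U \<subseteq> carrier N" "\<zero> \<in> U" "\<And>m n. m \<in> U \<Longrightarrow> n \<in> U \<Longrightarrow> m \<oplus> n \<in> U"
    and "\<And>m c. m \<in> U \<Longrightarrow> c \<rhd> m \<in> U" and "\<And>m g. m \<in> U \<Longrightarrow> m \<bullet> fvar g \<in> U"
  shows "U = {\<zero>} \<or> U = carrier N"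
proof -
  have "right_submodule (M2 \<alpha> \<beta>) N U"
    using assms by (intro right_submoduleI[OF right_module_N]) (simp_all add: act_fconst)
  then show ?thesis using simple unfolding simple_right_module_def by blast
qed

lemma carrier_nontrivial: "\<exists>m\<in>carrier N. m \<noteq> \<zero>"
  using simple zero_closed unfolding simple_right_module_def by blast

text \<open>Commutation up to a scalar is stated for the operators on \<open>N\<close> rather than
  in the algebra, so that the scalar can be moved freely past everything. As the action is from the
  right, \<open>f\<close> acts first on the left-hand side.\<close>

definition qcomm :: "'k \<Rightarrow> 'k falg \<Rightarrow> 'k falg \<Rightarrow> bool" where
  "qcomm c f g \<longleftrightarrow> (\<forall>m\<in>carrier N. m \<bullet> f \<bullet> g = c \<rhd> (m \<bullet> g \<bullet> f))"

lemma qcommD: "qcomm c f g \<Longrightarrow> m \<in> carrier N \<Longrightarrow> m \<bullet> f \<bullet> g = c \<rhd> (m \<bullet> g \<bullet> f)"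
  by (simp add: qcomm_def)

lemma qcomm_cong: "qcomm c f g \<Longrightarrow> c = d \<Longrightarrow> qcomm d f g"
  by simp

lemma qcomm_sym: "qcomm c f g \<Longrightarrow> c \<noteq> 0 \<Longrightarrow> qcomm (inverse c) g f"
  by (simp add: qcomm_def)

lemma qcomm_refl: "qcomm 1 f f"
  by (simp add: qcomm_def)

lemma qcomm_one: "qcomm 1 f 1" "qcomm 1 1 f"
  by (simp_all add: qcomm_def)

lemma qcomm_mult_right: "qcomm c f g \<Longrightarrow> qcomm d f h \<Longrightarrow> qcomm (c * d) f (g * h)"
  unfolding qcomm_def by (simp add: act_mult)

lemma qcomm_mult_left: "qcomm c f h \<Longrightarrow> qcomm d g h \<Longrightarrow> qcomm (c * d) (f * g) h"
  unfolding qcomm_def by (simp add: act_mult mult.commute)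

lemma qcomm_power_right: "qcomm c f g \<Longrightarrow> qcomm (c ^ k) f (g ^ k)"
  by (induction k) (simp_all add: qcomm_one qcomm_mult_right)

lemma qcomm_power_left: "qcomm c f g \<Longrightarrow> qcomm (c ^ k) (f ^ k) g"
  by (induction k) (simp_all add: qcomm_one qcomm_mult_left)

lemma qcomm_power: "qcomm c f g \<Longrightarrow> qcomm (c ^ (i * j)) (f ^ i) (g ^ j)"
  unfolding power_mult by (intro qcomm_power_right qcomm_power_left)

lemma qcomm_add_right: "qcomm c f g \<Longrightarrow> qcomm c f h \<Longrightarrow> qcomm c f (g + h)"
  unfolding qcomm_def by (simp add: act_add add_act sm_add)

lemma qcomm_fconst: "qcomm 1 f (fconst c)"
  unfolding qcomm_def by (simp add: act_fconst)

lemma qcomm_1_falg: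
  assumes "\<And>g. qcomm 1 f (fvar g)" shows "qcomm 1 f h"
proof (induction h rule: falg_induct)
  case (add g h)
  then show ?case by (rule qcomm_add_right)
next
  case (mult g h)
  then show ?case using qcomm_mult_right[of 1 f g 1 h] by simp
qed (use assms qcomm_fconst in auto)

section \<open>Commutation rules for the generators, \<open>Y\<close> and the quantum
  determinant\<close>

abbreviation "x11 \<equiv> fvar X11 :: 'k falg"
abbreviation "x12 \<equiv> fvar X12 :: 'k falg"
abbreviation "x21 \<equiv> fvar X21 :: 'k falg"
abbreviation "x22 \<equiv> fvar X22 :: 'k falg"

lemma act_relation:
  assumes "f - g \<in> M2_relations \<alpha> \<beta>" "m \<in> carrier N" shows "m \<bullet> f = m \<bullet> g"
  using M2_relation_class[OF assms(1)] act_eq_iff[OF assms(2), of f g] assms(2) by simp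

lemma act_fconst_mult: "m \<in> carrier N \<Longrightarrow> m \<bullet> (fconst c * f) = c \<rhd> (m \<bullet> f)"
  by (simp add: act_mult act_fconst)

lemma qcommI:
  assumes "f * g - fconst c * g * f \<in> M2_relations \<alpha> \<beta>" shows "qcomm c f g"
  unfolding qcomm_def using act_relation[OF assms]
  by (simp add: act_mult act_fconst)

lemma qcomm_gens:
  "qcomm \<alpha> x12 x11" "qcomm \<alpha> x22 x21" "qcomm \<beta> x21 x11" "qcomm \<beta> x22 x12"
  "qcomm (\<beta> * inverse \<alpha>) x21 x12"
  by (rule qcommI, simp add: M2_relations_def)+

lemma qcomm_gens':
  "qcomm (inverse \<alpha>) x11 x12" "qcomm (inverse \<alpha>) x21 x22" "qcomm (inverse \<beta>) x11 x21"
  "qcomm (inverse \<beta>) x12 x22" "qcomm (\<alpha> * inverse \<beta>) x12 x21"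
  using qcomm_gens[THEN qcomm_sym] by (simp_all add: mult.commute)

abbreviation "Y \<equiv> x12 * x21"

lemma x11_x22: "m \<in> carrier N \<Longrightarrow> m \<bullet> x11 \<bullet> x22 = m \<bullet> det \<oplus> inverse \<alpha> \<rhd> (m \<bullet> Y)"
  using act_add[of m det "fconst (inverse \<alpha>) * Y"]
  by (simp add: det_def mult.assoc act_mult[of m x11] act_fconst_mult)

lemma x22_x11:
  assumes m: "m \<in> carrier N" shows "m \<bullet> x22 \<bullet> x11 = m \<bullet> det \<oplus> \<beta> \<rhd> (m \<bullet> Y)"
proof -
  have "x22 * x11 - (x11 * x22 + fconst (\<beta> - inverse \<alpha>) * Y) \<in> M2_relations \<alpha> \<beta>"
    by (simp add: M2_relations_def mult.assoc)
  from act_relation[OF this m] have "m \<bullet> x22 \<bullet> x11 = m \<bullet> x11 \<bullet> x22 \<oplus> (\<beta> - inverse \<alpha>) \<rhd> (m \<bullet> Y)"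
    using m by (simp add: act_mult[of m x22] act_mult[of m x11] act_add act_fconst_mult)
  also have "\<dots> = m \<bullet> det \<oplus> (inverse \<alpha> \<rhd> (m \<bullet> Y) \<oplus> (\<beta> - inverse \<alpha>) \<rhd> (m \<bullet> Y))"
    using m by (simp add: x11_x22 a_assoc)
  also have "\<dots> = m \<bullet> det \<oplus> \<beta> \<rhd> (m \<bullet> Y)"
    using m by (simp flip: add_sm)
  finally show ?thesis .
qed

lemma qcomm_Y:
  "qcomm (\<alpha> * \<beta>) x22 Y" "qcomm (inverse (\<alpha> * \<beta>)) x11 Y" "qcomm (\<beta> * inverse \<alpha>) x21 Y"
  "qcomm (\<alpha> * inverse \<beta>) x12 Y"
  using qcomm_mult_right[OF qcomm_gens(4,2)] qcomm_mult_right[OF qcomm_gens'(1,3)]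
    qcomm_mult_right[OF qcomm_gens(5) qcomm_refl] qcomm_mult_right[OF qcomm_refl qcomm_gens'(5)]
  by (simp_all add: mult.commute)

lemma qcomm_Y':
  "qcomm (inverse (\<alpha> * \<beta>)) Y x22" "qcomm (\<alpha> * \<beta>) Y x11" "qcomm (\<alpha> * inverse \<beta>) Y x21"
  "qcomm (\<beta> * inverse \<alpha>) Y x12"
  using qcomm_Y[THEN qcomm_sym] by (simp_all add: mult.commute)

text \<open>For \<open>x11\<close> the operator \<open>x11 * x22 * x11\<close> is computed with
  either bracketing, and the terms with \<open>Y\<close> agree; likewise
  \<open>x22 * x11 * x22\<close> for \<open>x22\<close>. For \<open>x12\<close> and
  \<open>x21\<close> both terms of \<open>det\<close> pick up the same scalar.\<close>

lemma qcomm_det: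
  "qcomm 1 det x11" "qcomm 1 det x22" "qcomm (\<beta> * inverse \<alpha>) det x12" "qcomm (\<alpha> * inverse \<beta>) det x21"
proof -
  have [simp]: "inverse \<alpha> * (\<alpha> * \<beta>) = \<beta>" by simp
  show "qcomm 1 det x11" unfolding qcomm_def
  proof
    fix m assume m: "m \<in> carrier N"
    have "m \<bullet> x11 \<bullet> det \<oplus> \<beta> \<rhd> (m \<bullet> x11 \<bullet> Y) = m \<bullet> x11 \<bullet> x22 \<bullet> x11"
      using m x22_x11[of "m \<bullet> x11"] by simp
    also have "\<dots> = m \<bullet> det \<bullet> x11 \<oplus> \<beta> \<rhd> (m \<bullet> x11 \<bullet> Y)"
      using m by (simp add: x11_x22 add_act qcommD[OF qcomm_Y'(2)])
    finally show "m \<bullet> det \<bullet> x11 = 1 \<rhd> (m \<bullet> x11 \<bullet> det)"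
      using m by simp
  qed
  show "qcomm 1 det x22" unfolding qcomm_def
  proof
    fix m assume m: "m \<in> carrier N"
    have "m \<bullet> x22 \<bullet> det \<oplus> \<beta> \<rhd> (m \<bullet> Y \<bullet> x22) = m \<bullet> x22 \<bullet> x11 \<bullet> x22"
      using m x11_x22[of "m \<bullet> x22"] by (simp add: qcommD[OF qcomm_Y(1)])
    also have "\<dots> = m \<bullet> det \<bullet> x22 \<oplus> \<beta> \<rhd> (m \<bullet> Y \<bullet> x22)"
      using m by (simp add: x22_x11 add_act)
    finally show "m \<bullet> det \<bullet> x22 = 1 \<rhd> (m \<bullet> x22 \<bullet> det)"
      using m by simp
  qed
  have D: "det = x11 * x22 + fconst (- inverse \<alpha>) * Y"
    by (simp add: det_def mult.assoc fconst_def single_uminus)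
  have "qcomm (inverse (\<beta> * inverse \<alpha>)) x12 det" unfolding D
  proof (rule qcomm_add_right)
    show "qcomm (inverse (\<beta> * inverse \<alpha>)) x12 (x11 * x22)"
      using qcomm_mult_right[OF qcomm_gens(1) qcomm_gens'(4)] by (simp add: mult.commute)
    show "qcomm (inverse (\<beta> * inverse \<alpha>)) x12 (fconst (- inverse \<alpha>) * Y)"
      using qcomm_mult_right[OF qcomm_fconst qcomm_Y(4)] by (simp add: mult.commute)
  qed
  then show "qcomm (\<beta> * inverse \<alpha>) det x12" using qcomm_sym by force
  have "qcomm (inverse (\<alpha> * inverse \<beta>)) x21 det" unfolding D
  proof (rule qcomm_add_right)
    show "qcomm (inverse (\<alpha> * inverse \<beta>)) x21 (x11 * x22)"
      using qcomm_mult_right[OF qcomm_gens(3) qcomm_gens'(2)] by (simp add: mult.commute)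
    show "qcomm (inverse (\<alpha> * inverse \<beta>)) x21 (fconst (- inverse \<alpha>) * Y)"
      using qcomm_mult_right[OF qcomm_fconst qcomm_Y(3)] by (simp add: mult.commute)
  qed
  then show "qcomm (\<alpha> * inverse \<beta>) det x21" using qcomm_sym by force
qed

text \<open>With \<open>k = Suc j\<close>, pulling \<open>det\<close> and \<open>Y\<close> in front
  of \<open>x22 ^ j\<close> turns the coefficient \<beta> of \<open>Y\<close> in
  \<open>x22_x11\<close> into \<beta>(\<alpha>\<beta>)^j. This is 1/\<alpha>, the coefficient in
  \<open>x11_x22\<close>, because (\<alpha>\<beta>)^k = 1. The other half exchanges the two
  roles.\<close>

lemma qcomm_x22_power_x11:
  assumes "(\<alpha> * \<beta>) ^ k = 1" "k > 0"
  shows "qcomm 1 (x22 ^ k) x11" "qcomm 1 (x11 ^ k) x22"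
proof -
  obtain j where k: "k = Suc j" using assms(2) by (cases k) auto
  have j: "\<beta> * (\<alpha> * \<beta>) ^ j = inverse \<alpha>"
  proof -
    have "\<alpha> * (\<beta> * (\<alpha> * \<beta>) ^ j) = 1" using assms(1) by (simp add: k mult_ac)
    then show ?thesis by (simp add: field_simps)
  qed
  have j': "inverse \<alpha> * inverse (\<alpha> * \<beta>) ^ j = \<beta>"
    unfolding power_inverse inverse_mult_distrib[symmetric]
    using j by (metis inverse_inverse_eq inverse_mult_distrib mult.commute mult.left_commute nonzero_mult_div_cancel_right divide_inverse \<beta>_nz \<alpha>_nz right_inverse mult_1_right)
  show "qcomm 1 (x22 ^ k) x11" unfolding qcomm_def
  proof
    fix m assume m: "m \<in> carrier N"
    have "m \<bullet> x22 ^ k \<bullet> x11 = m \<bullet> x22 ^ j \<bullet> x22 \<bullet> x11" using m by (simp add: k power_Suc2 act_mult del: power_Suc)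
    also have "\<dots> = m \<bullet> det \<bullet> x22 ^ j \<oplus> inverse \<alpha> \<rhd> (m \<bullet> Y \<bullet> x22 ^ j)"
      using m x22_x11[of "m \<bullet> x22 ^ j"] qcommD[OF qcomm_power_left[OF qcomm_Y(1)], of m j]
        qcommD[OF qcomm_power_right[OF qcomm_det(2)], of m j] by (simp add: j)
    also have "\<dots> = m \<bullet> x11 \<bullet> x22 \<bullet> x22 ^ j" using m by (simp add: x11_x22 add_act)
    finally show "m \<bullet> x22 ^ k \<bullet> x11 = 1 \<rhd> (m \<bullet> x11 \<bullet> x22 ^ k)" using m by (simp add: k act_mult)
  qed
  show "qcomm 1 (x11 ^ k) x22" unfolding qcomm_def
  proof
    fix m assume m: "m \<in> carrier N"
    have "m \<bullet> x11 ^ k \<bullet> x22 = m \<bullet> x11 ^ j \<bullet> x11 \<bullet> x22" using m by (simp add: k power_Suc2 act_mult del: power_Suc)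
    also have "\<dots> = m \<bullet> det \<bullet> x11 ^ j \<oplus> \<beta> \<rhd> (m \<bullet> Y \<bullet> x11 ^ j)"
      using m x11_x22[of "m \<bullet> x11 ^ j"] qcommD[OF qcomm_power_left[OF qcomm_Y(2)], of m j]
        qcommD[OF qcomm_power_right[OF qcomm_det(1)], of m j] j' by simp
    also have "\<dots> = m \<bullet> x22 \<bullet> x11 \<bullet> x11 ^ j" using m by (simp add: x22_x11 add_act)
    finally show "m \<bullet> x11 ^ k \<bullet> x22 = 1 \<rhd> (m \<bullet> x22 \<bullet> x11 ^ k)" using m by (simp add: k act_mult)
  qed
qed

section \<open>Injectivity of elements and of their powers\<close>

lemma normal_kills_or_inj:
  assumes "\<And>g. \<exists>c. c \<noteq> 0 \<and> qcomm c f (fvar g)"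
  shows "kills f \<or> (\<forall>m\<in>carrier N. m \<bullet> f = \<zero> \<longrightarrow> m = \<zero>)"
proof -
  have "{m \<in> carrier N. m \<bullet> f = \<zero>} = {\<zero>} \<or> {m \<in> carrier N. m \<bullet> f = \<zero>} = carrier N"
  proof (rule submodule_cases)
    fix m g assume m: "m \<in> {m \<in> carrier N. m \<bullet> f = \<zero>}"
    obtain c where c: "c \<noteq> 0" "qcomm c f (fvar g)" using assms by blast
    have "c \<rhd> (m \<bullet> fvar g \<bullet> f) = \<zero>" using qcommD[OF c(2), of m] m by simp
    then have "m \<bullet> fvar g \<bullet> f = \<zero>" by (rule sm_eq_zero) (use c(1) m in simp_all)
    then show "m \<bullet> fvar g \<in> {m \<in> carrier N. m \<bullet> f = \<zero>}" using m by simp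
  qed (auto simp: add_act)
  then show ?thesis
  proof
    assume *: "{m \<in> carrier N. m \<bullet> f = \<zero>} = {\<zero>}"
    have "m = \<zero>" if "m \<in> carrier N" "m \<bullet> f = \<zero>" for m
    proof -
      have "m \<in> {m \<in> carrier N. m \<bullet> f = \<zero>}" using that by simp
      then show ?thesis unfolding * by simp
    qed
    then show ?thesis by (intro disjI2 ballI impI)
  next
    assume *: "{m \<in> carrier N. m \<bullet> f = \<zero>} = carrier N"
    have "m \<bullet> f = \<zero>" if "m \<in> carrier N" for m
    proof -
      have "m \<in> {m \<in> carrier N. m \<bullet> f = \<zero>}" unfolding * by (rule that)
      then show ?thesis by simp
    qed
    then show ?thesis by (simp add: kills_def)
  qed
qed

lemma inj_power:
  assumes "\<And>m. m \<in> carrier N \<Longrightarrow> m \<bullet> f = \<zero> \<Longrightarrow> m = \<zero>" and "m \<in> carrier N" "m \<bullet> f ^ k = \<zero>"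
  shows "m = \<zero>"
  using assms(2,3)
proof (induction k arbitrary: m)
  case (Suc k)
  have "m \<bullet> f \<bullet> f ^ k = \<zero>" using Suc.prems by (simp add: act_mult)
  then have "m \<bullet> f = \<zero>" using Suc.IH[of "m \<bullet> f"] Suc.prems(1) by simp
  then show ?case using assms(1)[OF Suc.prems(1)] by simp
qed simp

lemma torsionfree_iff:
  "torsionfree (M2 \<alpha> \<beta>) N (M2_class \<alpha> \<beta> f) \<longleftrightarrow> (\<forall>m\<in>carrier N. m \<bullet> f = \<zero> \<longrightarrow> m = \<zero>)"
proof
  assume tf: "torsionfree (M2 \<alpha> \<beta>) N (M2_class \<alpha> \<beta> f)"
  show "\<forall>m\<in>carrier N. m \<bullet> f = \<zero> \<longrightarrow> m = \<zero>"
  proof (intro ballI impI)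
    fix m assume m: "m \<in> carrier N" "m \<bullet> f = \<zero>"
    then have "m \<bullet> f ^ 1 = \<zero>" by simp
    then have "\<exists>k. m \<bullet> f ^ k = \<zero>" by (rule exI)
    then show "m = \<zero>" using tf m(1) unfolding torsionfree_def M2_class_power[symmetric] by simp
  qed
next
  assume inj: "\<forall>m\<in>carrier N. m \<bullet> f = \<zero> \<longrightarrow> m = \<zero>"
  show "torsionfree (M2 \<alpha> \<beta>) N (M2_class \<alpha> \<beta> f)"
    unfolding torsionfree_def M2_class_power[symmetric]
  proof (intro ballI impI)
    fix m assume m: "m \<in> carrier N" "\<exists>k. m \<bullet> f ^ k = \<zero>"
    then obtain k where "m \<bullet> f ^ k = \<zero>" by blast
    moreover have "\<And>m. m \<in> carrier N \<Longrightarrow> m \<bullet> f = \<zero> \<Longrightarrow> m = \<zero>" using inj by blast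
    ultimately show "m = \<zero>" using inj_power m(1) by blast
  qed
qed

lemma torsionfreeD:
  assumes "torsionfree (M2 \<alpha> \<beta>) N (M2_class \<alpha> \<beta> f)" "m \<in> carrier N" "m \<bullet> f = \<zero>"
  shows "m = \<zero>"
  using assms(1)[unfolded torsionfree_iff, rule_format, OF assms(2,3)] .

lemmas x12_inj = torsionfreeD[OF torsionfree_x12[unfolded M2_gen_def]]
lemmas x21_inj = torsionfreeD[OF torsionfree_x21[unfolded M2_gen_def]]
lemmas det_inj = torsionfreeD[OF torsionfree_det[unfolded M2_det_def, folded det_def]]

lemma Y_inj:
  assumes "m \<in> carrier N" "m \<bullet> Y = \<zero>" shows "m = \<zero>"
proof (rule x12_inj)
  show "m \<bullet> x12 = \<zero>" by (rule x21_inj) (use assms in \<open>simp_all add: act_mult\<close>)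
qed (rule assms)

text \<open>The four slots match the four variables of the polynomial tower; a shorter list of
  elements is padded with 1.\<close>

definition monomials :: "'m \<Rightarrow> 'k falg \<Rightarrow> 'k falg \<Rightarrow> 'k falg \<Rightarrow> 'k falg \<Rightarrow> 'm set" where
  "monomials v g1 g2 g3 g4 = range (\<lambda>(i, j, k, t). v \<bullet> g1 ^ i \<bullet> g2 ^ j \<bullet> g3 ^ k \<bullet> g4 ^ t)"

lemma monomials_closed:
  "v \<in> carrier N \<Longrightarrow> monomials v g1 g2 g3 g4 \<subseteq> carrier N"
  by (auto simp: monomials_def)

text \<open>\<open>g\<close> travels left past the powers behind its own slot at the price of a
  scalar and then raises the exponent in its slot.\<close>

lemma span_monomials_act:
  assumes v: "v \<in> carrier N"
    and qc: "\<And>g h. g \<in> {g1, g2, g3, g4} \<Longrightarrow> h \<in> {g1, g2, g3, g4} \<Longrightarrow> \<exists>c. qcomm c g h"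
    and g: "g \<in> {g1, g2, g3, g4}"
    and m: "m \<in> F.span (monomials v g1 g2 g3 g4)"
  shows "m \<bullet> g \<in> F.span (monomials v g1 g2 g3 g4)"
proof -
  let ?S = "monomials v g1 g2 g3 g4"
  have SC: "?S \<subseteq> carrier N" using monomials_closed[OF v] .
  have mon: "v \<bullet> g1 ^ i \<bullet> g2 ^ j \<bullet> g3 ^ k \<bullet> g4 ^ t \<bullet> g \<in> F.span ?S" for i j k t
  proof -
    let ?e = "\<lambda>i j k t. v \<bullet> g1 ^ i \<bullet> g2 ^ j \<bullet> g3 ^ k \<bullet> g4 ^ t"
    have e: "c \<rhd> ?e i j k t \<in> F.span ?S" for c i j k t
      by (rule F.span_base_act[OF _ SC]) (auto simp: monomials_def intro: range_eqI[of _ _ "(i, j, k, t)"])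
    have swap: "\<exists>c. \<forall>m\<in>carrier N. m \<bullet> h ^ i \<bullet> g = c \<rhd> (m \<bullet> g \<bullet> h ^ i)" if h: "h \<in> {g1, g2, g3, g4}" for h i
    proof -
      obtain c where "qcomm c h g" using qc[OF h g] by blast
      then have "qcomm (c ^ i) (h ^ i) g" by (rule qcomm_power_left)
      then show ?thesis unfolding qcomm_def by blast
    qed
    obtain c1 where c1: "\<And>m. m \<in> carrier N \<Longrightarrow> m \<bullet> g4 ^ t \<bullet> g = c1 \<rhd> (m \<bullet> g \<bullet> g4 ^ t)" using swap[of g4 t] by blast
    obtain c2 where c2: "\<And>m. m \<in> carrier N \<Longrightarrow> m \<bullet> g3 ^ k \<bullet> g = c2 \<rhd> (m \<bullet> g \<bullet> g3 ^ k)" using swap[of g3 k] by blast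
    obtain c3 where c3: "\<And>m. m \<in> carrier N \<Longrightarrow> m \<bullet> g2 ^ j \<bullet> g = c3 \<rhd> (m \<bullet> g \<bullet> g2 ^ j)" using swap[of g2 j] by blast
    have suc: "m \<bullet> h ^ i \<bullet> h = m \<bullet> h ^ Suc i" if "m \<in> carrier N" for m h i
      using that by (simp add: power_Suc2 act_mult del: power_Suc)
    consider "g = g4" | "g = g3" | "g = g2" | "g = g1" using g by blast
    then show ?thesis
    proof cases
      case 1
      then have "?e i j k t \<bullet> g = 1 \<rhd> ?e i j k (Suc t)" using v suc[of "v \<bullet> g1 ^ i \<bullet> g2 ^ j \<bullet> g3 ^ k" g4 t] by simp
      then show ?thesis by (simp only: e)
    next
      case 2
      have "?e i j k t \<bullet> g = c1 \<rhd> ?e i j (Suc k) t"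
        using v suc[of "v \<bullet> g1 ^ i \<bullet> g2 ^ j" g3 k] by (simp add: c1) (simp add: 2)
      then show ?thesis by (simp only: e)
    next
      case 3
      have "?e i j k t \<bullet> g = (c1 * c2) \<rhd> ?e i (Suc j) k t"
        using v suc[of "v \<bullet> g1 ^ i" g2 j] by (simp add: c1 c2) (simp add: 3)
      then show ?thesis by (simp only: e)
    next
      case 4
      have "?e i j k t \<bullet> g = (c1 * c2 * c3) \<rhd> ?e (Suc i) j k t"
        using v suc[of v g1 i] by (simp add: c1 c2 c3 mult.assoc) (simp add: 4)
      then show ?thesis by (simp only: e)
    qed
  qed
  show ?thesis
  proof (rule F.span_image[OF m SC _ _ SC])
    fix s r assume "s \<in> ?S"
    then obtain i j k t where s: "s = v \<bullet> g1 ^ i \<bullet> g2 ^ j \<bullet> g3 ^ k \<bullet> g4 ^ t" by (auto simp: monomials_def)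
    have "r \<rhd> (s \<bullet> g) \<in> F.span ?S" unfolding s by (rule F.span_act[OF mon SC])
    moreover have "s \<in> carrier N" using v by (simp add: s)
    ultimately show "(r \<rhd> s) \<bullet> g \<in> F.span ?S" by simp
  qed (simp_all add: add_act)
qed

text \<open>The n-th powers are the four commuting endomorphisms, and the actions of all algebra
  elements are the maps for which the module is simple. Finitely many generators remain: the
  monomials with exponents below \<open>n\<close>.\<close>

lemma central_powers_scalar:
  assumes v: "v \<in> carrier N" and n: "n > 0"
    and central: "\<And>g x. g \<in> {g1, g2, g3, g4} \<Longrightarrow> qcomm 1 (g ^ n) (fvar x)"
    and gen: "\<And>m. m \<in> carrier N \<Longrightarrow> \<exists>k. m \<bullet> (g4 ^ n) ^ k \<in> F.span (monomials v g1 g2 g3 g4)"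
    and nz: "\<not> kills (g4 ^ n)"
    and g: "g \<in> {g1, g2, g3, g4}"
  shows "\<exists>c. \<forall>m\<in>carrier N. m \<bullet> g ^ n = c \<rhd> m"
proof -
  define u where "u g m = m \<bullet> g ^ n" for g m
  define H where "H = range (\<lambda>f m. m \<bullet> f)"
  define S where "S = (\<lambda>(i, j, k, t). v \<bullet> g1 ^ i \<bullet> g2 ^ j \<bullet> g3 ^ k \<bullet> g4 ^ t) ` ({..<n} \<times> {..<n} \<times> {..<n} \<times> {..<n})"
  have c: "m \<bullet> g ^ n \<bullet> f = m \<bullet> f \<bullet> g ^ n" if "g \<in> {g1, g2, g3, g4}" "m \<in> carrier N" for g f m
    using qcomm_1_falg[OF central[OF that(1)], of f] that(2) unfolding qcomm_def by simp
  have u_cases: "\<exists>g. g \<in> {g1, g2, g3, g4} \<and> h = u g" if "h \<in> {u g1, u g2, u g3, u g4}" for h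
    using that by auto
  have "\<forall>g\<in>{u g1, u g2, u g3, u g4}. \<exists>c. \<forall>m\<in>carrier N. g m = c \<rhd> m"
  proof (rule commuting_endomorphisms_scalar[of N "\<lambda>m c. c \<rhd> m" "u g1" "u g2" "u g3" "u g4" H S])
    show "comm_ring_action N (\<lambda>m c. c \<rhd> m)" by (rule F.comm_ring_action_axioms)
    show "h m \<in> carrier N" if "h \<in> {u g1, u g2, u g3, u g4}" "m \<in> carrier N" for h m
      using that by (auto simp: u_def)
    show "h (m \<oplus> m') = h m \<oplus> h m'" if "h \<in> {u g1, u g2, u g3, u g4}" "m \<in> carrier N" "m' \<in> carrier N" for h m m'
      using that by (auto simp: u_def add_act)
    show "h (c \<rhd> m) = c \<rhd> h m" if "h \<in> {u g1, u g2, u g3, u g4}" "m \<in> carrier N" for h m c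
      using that by (auto simp: u_def)
    show "h (h' m) = h' (h m)" if h: "h \<in> {u g1, u g2, u g3, u g4}" "h' \<in> {u g1, u g2, u g3, u g4}" and m: "m \<in> carrier N" for h h' m
    proof -
      obtain g where "h = u g" using u_cases[OF h(1)] by blast
      moreover obtain g' where "g' \<in> {g1, g2, g3, g4}" "h' = u g'" using u_cases[OF h(2)] by blast
      ultimately show ?thesis using c[of g' m "g ^ n"] m by (simp add: u_def)
    qed
    show "U = {\<zero>} \<or> U = carrier N" if U: "U \<subseteq> carrier N" "\<zero> \<in> U" "\<And>m n. m \<in> U \<Longrightarrow> n \<in> U \<Longrightarrow> m \<ominus> n \<in> U"
      "\<And>h m. h \<in> H \<Longrightarrow> m \<in> U \<Longrightarrow> h m \<in> U" for U
    proof (rule submodule_cases)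
      have act: "m \<bullet> f \<in> U" if "m \<in> U" for m f using U(4) that unfolding H_def by blast
      show "m \<oplus> m' \<in> U" if "m \<in> U" "m' \<in> U" for m m'
      proof -
        have "m' \<bullet> (- 1) \<in> U" using act that by blast
        then have "m \<ominus> (m' \<bullet> (- 1)) \<in> U" using U(3) that by blast
        moreover have "m \<ominus> (m' \<bullet> (- 1)) = m \<oplus> m'" using that U(1) by (simp add: act_uminus minus_eq subset_iff)
        ultimately show ?thesis by simp
      qed
      show "c \<rhd> m \<in> U" if "m \<in> U" for c m using act[OF that] by (simp add: sm_def)
      show "m \<bullet> fvar g \<in> U" if "m \<in> U" for m g using act[OF that] .
    qed (use U in auto)
    show "h m \<in> carrier N" if "h \<in> H" "m \<in> carrier N" for h m using that by (auto simp: H_def)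
    show "h (m \<oplus> m') = h m \<oplus> h m'" if "h \<in> H" "m \<in> carrier N" "m' \<in> carrier N" for h m m'
      using that by (auto simp: H_def add_act)
    show "h (c \<rhd> m) = c \<rhd> h m" if "h \<in> H" "m \<in> carrier N" for h m c
      using that by (auto simp: H_def)
    show "h (h' m) = h' (h m)" if h: "h \<in> H" "h' \<in> {u g1, u g2, u g3, u g4}" and m: "m \<in> carrier N" for h h' m
    proof -
      obtain g where "g \<in> {g1, g2, g3, g4}" "h' = u g" using u_cases[OF h(2)] by blast
      moreover obtain f where "h = (\<lambda>m. m \<bullet> f)" using h(1) by (auto simp: H_def)
      ultimately show ?thesis using c[of g m f] m by (simp add: u_def)
    qed
    show "finite S" "S \<subseteq> carrier N" using v by (auto simp: S_def)
    show "\<exists>m\<in>carrier N. u g4 m \<noteq> \<zero>" using nz by (auto simp: kills_def u_def)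
  next
    fix T m assume S: "S \<subseteq> T" and T: "T \<subseteq> carrier N" "\<zero> \<in> T" "\<And>m n. m \<in> T \<Longrightarrow> n \<in> T \<Longrightarrow> m \<oplus> n \<in> T"
      "\<And>m c. m \<in> T \<Longrightarrow> c \<rhd> m \<in> T" and Tu: "\<And>h m. h \<in> {u g1, u g2, u g3, u g4} \<Longrightarrow> m \<in> T \<Longrightarrow> h m \<in> T"
      and m: "m \<in> carrier N"
    have Tp: "m \<bullet> (g ^ n) ^ k \<in> T" if "m \<in> T" "g \<in> {g1, g2, g3, g4}" for m g k
      using that(1)
    proof (induction k arbitrary: m)
      case 0
      then show ?case using T(1) by auto
    next
      case (Suc k)
      have "u g m \<in> T" using Tu Suc.prems that(2) by blast
      then show ?case using Suc.IH[of "u g m"] Suc.prems T(1) by (auto simp: act_mult u_def)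
    qed
    have split: "m \<bullet> g ^ i = m \<bullet> g ^ (i mod n) \<bullet> (g ^ n) ^ (i div n)" if "m \<in> carrier N" for m g i
      using that by (simp add: act_mult[symmetric] flip: power_mult power_add)
    have cp: "m \<bullet> (g ^ n) ^ k \<bullet> f = m \<bullet> f \<bullet> (g ^ n) ^ k" if "g \<in> {g1, g2, g3, g4}" "m \<in> carrier N" for g f m k
      using qcommD[OF qcomm_power_left[OF qcomm_1_falg[OF central[OF that(1)]]] that(2), of k f] that(2) by simp
    have "monomials v g1 g2 g3 g4 \<subseteq> T"
    proof -
      \<comment> \<open>Every exponent is split into its residue modulo \<open>n\<close> and a
        multiple of \<open>n\<close>. The central powers are collected at the end, and what stands
        in front of them belongs to \<open>S\<close>.\<close>
      have "v \<bullet> g1 ^ i \<bullet> g2 ^ j \<bullet> g3 ^ k \<bullet> g4 ^ t \<in> T" for i j k t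
      proof -
        define v1 where "v1 = v \<bullet> g1 ^ (i mod n)"
        define v2 where "v2 = v1 \<bullet> g2 ^ (j mod n)"
        define v3 where "v3 = v2 \<bullet> g3 ^ (k mod n)"
        define z1 where "z1 = (g1 ^ n) ^ (i div n)"
        define z2 where "z2 = (g2 ^ n) ^ (j div n)"
        define z3 where "z3 = (g3 ^ n) ^ (k div n)"
        have C: "v1 \<in> carrier N" "v2 \<in> carrier N" "v3 \<in> carrier N"
          using v by (simp_all add: v1_def v2_def v3_def)
        have z: "m \<bullet> z1 \<bullet> f = m \<bullet> f \<bullet> z1" "m \<bullet> z2 \<bullet> f = m \<bullet> f \<bullet> z2" "m \<bullet> z3 \<bullet> f = m \<bullet> f \<bullet> z3"
          if "m \<in> carrier N" for m f
          unfolding z1_def z2_def z3_def using cp that by simp_all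
        have e1: "v \<bullet> g1 ^ i = v1 \<bullet> z1"
          using split[OF v, of g1 i] by (simp add: v1_def z1_def)
        have e2: "v1 \<bullet> g2 ^ j = v2 \<bullet> z2"
          using split[OF C(1), of g2 j] by (simp add: v2_def z2_def)
        have e3: "v2 \<bullet> g3 ^ k = v3 \<bullet> z3"
          using split[OF C(2), of g3 k] by (simp add: v3_def z3_def)
        have "v \<bullet> g1 ^ i \<bullet> g2 ^ j \<bullet> g3 ^ k \<bullet> g4 ^ t = v3 \<bullet> g4 ^ t \<bullet> z3 \<bullet> z2 \<bullet> z1"
          by (simp only: e1 e2 e3 z(1)[of v1 "g2 ^ j"] z(1)[of "v2 \<bullet> z2" "g3 ^ k"] z(2)[of v2 "g3 ^ k"]
            z(1)[of "v3 \<bullet> z3 \<bullet> z2" "g4 ^ t"] z(2)[of "v3 \<bullet> z3" "g4 ^ t"] z(3)[of v3 "g4 ^ t"] C act_closed)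
        also have "v3 \<bullet> g4 ^ t = v3 \<bullet> g4 ^ (t mod n) \<bullet> (g4 ^ n) ^ (t div n)"
          by (rule split) (rule C)
        finally have "v \<bullet> g1 ^ i \<bullet> g2 ^ j \<bullet> g3 ^ k \<bullet> g4 ^ t =
          v \<bullet> g1 ^ (i mod n) \<bullet> g2 ^ (j mod n) \<bullet> g3 ^ (k mod n) \<bullet> g4 ^ (t mod n)
            \<bullet> (g4 ^ n) ^ (t div n) \<bullet> (g3 ^ n) ^ (k div n) \<bullet> (g2 ^ n) ^ (j div n) \<bullet> (g1 ^ n) ^ (i div n)"
          by (simp only: v1_def v2_def v3_def z1_def z2_def z3_def)
        moreover have "v \<bullet> g1 ^ (i mod n) \<bullet> g2 ^ (j mod n) \<bullet> g3 ^ (k mod n) \<bullet> g4 ^ (t mod n) \<in> T"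
          using n by (intro subsetD[OF S]) (auto simp: S_def intro!: image_eqI[of _ _ "(i mod n, j mod n, k mod n, t mod n)"])
        ultimately show ?thesis using Tp by simp
      qed
      then show ?thesis by (auto simp: monomials_def)
    qed
    then have sub: "F.span (monomials v g1 g2 g3 g4) \<subseteq> T"
    proof (intro subsetI)
      fix x assume "x \<in> F.span (monomials v g1 g2 g3 g4)"
      then show "x \<in> T"
        by (induction rule: F.span.induct) (use T \<open>monomials v g1 g2 g3 g4 \<subseteq> T\<close> in auto)
    qed
    obtain k where "m \<bullet> (g4 ^ n) ^ k \<in> T" using gen[OF m] sub by blast
    moreover have "(u g4 ^^ k) m = m \<bullet> (g4 ^ n) ^ k"
      using m by (induction k) (simp_all add: act_mult power_Suc2 u_def del: power_Suc)
    ultimately show "\<exists>k. (u g4 ^^ k) m \<in> T" by (intro exI[of _ k]) (simp only:)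
  qed
  then show ?thesis using g by (auto simp: u_def)
qed

text \<open>\<open>W\<close> is not known to be finite-dimensional, so the eigenvector is extracted
  from the polynomial X^n - c, which annihilates \<open>w\<close>: when a root is split off, either
  the cofactor \<open>h\<close> still annihilates \<open>w\<close>, or the image of \<open>w\<close>
  under \<open>h\<close> is an eigenvector.\<close>

lemma eigenvector:
  assumes W: "W \<subseteq> carrier N" "\<And>m n. m \<in> W \<Longrightarrow> n \<in> W \<Longrightarrow> m \<oplus> n \<in> W" "\<And>m c. m \<in> W \<Longrightarrow> c \<rhd> m \<in> W"
    and stable: "\<And>m. m \<in> W \<Longrightarrow> m \<bullet> f \<in> W"
    and w: "w \<in> W" "w \<noteq> \<zero>"
    and scalar: "\<And>m. m \<in> carrier N \<Longrightarrow> m \<bullet> f ^ n = c \<rhd> m" and n: "n > 0"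
  shows "\<exists>d w. w \<in> W \<and> w \<noteq> \<zero> \<and> w \<bullet> f = d \<rhd> w"
proof -
  interpret P: poly_action N "\<lambda>m c. c \<rhd> m" "\<lambda>m. m \<bullet> f"
    by unfold_locales (simp_all add: add_act)
  have WP: "P.pact m g \<in> W" if "m \<in> W" for m g
    using that
  proof (induction g arbitrary: m)
    case 0
    then show ?case using W(3)[of m 0] W(1) by auto
  next
    case (pCons a g)
    then show ?case using W stable by (subst P.pact_pCons) auto
  qed
  have *: "\<exists>d w. w \<in> W \<and> w \<noteq> \<zero> \<and> w \<bullet> f = d \<rhd> w" if "g \<noteq> 0" "P.pact w g = \<zero>" for g
    using that
  proof (induction "Polynomial.degree g" arbitrary: g rule: less_induct)
    case less
    have wC: "w \<in> carrier N" using w W by auto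
    show ?case
    proof (cases "Polynomial.degree g = 0")
      case True
      then obtain c where "g = [:c:]" by (rule degree_eq_zeroE)
      then show ?thesis using less.prems sm_eq_zero[of c w] wC w by simp
    next
      case False
      then obtain r where "poly g r = 0" using alg_closed_imp_poly_has_root[of g] by blast
      then obtain h where h: "g = h * [:- r, 1:]" by (auto simp: poly_eq_0_iff_dvd dvd_def mult.commute)
      have "h \<noteq> 0" using less.prems h by auto
      then have d: "Polynomial.degree h < Polynomial.degree g"
        using h by (simp add: degree_mult_eq del: mult_pCons_right)
      show ?thesis
      proof (cases "P.pact w h = \<zero>")
        case True
        then show ?thesis using less.hyps[OF d \<open>h \<noteq> 0\<close>] by blast
      next
        case False
        let ?w = "P.pact w h"
        have wW: "?w \<in> W" "?w \<in> carrier N" using WP w W by auto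
        have "P.pact ?w [:- r, 1:] = \<zero>" using less.prems wC by (simp only: h P.pact_mult)
        moreover have "P.pact ?w ([:- r, 1:] + [:r:]) = P.pact ?w [:- r, 1:] \<oplus> P.pact ?w [:r:]"
          using wW by (intro P.pact_add)
        ultimately have "?w \<bullet> f = r \<rhd> ?w" using wW by (simp add: one_pCons)
        then show ?thesis using False wW by blast
      qed
    qed
  qed
  let ?g = "[:0, 1:] ^ n - [:c:]"
  have wC: "w \<in> carrier N" using w W by auto
  have pow: "P.pact m ([:0, 1:] ^ k) = m \<bullet> f ^ k" if "m \<in> carrier N" for m k
    using that
  proof (induction k arbitrary: m)
    case (Suc k)
    then show ?case by (simp add: P.P.act_mult[of m "[:0, 1:]"] act_mult del: mult_pCons_left)
  qed simp
  have "P.pact w ?g = \<zero>" using wC by (simp add: P.P.act_diff pow scalar minus_eq r_neg)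
  moreover have "?g \<noteq> 0"
  proof
    assume "?g = 0"
    then have "Polynomial.degree ([:0, 1:] ^ n :: 'k poly) = Polynomial.degree [:c:]" by simp
    then show False using n by (simp add: degree_power_eq)
  qed
  ultimately show ?thesis using * by blast
qed

text \<open>The eigenspace of one operator inside \<open>W\<close> is stable under the others, as
  they commute with it, and becomes the next \<open>W\<close>.\<close>

lemma joint_eigenvector:
  assumes "W \<subseteq> carrier N" "\<And>m n. m \<in> W \<Longrightarrow> n \<in> W \<Longrightarrow> m \<oplus> n \<in> W" "\<And>m c. m \<in> W \<Longrightarrow> c \<rhd> m \<in> W"
    and "\<And>f m. f \<in> set fs \<Longrightarrow> m \<in> W \<Longrightarrow> m \<bullet> f \<in> W"
    and "w \<in> W" "w \<noteq> \<zero>" and n: "n > 0"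
    and "\<And>f. f \<in> set fs \<Longrightarrow> \<exists>c. \<forall>m\<in>carrier N. m \<bullet> f ^ n = c \<rhd> m"
    and "\<And>f g. f \<in> set fs \<Longrightarrow> g \<in> set fs \<Longrightarrow> qcomm 1 f g"
  shows "\<exists>v. v \<in> W \<and> v \<noteq> \<zero> \<and> (\<forall>f\<in>set fs. \<exists>c. v \<bullet> f = c \<rhd> v)"
  using assms(1-6,8,9)
proof (induction fs arbitrary: W w)
  case (Cons f fs)
  note W = Cons.prems(1-3)
  obtain c where c: "\<And>m. m \<in> carrier N \<Longrightarrow> m \<bullet> f ^ n = c \<rhd> m" using Cons.prems(7)[of f] by auto
  obtain d w' where w': "w' \<in> W" "w' \<noteq> \<zero>" "w' \<bullet> f = d \<rhd> w'"
    using eigenvector[OF W, of f w n c] Cons.prems(4)[of f] Cons.prems(5,6) c n by auto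
  define W' where "W' = {m \<in> W. m \<bullet> f = d \<rhd> m}"
  have "\<exists>v. v \<in> W' \<and> v \<noteq> \<zero> \<and> (\<forall>f\<in>set fs. \<exists>c. v \<bullet> f = c \<rhd> v)"
  proof (rule Cons.IH)
    show "W' \<subseteq> carrier N" using W by (auto simp: W'_def)
    show "m \<oplus> n \<in> W'" if "m \<in> W'" "n \<in> W'" for m n
      using that W by (auto simp: W'_def add_act sm_add subset_iff)
    show "c \<rhd> m \<in> W'" if "m \<in> W'" for m c
      using that W by (auto simp: W'_def subset_iff mult.commute)
    show "m \<bullet> g \<in> W'" if "g \<in> set fs" "m \<in> W'" for g m
    proof -
      have m: "m \<in> W" "m \<bullet> f = d \<rhd> m" "m \<in> carrier N" using that W by (auto simp: W'_def)
      have "qcomm 1 g f" using Cons.prems(8)[of g f] that by simp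
      then have "m \<bullet> g \<bullet> f = d \<rhd> (m \<bullet> g)" using m by (simp add: qcommD)
      then show ?thesis using Cons.prems(4)[of g m] that m by (simp add: W'_def)
    qed
    show "w' \<in> W'" "w' \<noteq> \<zero>" using w' by (simp_all add: W'_def)
  qed (use Cons.prems(7,8) in auto)
  then show ?case by (auto simp: W'_def)
qed auto

end

section \<open>Classification\<close>

context simple_M2_module
begin

lemma qcomm_1_sym: "qcomm 1 f g \<Longrightarrow> qcomm 1 g f"
  using qcomm_sym[of 1 f g] by simp

lemma qcomm_power_period: "qcomm c f g \<Longrightarrow> c ^ n = 1 \<Longrightarrow> qcomm 1 (f ^ n) g"
  using qcomm_power_left[of c f g n] by simp

lemma qcomm_power_period': "qcomm c f g \<Longrightarrow> c ^ n = 1 \<Longrightarrow> qcomm 1 f (g ^ n)"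
  using qcomm_power_right[of c f g n] by simp

lemma power_gen_central:
  assumes n: "n > 0" "\<alpha> ^ n = 1" "\<beta> ^ n = 1" and g: "g \<in> {x12, x21, det, x11, x22}"
  shows "qcomm 1 (g ^ n) (fvar x)"
proof -
  have roots: "inverse \<alpha> ^ n = 1" "inverse \<beta> ^ n = 1" "(\<alpha> * \<beta>) ^ n = 1"
    "(\<beta> * inverse \<alpha>) ^ n = 1" "(\<alpha> * inverse \<beta>) ^ n = 1" "1 ^ n = (1 :: 'k)"
    using n by (simp_all add: power_mult_distrib power_inverse)
  consider "g = x12" | "g = x21" | "g = det" | "g = x11" | "g = x22" using g by blast
  then show ?thesis
  proof cases
    case 1
    show ?thesis unfolding 1 by (cases x)
      (simp_all add: roots n qcomm_power_period[OF qcomm_gens(1)] qcomm_power_period[OF qcomm_refl]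
        qcomm_power_period[OF qcomm_gens'(5)] qcomm_power_period[OF qcomm_gens'(4)])
  next
    case 2
    show ?thesis unfolding 2 by (cases x)
      (simp_all add: roots n qcomm_power_period[OF qcomm_gens(3)] qcomm_power_period[OF qcomm_gens(5)]
        qcomm_power_period[OF qcomm_refl] qcomm_power_period[OF qcomm_gens'(2)])
  next
    case 3
    show ?thesis unfolding 3 by (cases x)
      (simp_all add: roots n qcomm_power_period[OF qcomm_det(1)] qcomm_power_period[OF qcomm_det(2)] qcomm_power_period[OF qcomm_det(3)]
        qcomm_power_period[OF qcomm_det(4)])
  next
    case 4
    show ?thesis unfolding 4 by (cases x)
      (simp_all add: roots n qcomm_power_period[OF qcomm_refl]
        qcomm_power_period[OF qcomm_gens'(1)] qcomm_power_period[OF qcomm_gens'(3)] qcomm_x22_power_x11(2)[OF roots(3) n(1)])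
  next
    case 5
    show ?thesis unfolding 5 by (cases x)
      (simp_all add: roots n qcomm_power_period[OF qcomm_refl]
        qcomm_power_period[OF qcomm_gens(4)] qcomm_power_period[OF qcomm_gens(2)] qcomm_x22_power_x11(1)[OF roots(3) n(1)])
  qed
qed

section \<open>Elements whose n-th power acts by a scalar\<close>

definition scalar :: "'k falg \<Rightarrow> bool" where
  "scalar f \<longleftrightarrow> (\<exists>c. \<forall>m\<in>carrier N. m \<bullet> f = c \<rhd> m)"

lemma scalar_one: "scalar 1"
  unfolding scalar_def by (intro exI[of _ 1]) simp

lemma scalar_mult:
  assumes "scalar f" "scalar g" shows "scalar (f * g)"
proof -
  obtain c d where "\<And>m. m \<in> carrier N \<Longrightarrow> m \<bullet> f = c \<rhd> m" "\<And>m. m \<in> carrier N \<Longrightarrow> m \<bullet> g = d \<rhd> m"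
    using assms unfolding scalar_def by blast
  then have "\<forall>m\<in>carrier N. m \<bullet> (f * g) = (c * d) \<rhd> m" by (simp add: act_mult mult.commute)
  then show ?thesis unfolding scalar_def by blast
qed

lemma scalar_power: "scalar f \<Longrightarrow> scalar (f ^ k)"
  by (induction k) (simp_all add: scalar_one scalar_mult)

lemma scalar_power_power: "scalar (f ^ n) \<Longrightarrow> scalar ((f ^ k) ^ n)"
  using scalar_power[of "f ^ n" k] by (simp add: mult.commute flip: power_mult)

lemma mult_power_qcomm:
  assumes "qcomm c g f"
  shows "\<exists>d. \<forall>m\<in>carrier N. m \<bullet> (f * g) ^ k = d \<rhd> (m \<bullet> (f ^ k * g ^ k))"
proof (induction k)
  case 0
  show ?case by (intro exI[of _ 1]) simp
next
  case (Suc k)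
  then obtain d where d: "\<And>m. m \<in> carrier N \<Longrightarrow> m \<bullet> (f * g) ^ k = d \<rhd> (m \<bullet> (f ^ k * g ^ k))" by blast
  have swap: "m \<bullet> g \<bullet> f ^ k = c ^ k \<rhd> (m \<bullet> f ^ k \<bullet> g)" if "m \<in> carrier N" for m
    using qcommD[OF qcomm_power_right[OF assms] that] .
  have "m \<bullet> (f * g) ^ Suc k = (d * c ^ k) \<rhd> (m \<bullet> (f ^ Suc k * g ^ Suc k))" if m: "m \<in> carrier N" for m
  proof -
    have "m \<bullet> (f * g) ^ Suc k = d \<rhd> (m \<bullet> f \<bullet> g \<bullet> f ^ k \<bullet> g ^ k)" using m by (simp add: d act_mult)
    also have "m \<bullet> f \<bullet> g \<bullet> f ^ k = c ^ k \<rhd> (m \<bullet> f \<bullet> f ^ k \<bullet> g)" using m by (intro swap) simp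
    finally show ?thesis using m by (simp add: act_mult)
  qed
  then show ?case by blast
qed

text \<open>The purpose is \<open>Y\<close>: from \<open>x12\<close> and \<open>x21\<close> the
  scalar power passes to their product, because reordering the factors costs only a scalar.\<close>

lemma scalar_mult_power:
  assumes "qcomm c g f" "scalar (f ^ n)" "scalar (g ^ n)" shows "scalar ((f * g) ^ n)"
proof -
  obtain d where d: "\<And>m. m \<in> carrier N \<Longrightarrow> m \<bullet> (f * g) ^ n = d \<rhd> (m \<bullet> (f ^ n * g ^ n))"
    using mult_power_qcomm[OF assms(1)] by blast
  obtain c where "\<And>m. m \<in> carrier N \<Longrightarrow> m \<bullet> (f ^ n * g ^ n) = c \<rhd> m"
    using scalar_mult[OF assms(2,3)] unfolding scalar_def by blast
  then have "\<forall>m\<in>carrier N. m \<bullet> (f * g) ^ n = (d * c) \<rhd> m" using d by simp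
  then show ?thesis unfolding scalar_def by blast
qed

lemma monomials_base: "v \<in> carrier N \<Longrightarrow> v \<in> F.span (monomials v g1 g2 g3 g4)"
  by (rule F.span_base[OF _ monomials_closed])
    (auto simp: monomials_def intro: range_eqI[of _ _ "(0, 0, 0, 0)"])

text \<open>The span \<open>T\<close> of the monomials in \<open>x12\<close>, \<open>x21\<close>,
  \<open>det\<close>, \<open>x11\<close> on one vector need not be stable under \<open>x22\<close>.
  Its enlargement \<open>U\<close>, consisting of the vectors that some power of
  \<open>x11 ^ n\<close> moves into \<open>T\<close>, is a nonzero submodule and hence all of
  \<open>N\<close>.\<close>

lemma scalar_powers_x11_inj:
  assumes inj: "\<And>m. m \<in> carrier N \<Longrightarrow> m \<bullet> x11 = \<zero> \<Longrightarrow> m = \<zero>"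
    and n: "n > 0" "\<alpha> ^ n = 1" "\<beta> ^ n = 1"
  shows "\<forall>g\<in>{x12, x21, det, x11}. scalar (g ^ n)"
proof
  fix g assume g: "g \<in> {x12, x21, det, x11}"
  obtain v where v: "v \<in> carrier N" "v \<noteq> \<zero>" using carrier_nontrivial by blast
  define T where "T = F.span (monomials v x12 x21 det x11)"
  have SC: "monomials v x12 x21 det x11 \<subseteq> carrier N" using monomials_closed[OF v(1)] .
  have TC: "T \<subseteq> carrier N" unfolding T_def using F.span_closed[OF _ SC] by blast
  have vT: "v \<in> T" unfolding T_def by (rule monomials_base[OF v(1)])
  have T_add: "m \<oplus> m' \<in> T" if "m \<in> T" "m' \<in> T" for m m'
    using that F.span_add[OF _ _ SC] unfolding T_def by blast
  have T_sm: "c \<rhd> m \<in> T" if "m \<in> T" for m c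
    using that F.span_act[OF _ SC] unfolding T_def by blast
  have qc: "\<exists>c. qcomm c f h" if "f \<in> {x12, x21, det, x11}" "h \<in> {x12, x21, det, x11}" for f h
    using that qcomm_gens qcomm_gens' qcomm_det qcomm_det[THEN qcomm_sym] qcomm_refl by auto
  have T_act: "m \<bullet> h \<in> T" if "h \<in> {x12, x21, det, x11}" "m \<in> T" for m h
    unfolding T_def using qc
    by (intro span_monomials_act[OF v(1) _ that(1)]) (use that(2) T_def in auto)
  define z where "z = x11 ^ n"
  have T_power: "m \<bullet> x11 ^ k \<in> T" if "m \<in> T" for m k
    using that
  proof (induction k arbitrary: m)
    case 0
    then show ?case using TC by auto
  next
    case (Suc k)
    then show ?case using Suc.IH[OF T_act[of x11 m]] TC by (auto simp: act_mult)
  qed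
  have T_z: "m \<bullet> z ^ k \<in> T" if "m \<in> T" for m k
    unfolding z_def power_mult[symmetric] using that by (rule T_power)
  have T_Y: "m \<bullet> Y \<in> T" if "m \<in> T" for m
    using T_act[of x21 "m \<bullet> x12"] T_act[of x12 m] that TC by (auto simp: act_mult)
  have z_comm: "m \<bullet> f \<bullet> z ^ k = m \<bullet> z ^ k \<bullet> f" if "m \<in> carrier N" for m f k
    using qcommD[OF qcomm_power_left[OF qcomm_1_falg[OF power_gen_central[OF n, of x11]]] that, of k f] that
    by (simp add: z_def)
  define U where "U = {m \<in> carrier N. \<exists>k. m \<bullet> z ^ k \<in> T}"
  have "U = {\<zero>} \<or> U = carrier N"
  proof (rule submodule_cases)
    show "U \<subseteq> carrier N" by (auto simp: U_def)
    show "\<zero> \<in> U" using F.span_zero by (auto simp: U_def T_def)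
    fix m assume m: "m \<in> U"
    then obtain k where k: "m \<in> carrier N" "m \<bullet> z ^ k \<in> T" by (auto simp: U_def)
    show "c \<rhd> m \<in> U" for c using k T_sm by (auto simp: U_def)
    show "m \<bullet> fvar h \<in> U" for h
    proof (cases "h = X22")
      case False
      then have "fvar h \<in> {x12, x21, det, x11}" by (cases h) auto
      then have "m \<bullet> fvar h \<bullet> z ^ k \<in> T" using T_act k by (simp add: z_comm)
      then show ?thesis using k(1) by (auto simp: U_def)
    next
      case True
      \<comment> \<open>One factor \<open>x11\<close> of \<open>z ^ Suc k\<close> is held back to
        meet \<open>x22\<close>: on \<open>t\<close>, which lies in \<open>T\<close>, the product
        \<open>x11 * x22\<close> is \<open>det\<close> plus a multiple of \<open>Y\<close>, and both
        preserve \<open>T\<close>.\<close>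
      define t where "t = m \<bullet> z ^ k \<bullet> x11 ^ (n - 1)"
      have t: "t \<in> T" "t \<in> carrier N" unfolding t_def using T_power[OF k(2)] TC by auto
      have z: "z = x11 ^ (n - 1) * x11" using n(1) unfolding z_def by (simp flip: power_Suc2)
      have "m \<bullet> z ^ Suc k = m \<bullet> z ^ k \<bullet> z" using k(1) by (simp add: power_Suc2 act_mult del: power_Suc)
      also have "\<dots> = t \<bullet> x11" unfolding t_def by (subst (2) z) (use k(1) in \<open>simp add: act_mult\<close>)
      finally have "m \<bullet> z ^ Suc k \<bullet> x22 = t \<bullet> det \<oplus> inverse \<alpha> \<rhd> (t \<bullet> Y)"
        using t(2) by (simp only: x11_x22)
      then have "m \<bullet> x22 \<bullet> z ^ Suc k = t \<bullet> det \<oplus> inverse \<alpha> \<rhd> (t \<bullet> Y)"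
        unfolding z_comm[OF k(1), of x22] .
      also have "\<dots> \<in> T" by (intro T_add T_sm T_act T_Y t) simp
      finally have "\<exists>k. m \<bullet> x22 \<bullet> z ^ k \<in> T" by (rule exI)
      then show ?thesis using k(1) True unfolding U_def by simp
    qed
    fix m' assume "m' \<in> U"
    then obtain k' where k': "m' \<in> carrier N" "m' \<bullet> z ^ k' \<in> T" by (auto simp: U_def)
    have "m \<bullet> z ^ (k + k') \<in> T" using T_z[OF k(2), of k'] k(1) by (simp add: power_add act_mult)
    moreover have "m' \<bullet> z ^ (k + k') \<in> T" using T_z[OF k'(2), of k] k'(1)
      by (simp add: power_add act_mult add.commute[of k])
    ultimately have "(m \<oplus> m') \<bullet> z ^ (k + k') \<in> T" using k k' T_add by (simp add: add_act)
    then show "m \<oplus> m' \<in> U" using k k' by (auto simp: U_def)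
  qed
  moreover have "v \<bullet> z ^ 0 \<in> T" using vT v by simp
  then have "v \<in> U" using v(1) unfolding U_def by blast
  ultimately have U: "U = carrier N" using v by auto
  have "\<exists>c. \<forall>m\<in>carrier N. m \<bullet> g ^ n = c \<rhd> m"
  proof (rule central_powers_scalar[OF v(1) n(1) _ _ _ g])
    show "qcomm 1 (g ^ n) (fvar x)" if "g \<in> {x12, x21, det, x11}" for g x
      by (rule power_gen_central[OF n]) (use that in auto)
    show "\<exists>k. m \<bullet> (x11 ^ n) ^ k \<in> F.span (monomials v x12 x21 det x11)" if "m \<in> carrier N" for m
      using that U unfolding U_def T_def z_def by blast
    show "\<not> kills (x11 ^ n)"
    proof
      assume "kills (x11 ^ n)"
      then have "v \<bullet> x11 ^ n = \<zero>" using v by (simp add: kills_def)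
      then show False using inj_power[of x11 v n] inj v by blast
    qed
  qed
  then show "scalar (g ^ n)" unfolding scalar_def .
qed

lemma scalar_powers_x11_ker:
  assumes v: "v \<in> carrier N" "v \<noteq> \<zero>" "v \<bullet> x11 = \<zero>"
    and n: "n > 0" "\<alpha> ^ n = 1" "\<beta> ^ n = 1"
  shows "\<forall>g\<in>{x12, x21, x22}. scalar (g ^ n)"
proof
  fix g assume g: "g \<in> {x12, x21, x22}"
  define T where "T = F.span (monomials v x12 x21 x22 1)"
  have SC: "monomials v x12 x21 x22 1 \<subseteq> carrier N" using monomials_closed[OF v(1)] .
  have TC: "T \<subseteq> carrier N" unfolding T_def using F.span_closed[OF _ SC] by blast
  have vT: "v \<in> T" unfolding T_def by (rule monomials_base[OF v(1)])
  have T_add: "m \<oplus> m' \<in> T" if "m \<in> T" "m' \<in> T" for m m'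
    using that F.span_add[OF _ _ SC] unfolding T_def by blast
  have T_sm: "c \<rhd> m \<in> T" if "m \<in> T" for m c
    using that F.span_act[OF _ SC] unfolding T_def by blast
  have qc: "\<exists>c. qcomm c f h" if "f \<in> {x12, x21, x22, 1}" "h \<in> {x12, x21, x22, 1}" for f h
    using that qcomm_gens qcomm_gens' qcomm_refl qcomm_one by auto
  have T_act: "m \<bullet> h \<in> T" if "h \<in> {x12, x21, x22, 1}" "m \<in> T" for m h
    unfolding T_def using qc
    by (intro span_monomials_act[OF v(1) _ that(1)]) (use that(2) T_def in auto)
  have T_power: "m \<bullet> h ^ k \<in> T" if "m \<in> T" "h \<in> {x12, x21, x22}" for m h k
    using that(1)
  proof (induction k arbitrary: m)
    case 0
    then show ?case using TC by auto
  next
    case (Suc k)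
    then show ?case using Suc.IH[OF T_act[of h m]] that(2) TC by (auto simp: act_mult)
  qed
  have T_Y: "m \<bullet> Y \<in> T" if "m \<in> T" for m
    using T_act[of x21 "m \<bullet> x12"] T_act[of x12 m] that TC by (auto simp: act_mult)
  have T_x11: "m \<bullet> x11 \<in> T" if m: "m \<in> T" for m
  proof -
    have "m \<bullet> x11 \<in> F.span (monomials v x12 x21 x22 1)"
    proof (rule F.span_image[OF m[unfolded T_def] SC _ _ SC])
      fix s r assume s: "s \<in> monomials v x12 x21 x22 1"
      obtain i j k where ijk: "s = v \<bullet> x12 ^ i \<bullet> x21 ^ j \<bullet> x22 ^ k"
        using s v(1) by (auto simp: monomials_def)
      define w where "w = v \<bullet> x12 ^ i \<bullet> x21 ^ j"
      have w: "w \<in> T" "w \<in> carrier N" unfolding w_def using T_power vT TC by auto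
      have "v \<bullet> x12 ^ i \<bullet> x11 = \<alpha> ^ i \<rhd> (v \<bullet> x11 \<bullet> x12 ^ i)"
        by (rule qcommD[OF qcomm_power_left[OF qcomm_gens(1)] v(1)])
      then have "v \<bullet> x12 ^ i \<bullet> x11 = \<zero>" by (simp add: v(3))
      moreover have "w \<bullet> x11 = \<beta> ^ j \<rhd> (v \<bullet> x12 ^ i \<bullet> x11 \<bullet> x21 ^ j)" unfolding w_def
        by (rule qcommD[OF qcomm_power_left[OF qcomm_gens(3)]]) (use v in simp)
      ultimately have w0: "w \<bullet> x11 = \<zero>" by simp
      have "s \<bullet> x11 \<in> T"
      proof (cases k)
        case 0
        have "\<zero> \<in> T" unfolding T_def by (rule F.span_zero)
        then show ?thesis using w0 0 w by (simp add: ijk flip: w_def)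
      next
        case (Suc j')
        define t where "t = w \<bullet> x22 ^ j'"
        have t: "t \<in> T" "t \<in> carrier N" unfolding t_def using T_power w TC by auto
        have "\<zero> = w \<bullet> det \<oplus> inverse \<alpha> \<rhd> (w \<bullet> Y)" using x11_x22[OF w(2)] w0 by simp
        then have "w \<bullet> det = \<ominus> (inverse \<alpha> \<rhd> (w \<bullet> Y))" using w(2) by (simp add: minus_equality)
        also have "\<dots> = (- 1) \<rhd> (inverse \<alpha> \<rhd> (w \<bullet> Y))"
          using w(2) F.act_uminus[of "inverse \<alpha> \<rhd> (w \<bullet> Y)" 1] by simp
        also have "\<dots> \<in> T" by (intro T_sm T_Y w)
        finally have "w \<bullet> det \<bullet> x22 ^ j' \<in> T" by (rule T_power) simp
        also have "w \<bullet> det \<bullet> x22 ^ j' = t \<bullet> det" unfolding t_def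
          using qcommD[OF qcomm_power_right[OF qcomm_det(2)] w(2), of j'] w(2) by simp
        finally have tD: "t \<bullet> det \<in> T" .
        have "s \<bullet> x11 = t \<bullet> x22 \<bullet> x11"
          using w by (simp add: ijk Suc power_Suc2 act_mult t_def del: power_Suc flip: w_def)
        also have "\<dots> = t \<bullet> det \<oplus> \<beta> \<rhd> (t \<bullet> Y)" using t(2) by (rule x22_x11)
        also have "\<dots> \<in> T" by (intro T_add tD T_sm T_Y t)
        finally show ?thesis .
      qed
      then have "r \<rhd> (s \<bullet> x11) \<in> T" by (rule T_sm)
      moreover have "s \<in> carrier N" using s SC by blast
      ultimately show "(r \<rhd> s) \<bullet> x11 \<in> F.span (monomials v x12 x21 x22 1)" by (simp add: T_def)
    qed (simp_all add: add_act)
    then show ?thesis by (simp add: T_def)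
  qed
  have "T = {\<zero>} \<or> T = carrier N"
  proof (rule submodule_cases)
    show "\<zero> \<in> T" unfolding T_def by (rule F.span_zero)
    show "m \<bullet> fvar h \<in> T" if "m \<in> T" for m h
      using that by (cases h) (auto intro: T_act T_x11)
  qed (use TC T_add T_sm in auto)
  then have T: "T = carrier N" using vT v by auto
  have g': "g \<in> {x12, x21, x22, 1}" using g by auto
  have "\<exists>c. \<forall>m\<in>carrier N. m \<bullet> g ^ n = c \<rhd> m"
  proof (rule central_powers_scalar[OF v(1) n(1) _ _ _ g'])
    show "qcomm 1 (g ^ n) (fvar x)" if "g \<in> {x12, x21, x22, 1}" for g x
    proof (cases "g = 1")
      case False
      then show ?thesis by (intro power_gen_central[OF n]) (use that in auto)
    qed (simp add: qcomm_one)
    show "\<exists>k. m \<bullet> (1 ^ n) ^ k \<in> F.span (monomials v x12 x21 x22 1)" if "m \<in> carrier N" for m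
      using that T unfolding T_def by simp
    show "\<not> kills (1 ^ n)" using v by (auto simp: kills_def)
  qed
  then show "scalar (g ^ n)" unfolding scalar_def .
qed

section \<open>Homomorphisms from the explicit modules\<close>

lemma act_Suc: "m \<in> carrier N \<Longrightarrow> m \<bullet> f ^ k \<bullet> f = m \<bullet> f ^ Suc k"
  by (simp add: power_Suc2 act_mult del: power_Suc)

text \<open>The parameters \<open>\<mu>4\<close> and \<open>\<mu>3\<close> are the eigenvalues of
  \<open>det\<close> and \<open>Y\<close> on the joint eigenvector, while \<open>\<mu>1\<close> and
  \<open>\<mu>2\<close> are roots, of orders \<open>m1\<close> and \<open>m2\<close>, of those of
  \<open>x11 ^ m1\<close> and \<open>x21 ^ m2\<close>. Normalising by powers of these roots makes
  the vectors \<open>E a b\<close> periodic in \<open>a\<close>.\<close>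

lemma V1_iso:
  assumes inj: "\<And>m. m \<in> carrier N \<Longrightarrow> m \<bullet> x11 = \<zero> \<Longrightarrow> m = \<zero>"
  shows "iso_to_V1 \<alpha> \<beta> N"
proof -
  obtain n where n: "n > 0" "\<alpha> ^ n = 1" "\<beta> ^ n = 1" by (rule common_period)
  have sc: "\<forall>g\<in>{x12, x21, det, x11}. scalar (g ^ n)" using inj n by (rule scalar_powers_x11_inj)
  have ratio: "(\<alpha> * inverse \<beta>) ^ m2 = 1" by (simp add: ratio_power_iff)
  obtain v0 where v0: "v0 \<in> carrier N" "v0 \<noteq> \<zero>" using carrier_nontrivial by blast
  have comm: "qcomm 1 det Y" "qcomm 1 det (x11 ^ m1)" "qcomm 1 det (x21 ^ m2)"
    "qcomm 1 Y (x11 ^ m1)" "qcomm 1 Y (x21 ^ m2)" "qcomm 1 (x11 ^ m1) (x21 ^ m2)"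
  proof -
    show "qcomm 1 det Y" by (rule qcomm_cong[OF qcomm_mult_right[OF qcomm_det(3,4)]]) (simp add: field_simps)
    show "qcomm 1 det (x11 ^ m1)" using qcomm_det(1) by (rule qcomm_power_period') simp
    show "qcomm 1 det (x21 ^ m2)" using qcomm_det(4) ratio by (rule qcomm_power_period')
    show "qcomm 1 Y (x11 ^ m1)" using qcomm_Y'(2) \<alpha>\<beta>_power_m1 by (rule qcomm_power_period')
    show "qcomm 1 Y (x21 ^ m2)" using qcomm_Y'(3) ratio by (rule qcomm_power_period')
    show "qcomm 1 (x11 ^ m1) (x21 ^ m2)"
      using qcomm_power[OF qcomm_gens'(3), of m1 m2] \<beta>_power_m12 by (simp add: power_inverse)
  qed
  have "\<exists>v. v \<in> carrier N \<and> v \<noteq> \<zero> \<and> (\<forall>f\<in>set [det, Y, x11 ^ m1, x21 ^ m2]. \<exists>c. v \<bullet> f = c \<rhd> v)"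
  proof (rule joint_eigenvector[of _ _ v0 n])
    show "qcomm 1 f g" if "f \<in> set [det, Y, x11 ^ m1, x21 ^ m2]" "g \<in> set [det, Y, x11 ^ m1, x21 ^ m2]" for f g
      using that comm comm[THEN qcomm_1_sym] qcomm_refl by auto
    have "scalar (Y ^ n)" using sc by (intro scalar_mult_power[OF qcomm_gens(5)]) auto
    then show "\<exists>c. \<forall>m\<in>carrier N. m \<bullet> f ^ n = c \<rhd> m" if "f \<in> set [det, Y, x11 ^ m1, x21 ^ m2]" for f
      unfolding scalar_def[symmetric] using that sc scalar_power_power by auto
  qed (use v0 n in auto)
  then obtain v \<mu>4 \<mu>3 \<nu>1 \<nu>2 where v: "v \<in> carrier N" "v \<noteq> \<zero>"
    and ev: "v \<bullet> det = \<mu>4 \<rhd> v" "v \<bullet> Y = \<mu>3 \<rhd> v" "v \<bullet> x11 ^ m1 = \<nu>1 \<rhd> v" "v \<bullet> x21 ^ m2 = \<nu>2 \<rhd> v"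
    by auto
  have "\<mu>4 \<noteq> 0" "\<mu>3 \<noteq> 0" using det_inj[OF v(1)] Y_inj[OF v(1)] v ev by auto
  moreover have "\<nu>1 \<noteq> 0" using inj_power[of x11 v m1, OF inj] v ev by auto
  moreover have "\<nu>2 \<noteq> 0" using inj_power[of x21 v m2, OF x21_inj] v ev by auto
  moreover obtain \<mu>1 where \<mu>1: "\<mu>1 ^ m1 = \<nu>1" using nth_root_exists[OF m1_pos] by blast
  moreover obtain \<mu>2 where \<mu>2: "\<mu>2 ^ m2 = \<nu>2" using nth_root_exists[OF m2_pos] by blast
  ultimately have nz: "\<mu>1 \<noteq> 0" "\<mu>2 \<noteq> 0" "\<mu>3 \<noteq> 0" "\<mu>4 \<noteq> 0" using m1_pos m2_pos by auto
  have [simp]: "\<mu>1 * (inverse \<mu>1 * x) = x" "\<mu>2 * (inverse \<mu>2 * x) = x" for x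
    using nz by (simp_all flip: mult.assoc)
  define P where "P = inverse (\<alpha> * \<beta>)"
  define Q where "Q = inverse \<alpha> * \<beta>"
  define E where "E a b = (inverse \<mu>1 ^ a * inverse \<mu>2 ^ b) \<rhd> (v \<bullet> x11 ^ a \<bullet> x21 ^ b)" for a b
  have EC: "E a b \<in> carrier N" for a b using v by (simp add: E_def)
  have E_per1: "E (m1 + a) b = E a b" for a b
    using v nz by (simp add: E_def power_add act_mult ev \<mu>1[symmetric] power_inverse) (simp add: field_simps)
  \<comment> \<open>Moving \<open>x21 ^ m2\<close> to the left of \<open>x11 ^ a\<close>, where it
    meets the eigenvector, produces the factor \<beta>^(-a m2) in the wrap-around of
    \<open>V1\<close>.\<close>
  have E_per2: "E a (m2 + b) = inverse \<beta> ^ (a * m2) \<rhd> E a b" for a b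
  proof -
    have "v \<bullet> x11 ^ a \<bullet> x21 ^ m2 = inverse \<beta> ^ (a * m2) \<rhd> (v \<bullet> x21 ^ m2 \<bullet> x11 ^ a)"
      by (rule qcommD[OF qcomm_power[OF qcomm_gens'(3)] v(1)])
    then show ?thesis
      using v nz by (simp add: E_def power_add act_mult ev \<mu>2[symmetric] power_inverse mult_ac)
        (simp add: field_simps)
  qed
  have E_x11: "E a b \<bullet> x11 = (\<mu>1 * \<beta> ^ b) \<rhd> E (Suc a) b" for a b
  proof -
    have "v \<bullet> x11 ^ a \<bullet> x21 ^ b \<bullet> x11 = \<beta> ^ b \<rhd> (v \<bullet> x11 ^ a \<bullet> x11 \<bullet> x21 ^ b)"
      by (rule qcommD[OF qcomm_power_left[OF qcomm_gens(3)]]) (use v in simp)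
    then show ?thesis using v nz unfolding E_def act_Suc[OF v(1)] by (simp add: mult_ac)
  qed
  have E_x21: "E a b \<bullet> x21 = \<mu>2 \<rhd> E a (Suc b)" for a b
    using v nz act_Suc[of "v \<bullet> x11 ^ a" x21 b] by (simp add: E_def mult_ac)
  have Y_ev: "v \<bullet> x11 ^ a \<bullet> Y = (P ^ a * \<mu>3) \<rhd> (v \<bullet> x11 ^ a)" for a
    using qcommD[OF qcomm_power_left[OF qcomm_Y(2)] v(1), of a] v ev by (simp add: P_def)
  have E_Y: "E a b \<bullet> Y = (Q ^ b * P ^ a * \<mu>3) \<rhd> E a b" for a b
  proof -
    have "v \<bullet> x11 ^ a \<bullet> x21 ^ b \<bullet> Y = Q ^ b \<rhd> (v \<bullet> x11 ^ a \<bullet> Y \<bullet> x21 ^ b)"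
      using qcommD[OF qcomm_power_left[OF qcomm_Y(3)], of "v \<bullet> x11 ^ a" b] v by (simp add: Q_def mult.commute)
    then show ?thesis using v by (simp add: E_def Y_ev mult_ac)
  qed
  \<comment> \<open>\<open>x12\<close> is recovered from \<open>Y\<close>: applied after
    \<open>x21\<close> it acts as \<beta>/\<alpha> times \<open>Y\<close>, whose eigenvalue on
    \<open>E a b\<close> is known.\<close>
  have E_x12: "E a (Suc b) \<bullet> x12 = (inverse \<mu>2 * \<mu>3 * Q ^ Suc b * P ^ a) \<rhd> E a b" for a b
  proof -
    have "\<mu>2 \<rhd> (E a (Suc b) \<bullet> x12) = E a b \<bullet> x21 \<bullet> x12"
      using EC by (simp add: E_x21)
    also have "\<dots> = Q \<rhd> (E a b \<bullet> Y)"
      using qcommD[OF qcomm_gens(5) EC] EC by (simp add: act_mult Q_def mult.commute)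
    also have "\<dots> = (Q ^ Suc b * P ^ a * \<mu>3) \<rhd> E a b" using EC by (simp add: E_Y mult_ac)
    finally have "E a (Suc b) \<bullet> x12 = inverse \<mu>2 \<rhd> (Q ^ Suc b * P ^ a * \<mu>3) \<rhd> E a b"
      using sm_cancel[of "E a (Suc b) \<bullet> x12" \<mu>2] EC nz by simp
    then show ?thesis using EC by (simp add: mult_ac)
  qed
  have E_x22: "E (Suc a) b \<bullet> x22 = (inverse \<mu>1 * inverse \<alpha> ^ b * (\<mu>4 + inverse \<alpha> * P ^ a * \<mu>3)) \<rhd> E a b" for a b
  proof -
    have "v \<bullet> x11 ^ a \<bullet> det = v \<bullet> det \<bullet> x11 ^ a"
      using qcommD[OF qcomm_power_right[OF qcomm_det(1)] v(1), of a] v by simp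
    then have D: "v \<bullet> x11 ^ a \<bullet> x11 \<bullet> x22 = (\<mu>4 + inverse \<alpha> * P ^ a * \<mu>3) \<rhd> (v \<bullet> x11 ^ a)"
      using v by (simp add: x11_x22 ev Y_ev add_sm mult_ac)
    have "v \<bullet> x11 ^ Suc a \<bullet> x21 ^ b \<bullet> x22 = inverse \<alpha> ^ b \<rhd> (v \<bullet> x11 ^ Suc a \<bullet> x22 \<bullet> x21 ^ b)"
      by (rule qcommD[OF qcomm_power_left[OF qcomm_gens'(2)]]) (use v in simp)
    then show ?thesis using v D unfolding E_def act_Suc[OF v(1)] by (simp add: mult_ac)
  qed
  let ?T = "V1_action \<alpha> \<beta> \<mu>1 \<mu>2 \<mu>3 \<mu>4"
  interpret V: basis_action \<alpha> \<beta> m1 m2 ?T using nz(1,2) by (rule basis_action_V1)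
  have P: "P ^ m1 = 1" using \<alpha>\<beta>_power_m1 unfolding P_def by (simp only: power_inverse) simp
  have Q: "Q ^ m2 = 1" using \<alpha>_power_m2 by (simp add: Q_def power_mult_distrib power_inverse)
  have hom: "\<exists>c q. q \<in> {..<m1} \<times> {..<m2} \<and> ?T g p = e_vec c q \<and>
      (\<lambda>(a, b). E a b) p \<bullet> fvar g = (\<lambda>(a, b). E a b) q \<bullet> fconst c"
    if "p \<in> {..<m1} \<times> {..<m2}" for g p
  proof -
    obtain a b where ab: "p = (a, b)" "a < m1" "b < m2" using \<open>p \<in> _\<close> by auto
    have E0: "E m1 b = E 0 b" for b using E_per1[of 0 b] by simp
    show ?thesis
    proof (cases g)
      case X11
      have "E (Suc a) b = E (Suc a mod m1) b" using ab(2) E0 by (cases "Suc a = m1") auto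
      then show ?thesis using X11 ab m1_pos
        by (intro exI[of _ "\<mu>1 * \<beta> ^ b"] exI[of _ "(Suc a mod m1, b)"]) (simp add: E_x11 act_fconst)
    next
      case X21
      show ?thesis
      proof (cases "b = m2 - 1")
        case True
        then have "E a (Suc b) = inverse \<beta> ^ (a * m2) \<rhd> E a 0" using E_per2[of a 0] m2_pos by simp
        then show ?thesis using X21 ab True m2_pos EC
          by (intro exI[of _ "\<mu>2 * inverse \<beta> ^ (a * m2)"] exI[of _ "(a, 0)"]) (simp add: E_x21 act_fconst)
      next
        case False
        then show ?thesis using X21 ab
          by (intro exI[of _ \<mu>2] exI[of _ "(a, Suc b)"]) (auto simp add: E_x21 act_fconst)
      qed
    next
      case X12
      show ?thesis
      proof (cases b)
        case 0
        \<comment> \<open>Row 0 is treated as row \<open>m2\<close>, where \<open>E_x12\<close>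
          applies; dividing by the wrap-around factor \<beta>^(-a m2) gives the power of \<beta> in
          the definition of \<open>V1\<close>.\<close>
        have "E a m2 \<bullet> x12 = (inverse \<mu>2 * \<mu>3 * P ^ a) \<rhd> E a (m2 - 1)"
          using E_x12[of a "m2 - 1"] m2_pos Q by simp
        moreover have "E a m2 = inverse \<beta> ^ (a * m2) \<rhd> E a 0" using E_per2[of a 0] by simp
        ultimately have "inverse \<beta> ^ (a * m2) \<rhd> (E a 0 \<bullet> x12) = (inverse \<mu>2 * \<mu>3 * P ^ a) \<rhd> E a (m2 - 1)"
          using EC by simp
        then have "E a 0 \<bullet> x12 = inverse (inverse \<beta> ^ (a * m2)) \<rhd> (inverse \<mu>2 * \<mu>3 * P ^ a) \<rhd> E a (m2 - 1)"
          using sm_cancel[of "E a 0 \<bullet> x12" "inverse \<beta> ^ (a * m2)"] EC by simp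
        then have "E a 0 \<bullet> x12 = (inverse \<mu>2 * \<mu>3 * \<beta> ^ (a * m2) * P ^ a) \<rhd> E a (m2 - 1)"
          using EC by (simp add: power_inverse mult_ac)
        then show ?thesis using X12 0 ab m2_pos
          by (intro exI[of _ "inverse \<mu>2 * \<mu>3 * \<beta> ^ (a * m2) * P ^ a"] exI[of _ "(a, m2 - 1)"])
            (simp add: act_fconst P_def)
      next
        case (Suc b')
        then show ?thesis using X12 ab
          by (intro exI[of _ "inverse \<mu>2 * \<mu>3 * Q ^ b * P ^ a"] exI[of _ "(a, b')"])
            (simp add: act_fconst P_def Q_def E_x12)
      qed
    next
      case X22
      have "E a b \<bullet> x22 = (inverse \<mu>1 * inverse \<alpha> ^ b * (\<mu>4 + \<beta> * P ^ a * \<mu>3)) \<rhd> E ((a + (m1 - 1)) mod m1) b"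
      proof (cases a)
        case 0
        \<comment> \<open>Index a = 0 is treated as \<open>m1\<close>. The formula
          \<open>E_x22\<close>, which is shifted by one, then yields the coefficient
          \<open>inverse \<alpha> * P ^ (m1 - 1)\<close> of \<open>\<mu>3\<close>, and this is the
          \<beta> that \<open>V1\<close> prescribes.\<close>
        have "P ^ (m1 - 1) = 1 / P" using P m1_pos by (simp add: P_def power_diff)
        then have "inverse \<alpha> * P ^ (m1 - Suc 0) = \<beta>" by (simp add: P_def field_simps)
        then show ?thesis using E_x22[of "m1 - 1" b] m1_pos E0[of b] 0 by simp
      next
        case (Suc a')
        have "(Suc a' + (m1 - 1)) mod m1 = a'" using ab(2) Suc by simp
        moreover have eq: "inverse \<alpha> * P ^ a' = \<beta> * P ^ a" by (simp add: Suc P_def)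
        ultimately show ?thesis using E_x22[of a' b, unfolded eq] Suc by simp
      qed
      then show ?thesis using X22 ab m1_pos
        by (intro exI[of _ "inverse \<mu>1 * inverse \<alpha> ^ b * (\<mu>4 + \<beta> * P ^ a * \<mu>3)"]
            exI[of _ "((a + (m1 - 1)) mod m1, b)"]) (simp add: act_fconst P_def)
    qed
  qed
  have "right_module_iso (M2 \<alpha> \<beta>) N (V1 \<alpha> \<beta> \<mu>1 \<mu>2 \<mu>3 \<mu>4)" unfolding V1_def
  proof (rule V.iso_V[OF _ simple _ _ _ hom])
    show "simple_right_module (M2 \<alpha> \<beta>) (basis_module m1 m2 ?T)"
      using V1_simple[OF nz] unfolding V1_def .
    show "(0, 0) \<in> {..<m1} \<times> {..<m2}" using m1_pos m2_pos by simp
    show "(\<lambda>(a, b). E a b) (0, 0) \<noteq> \<zero>" using v by (simp add: E_def)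
  qed (use EC in auto)
  then show ?thesis unfolding iso_to_V1_def using nz by blast
qed

text \<open>The vectors \<open>w b = v x21^b\<close> are killed by \<open>x11\<close>, so
  \<open>det\<close> acts on them as -\<open>Y\<close>/\<alpha>; this fixes the action of
  \<open>x11\<close> on the rows that \<open>x22\<close> builds above them. In
  (\<alpha>\<beta>)^(a+1) - 1 the power comes from \<beta>\<open>Y\<close> on row a and the -1 from
  \<open>det\<close>.\<close>

lemma highest_weight_relations:
  fixes v \<mu>1 \<mu>2 \<mu>3
  defines "E \<equiv> \<lambda>a b. (inverse \<mu>1 ^ a * inverse \<mu>2 ^ b) \<rhd> (v \<bullet> x21 ^ b \<bullet> x22 ^ a)"
  assumes v: "v \<in> carrier N" "v \<bullet> x11 = \<zero>" "v \<bullet> Y = \<mu>3 \<rhd> v" "v \<bullet> x21 ^ m2 = \<mu>2 ^ m2 \<rhd> v"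
    and nz: "\<mu>1 \<noteq> 0" "\<mu>2 \<noteq> 0"
  shows "E a b \<in> carrier N" and "E a (m2 + b) = E a b"
    and "E a b \<bullet> x22 = \<mu>1 \<rhd> E (Suc a) b"
    and "E a b \<bullet> x21 = (\<mu>2 * \<alpha> ^ a) \<rhd> E a (Suc b)"
    and "E a (Suc b) \<bullet> x12 = (inverse \<mu>2 * \<mu>3 * \<beta> ^ a * (inverse \<alpha> * \<beta>) ^ Suc b) \<rhd> E a b"
    and "E 0 b \<bullet> x11 = \<zero>"
    and "E (Suc a) b \<bullet> x11 =
      (inverse \<mu>1 * \<mu>3 * inverse \<alpha> * (inverse \<alpha> * \<beta>) ^ b * ((\<alpha> * \<beta>) ^ Suc a - 1)) \<rhd> E a b"
proof -
  define Q where "Q = inverse \<alpha> * \<beta>"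
  have [simp]: "\<mu>1 * (inverse \<mu>1 * x) = x" "\<mu>2 * (inverse \<mu>2 * x) = x" for x
    using nz by (simp_all flip: mult.assoc)
  define w where "w b = v \<bullet> x21 ^ b" for b
  have w: "w b \<in> carrier N" for b using v by (simp add: w_def)
  have E: "E a b = (inverse \<mu>1 ^ a * inverse \<mu>2 ^ b) \<rhd> (w b \<bullet> x22 ^ a)" for a b
    by (simp add: E_def w_def)
  show EC: "E a b \<in> carrier N" for a b using w by (simp add: E)
  have w_per: "w (m2 + b) = \<mu>2 ^ m2 \<rhd> w b" using v by (simp add: w_def power_add act_mult)
  show "E a (m2 + b) = E a b"
    using w nz by (simp add: E w_per power_add power_inverse) (simp add: field_simps)
  show "E a b \<bullet> x22 = \<mu>1 \<rhd> E (Suc a) b"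
    using w nz act_Suc[OF w, of b x22 a] by (simp add: E mult.assoc[symmetric])
  have "w b \<bullet> x22 ^ a \<bullet> x21 = \<alpha> ^ a \<rhd> (w b \<bullet> x21 \<bullet> x22 ^ a)" for a b
    by (rule qcommD[OF qcomm_power_left[OF qcomm_gens(2)] w])
  moreover have w_Suc: "w b \<bullet> x21 = w (Suc b)" for b using v by (simp only: w_def act_Suc)
  ultimately show E_x21: "E a b \<bullet> x21 = (\<mu>2 * \<alpha> ^ a) \<rhd> E a (Suc b)" for a b
    using w nz by (simp add: E mult_ac)
  have w_x11: "w b \<bullet> x11 = \<zero>" for b
    using qcommD[OF qcomm_power_left[OF qcomm_gens(3)] v(1), of b] v by (simp add: w_def)
  then show "E 0 b \<bullet> x11 = \<zero>" using w by (simp add: E)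
  have w_Y: "w b \<bullet> Y = (Q ^ b * \<mu>3) \<rhd> w b" for b
    using qcommD[OF qcomm_power_left[OF qcomm_Y(3)] v(1), of b] v by (simp add: w_def Q_def mult.commute)
  have w_det: "w b \<bullet> det = (- inverse \<alpha> * Q ^ b * \<mu>3) \<rhd> w b" for b
  proof -
    have "\<zero> = w b \<bullet> det \<oplus> inverse \<alpha> \<rhd> (w b \<bullet> Y)" using x11_x22[OF w, of b] w_x11 by simp
    then have "w b \<bullet> det = \<ominus> ((inverse \<alpha> * (Q ^ b * \<mu>3)) \<rhd> w b)" using w by (simp add: minus_equality w_Y)
    also have "\<dots> = (- (inverse \<alpha> * (Q ^ b * \<mu>3))) \<rhd> w b" using w F.act_uminus by simp
    finally show ?thesis by (simp add: mult.assoc)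
  qed
  have "w b \<bullet> x22 ^ Suc a \<bullet> x11 = ((inverse \<alpha> * ((\<alpha> * \<beta>) ^ Suc a - 1)) * Q ^ b * \<mu>3) \<rhd> (w b \<bullet> x22 ^ a)"
  proof -
    have "w b \<bullet> x22 ^ a \<bullet> det = w b \<bullet> det \<bullet> x22 ^ a"
      using qcommD[OF qcomm_power_right[OF qcomm_det(2)] w, of b a] w by simp
    moreover have "w b \<bullet> x22 ^ a \<bullet> Y = (\<alpha> * \<beta>) ^ a \<rhd> (w b \<bullet> Y \<bullet> x22 ^ a)"
      by (rule qcommD[OF qcomm_power_left[OF qcomm_Y(1)] w])
    ultimately have "w b \<bullet> x22 ^ a \<bullet> x22 \<bullet> x11 =
        (- inverse \<alpha> * Q ^ b * \<mu>3 + \<beta> * (\<alpha> * \<beta>) ^ a * Q ^ b * \<mu>3) \<rhd> (w b \<bullet> x22 ^ a)"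
      using w by (simp add: x22_x11 w_det w_Y add_sm[symmetric] mult_ac)
    also have "- inverse \<alpha> * Q ^ b * \<mu>3 + \<beta> * (\<alpha> * \<beta>) ^ a * Q ^ b * \<mu>3
        = (inverse \<alpha> * ((\<alpha> * \<beta>) ^ Suc a - 1)) * Q ^ b * \<mu>3"
      by (simp add: field_simps)
    finally show ?thesis by (simp only: act_Suc w)
  qed
  then show "E (Suc a) b \<bullet> x11 =
      (inverse \<mu>1 * \<mu>3 * inverse \<alpha> * (inverse \<alpha> * \<beta>) ^ b * ((\<alpha> * \<beta>) ^ Suc a - 1)) \<rhd> E a b"
    using w by (simp add: E Q_def mult_ac)
  have "w b \<bullet> x22 ^ a \<bullet> x12 = \<beta> ^ a \<rhd> (w b \<bullet> x12 \<bullet> x22 ^ a)" for b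
    by (rule qcommD[OF qcomm_power_left[OF qcomm_gens(4)] w])
  moreover have "w (Suc b) \<bullet> x12 = (Q ^ Suc b * \<mu>3) \<rhd> w b"
    unfolding w_Suc[symmetric] using qcommD[OF qcomm_gens(5) w, of b] w w_Y[of b]
    by (simp add: act_mult Q_def mult_ac)
  ultimately show "E a (Suc b) \<bullet> x12 = (inverse \<mu>2 * \<mu>3 * \<beta> ^ a * (inverse \<alpha> * \<beta>) ^ Suc b) \<rhd> E a b"
    using w by (simp add: E Q_def mult_ac)
qed

text \<open>The kernel of \<open>x11\<close> is stable under each of the three operators:
  \<open>x22 ^ m1\<close> commutes with \<open>x11\<close> because \<open>l\<close> divides
  \<open>m1\<close>, the others do so up to a scalar. The eigenvalue \<open>\<nu>\<close> may
  vanish, while the other two cannot, since \<open>x12\<close> and \<open>x21\<close> are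
  injective.\<close>

lemma highest_weight_eigenvector:
  assumes v0: "v0 \<in> carrier N" "v0 \<noteq> \<zero>" "v0 \<bullet> x11 = \<zero>"
  shows "\<exists>v \<mu>2 \<mu>3 \<nu>. v \<in> carrier N \<and> v \<noteq> \<zero> \<and> v \<bullet> x11 = \<zero> \<and> \<mu>2 \<noteq> 0 \<and> \<mu>3 \<noteq> 0 \<and> v \<bullet> Y = \<mu>3 \<rhd> v \<and>
    v \<bullet> x21 ^ m2 = \<mu>2 ^ m2 \<rhd> v \<and> v \<bullet> x22 ^ m1 = \<nu> \<rhd> v"
proof -
  obtain n where n: "n > 0" "\<alpha> ^ n = 1" "\<beta> ^ n = 1" by (rule common_period)
  have sc: "\<forall>g\<in>{x12, x21, x22}. scalar (g ^ n)" using v0 n by (rule scalar_powers_x11_ker)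
  have ratio: "(\<alpha> * inverse \<beta>) ^ m2 = 1" "(\<beta> * inverse \<alpha>) ^ m2 = 1"
    using \<alpha>_power_m2 by (simp_all add: power_mult_distrib power_inverse)
  define W where "W = {m \<in> carrier N. m \<bullet> x11 = \<zero>}"
  have comm: "qcomm 1 Y (x21 ^ m2)" "qcomm 1 Y (x22 ^ m1)" "qcomm 1 (x21 ^ m2) (x22 ^ m1)"
  proof -
    show "qcomm 1 Y (x21 ^ m2)" using qcomm_Y'(3) ratio(1) by (rule qcomm_power_period')
    have "inverse (\<alpha> * \<beta>) ^ m1 = 1" using \<alpha>\<beta>_power_m1 by (simp only: power_inverse) simp
    then show "qcomm 1 Y (x22 ^ m1)" using qcomm_Y'(1) by (intro qcomm_power_period')
    show "qcomm 1 (x21 ^ m2) (x22 ^ m1)"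
      using qcomm_power[OF qcomm_gens'(2), of m2 m1] \<alpha>_power_m12 by (simp add: power_inverse mult.commute)
  qed
  have stable: "\<exists>c. qcomm c f x11" if "f \<in> set [Y, x21 ^ m2, x22 ^ m1]" for f
    using that qcomm_Y'(2) qcomm_power_left[OF qcomm_gens(3), of m2]
      qcomm_x22_power_x11(1)[OF \<alpha>\<beta>_power_m1 m1_pos] by auto
  have "\<exists>v. v \<in> W \<and> v \<noteq> \<zero> \<and> (\<forall>f\<in>set [Y, x21 ^ m2, x22 ^ m1]. \<exists>c. v \<bullet> f = c \<rhd> v)"
  proof (rule joint_eigenvector[of _ _ v0 n])
    show "qcomm 1 f g" if "f \<in> set [Y, x21 ^ m2, x22 ^ m1]" "g \<in> set [Y, x21 ^ m2, x22 ^ m1]" for f g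
      using that comm comm[THEN qcomm_1_sym] qcomm_refl by auto
    have "scalar (Y ^ n)" using sc by (intro scalar_mult_power[OF qcomm_gens(5)]) auto
    then show "\<exists>c. \<forall>m\<in>carrier N. m \<bullet> f ^ n = c \<rhd> m" if "f \<in> set [Y, x21 ^ m2, x22 ^ m1]" for f
      unfolding scalar_def[symmetric] using that sc scalar_power_power by auto
    show "m \<bullet> f \<in> W" if f: "f \<in> set [Y, x21 ^ m2, x22 ^ m1]" and m: "m \<in> W" for f m
    proof -
      obtain c where "qcomm c f x11" using stable[OF f] by blast
      then have "m \<bullet> f \<bullet> x11 = c \<rhd> (m \<bullet> x11 \<bullet> f)" using m unfolding W_def by (intro qcommD) auto
      then show ?thesis using m by (simp add: W_def)
    qed
  qed (use v0 n in \<open>auto simp: W_def add_act\<close>)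
  then obtain v \<mu>3 \<nu>2 \<nu> where v: "v \<in> carrier N" "v \<bullet> x11 = \<zero>" "v \<noteq> \<zero>"
    and ev: "v \<bullet> Y = \<mu>3 \<rhd> v" "v \<bullet> x21 ^ m2 = \<nu>2 \<rhd> v" "v \<bullet> x22 ^ m1 = \<nu> \<rhd> v"
    by (auto simp: W_def)
  have "\<mu>3 \<noteq> 0" using Y_inj[OF v(1)] v ev by auto
  moreover have "\<nu>2 \<noteq> 0" using inj_power[of x21 v m2, OF x21_inj] v ev by auto
  moreover obtain \<mu>2 where \<mu>2: "\<mu>2 ^ m2 = \<nu>2" using nth_root_exists[OF m2_pos] by blast
  ultimately have nz: "\<mu>2 \<noteq> 0" "\<mu>3 \<noteq> 0" using m2_pos by auto
  then show ?thesis using v ev \<mu>2 by metis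
qed

text \<open>This covers \<open>V2\<close> and \<open>V3\<close> together. \<open>x22\<close> maps
  the top vector to \<open>\<mu>1 \<rhd> E n b\<close>, and
  \<open>\<kappa> * \<mu>1 ^ (n - 1)\<close> is the eigenvalue for which this is the return to the
  bottom row prescribed by \<open>hw_action\<close>.\<close>

lemma highest_weight_iso:
  assumes v: "v \<in> carrier N" "v \<noteq> \<zero>" "v \<bullet> x11 = \<zero>" "v \<bullet> Y = \<mu>3 \<rhd> v" "v \<bullet> x21 ^ m2 = \<mu>2 ^ m2 \<rhd> v"
    and nz: "\<mu>1 \<noteq> 0" "\<mu>2 \<noteq> 0" "\<mu>3 \<noteq> 0" and n: "\<kappa> = 0 \<and> n = l \<or> \<kappa> \<noteq> 0 \<and> n = m1"
    and top: "v \<bullet> x22 ^ n = (\<kappa> * \<mu>1 ^ (n - 1)) \<rhd> v"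
  shows "right_module_iso (M2 \<alpha> \<beta>) N (basis_module n m2 (hw_action \<alpha> \<beta> n \<mu>1 \<mu>2 \<mu>3 \<kappa>))"
proof -
  define E where "E a b = (inverse \<mu>1 ^ a * inverse \<mu>2 ^ b) \<rhd> (v \<bullet> x21 ^ b \<bullet> x22 ^ a)" for a b
  note E = highest_weight_relations[OF v(1,3,4,5) nz(1,2), folded E_def]
  have n_pos: "n > 0" using n l_pos m1_pos by auto
  have E_per: "\<mu>1 \<rhd> E n b = (\<kappa> * inverse \<alpha> ^ (b * n)) \<rhd> E 0 b" for b
  proof -
    obtain n' where n': "n = Suc n'" using n_pos by (cases n) auto
    have "v \<bullet> x21 ^ b \<bullet> x22 ^ n = inverse \<alpha> ^ (b * n) \<rhd> (v \<bullet> x22 ^ n \<bullet> x21 ^ b)"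
      by (rule qcommD[OF qcomm_power[OF qcomm_gens'(2)] v(1)])
    then have "\<mu>1 \<rhd> E n b = (\<mu>1 * (inverse \<mu>1 ^ n * inverse \<mu>2 ^ b) *
        (inverse \<alpha> ^ (b * n) * (\<kappa> * \<mu>1 ^ (n - 1)))) \<rhd> (v \<bullet> x21 ^ b)"
      using v(1) by (simp add: E_def top mult.assoc)
    also have "\<mu>1 * (inverse \<mu>1 ^ n * inverse \<mu>2 ^ b) * (inverse \<alpha> ^ (b * n) * (\<kappa> * \<mu>1 ^ (n - 1)))
        = \<kappa> * inverse \<alpha> ^ (b * n) * inverse \<mu>2 ^ b"
      using nz(1) by (simp add: n' power_inverse field_simps)
    finally show ?thesis using v(1) by (simp add: E_def)
  qed
  let ?T = "hw_action \<alpha> \<beta> n \<mu>1 \<mu>2 \<mu>3 \<kappa>"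
  interpret V: basis_action \<alpha> \<beta> n m2 ?T using nz(1,2) n by (rule basis_action_hw)
  define Q where "Q = inverse \<alpha> * \<beta>"
  have Q: "Q ^ m2 = 1" using \<alpha>_power_m2 by (simp add: Q_def power_mult_distrib power_inverse)
  have hom: "\<exists>c q. q \<in> {..<n} \<times> {..<m2} \<and> ?T g p = e_vec c q \<and>
      (\<lambda>(a, b). E a b) p \<bullet> fvar g = (\<lambda>(a, b). E a b) q \<bullet> fconst c"
    if "p \<in> {..<n} \<times> {..<m2}" for g p
  proof -
    obtain a b where ab: "p = (a, b)" "a < n" "b < m2" using \<open>p \<in> _\<close> by auto
    have E0: "E a m2 = E a 0" for a using E(2)[of a 0] by simp
    show ?thesis
    proof (cases g)
      case X11
      show ?thesis
      proof (cases a)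
        case 0
        \<comment> \<open>The image is zero; with coefficient 0 any index of the box serves as
          witness.\<close>
        then show ?thesis using X11 ab E(1) n_pos
          by (intro exI[of _ 0] exI[of _ "(a, b)"]) (simp add: E(6) act_fconst)
      next
        case (Suc a')
        then show ?thesis using X11 ab
          by (intro exI[of _ "inverse \<mu>1 * \<mu>3 * inverse \<alpha> * (inverse \<alpha> * \<beta>) ^ b * ((\<alpha> * \<beta>) ^ a - 1)"]
              exI[of _ "(a', b)"]) (simp add: E(7) act_fconst)
      qed
    next
      case X12
      have "E a b \<bullet> x12 = (inverse \<mu>2 * \<mu>3 * \<beta> ^ a * Q ^ b) \<rhd> E a ((b + (m2 - 1)) mod m2)"
      proof (cases b)
        case 0
        then show ?thesis using E(5)[of a "m2 - 1"] E0 m2_pos Q by (simp flip: Q_def)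
      next
        case (Suc b')
        then show ?thesis using E(5)[of a b'] ab by (simp flip: Q_def)
      qed
      then show ?thesis using X12 ab m2_pos
        by (intro exI[of _ "inverse \<mu>2 * \<mu>3 * \<beta> ^ a * Q ^ b"] exI[of _ "(a, (b + (m2 - 1)) mod m2)"])
          (simp add: act_fconst Q_def)
    next
      case X21
      have "E a (Suc b) = E a (Suc b mod m2)" using ab(3) E0 by (cases "Suc b = m2") auto
      then show ?thesis using X21 ab m2_pos
        by (intro exI[of _ "\<mu>2 * \<alpha> ^ a"] exI[of _ "(a, Suc b mod m2)"]) (simp add: E(4) act_fconst)
    next
      case X22
      show ?thesis
      proof (cases "a = n - 1")
        case True
        then show ?thesis using X22 ab n_pos E(1) E_per
          by (intro exI[of _ "\<kappa> * inverse \<alpha> ^ (b * n)"] exI[of _ "(0, b)"]) (simp add: E(3) act_fconst)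
      next
        case False
        then show ?thesis using X22 ab
          by (intro exI[of _ \<mu>1] exI[of _ "(Suc a, b)"]) (auto simp add: E(3) act_fconst)
      qed
    qed
  qed
  show ?thesis
  proof (rule V.iso_V[OF _ simple _ _ _ hom])
    show "simple_right_module (M2 \<alpha> \<beta>) (basis_module n m2 ?T)" using nz n by (rule hw_simple)
    show "(0, 0) \<in> {..<n} \<times> {..<m2}" using n_pos m2_pos by simp
    show "(\<lambda>(a, b). E a b) (0, 0) \<noteq> \<zero>" using v by (simp add: E_def)
  qed (use E(1) in auto)
qed

lemma V2_iso:
  assumes v0: "v0 \<in> carrier N" "v0 \<noteq> \<zero>" "v0 \<bullet> x11 = \<zero>"
    and inj: "\<And>m. m \<in> carrier N \<Longrightarrow> m \<bullet> x22 = \<zero> \<Longrightarrow> m = \<zero>"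
  shows "iso_to_V2 \<alpha> \<beta> N"
proof -
  obtain v \<mu>2 \<mu>3 \<nu> where v: "v \<in> carrier N" "v \<noteq> \<zero>" "v \<bullet> x11 = \<zero>" "v \<bullet> Y = \<mu>3 \<rhd> v"
      "v \<bullet> x21 ^ m2 = \<mu>2 ^ m2 \<rhd> v"
    and \<nu>: "v \<bullet> x22 ^ m1 = \<nu> \<rhd> v" and nz: "\<mu>2 \<noteq> 0" "\<mu>3 \<noteq> 0"
    using highest_weight_eigenvector[OF v0] by auto
  have "\<nu> \<noteq> 0" using inj_power[of x22 v m1, OF inj] v \<nu> by auto
  moreover obtain \<mu>1 where \<mu>1: "\<mu>1 ^ m1 = \<nu>" using nth_root_exists[OF m1_pos] by blast
  ultimately have \<mu>1_nz: "\<mu>1 \<noteq> 0" using m1_pos by auto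
  have "v \<bullet> x22 ^ m1 = (\<mu>1 * \<mu>1 ^ (m1 - 1)) \<rhd> v" using \<nu> \<mu>1 m1_pos by (simp flip: power_Suc)
  then have "right_module_iso (M2 \<alpha> \<beta>) N (V2 \<alpha> \<beta> \<mu>1 \<mu>2 \<mu>3)"
    unfolding V2_def V2_action_eq using v \<mu>1_nz nz by (intro highest_weight_iso) simp_all
  then show ?thesis unfolding iso_to_V2_def using nz \<mu>1_nz by blast
qed

lemma V3_iso:
  assumes v0: "v0 \<in> carrier N" "v0 \<noteq> \<zero>" "v0 \<bullet> x11 = \<zero>" and nil: "kills (x22 ^ l)"
  shows "iso_to_V3 \<alpha> \<beta> N"
proof -
  obtain v \<mu>2 \<mu>3 where v: "v \<in> carrier N" "v \<noteq> \<zero>" "v \<bullet> x11 = \<zero>" "v \<bullet> Y = \<mu>3 \<rhd> v"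
      "v \<bullet> x21 ^ m2 = \<mu>2 ^ m2 \<rhd> v" and nz: "\<mu>2 \<noteq> 0" "\<mu>3 \<noteq> 0"
    using highest_weight_eigenvector[OF v0] by auto
  \<comment> \<open>\<open>V3\<close> is the case \<open>\<kappa> = 0\<close>,
    \<open>\<mu>1 = 1\<close> of height \<open>l\<close>; its two parameters are the
    \<open>\<mu>2\<close> and \<open>\<mu>3\<close> of the general family.\<close>
  have "v \<bullet> x22 ^ l = (0 * 1 ^ (l - 1)) \<rhd> v" using nil v(1) by (simp add: kills_def)
  then have "right_module_iso (M2 \<alpha> \<beta>) N (V3 \<alpha> \<beta> \<mu>2 \<mu>3)"
    unfolding V3_def V3_action_eq using v nz by (intro highest_weight_iso) (simp_all only: refl one_neq_zero not_False_eq_True simp_thms)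
  then show ?thesis unfolding iso_to_V3_def using nz by blast
qed

section \<open>The alternatives for \<open>X11\<close> and \<open>X22\<close>\<close>

lemma power_l_kills_or_inj:
  assumes "f \<in> {x11, x22}"
  shows "kills (f ^ l) \<or> (\<forall>m\<in>carrier N. m \<bullet> f ^ l = \<zero> \<longrightarrow> m = \<zero>)"
proof (rule normal_kills_or_inj)
  note q = qcomm_x22_power_x11[OF \<alpha>\<beta>_power_l l_pos]
  fix g
  show "\<exists>c. c \<noteq> 0 \<and> qcomm c (f ^ l) (fvar g)"
  proof (cases "f = x22")
    case f: True
    show ?thesis
    proof (cases g)
      case X11
      show ?thesis unfolding f X11 using q(1) by (intro exI[of _ 1]) simp
    next
      case X12
      show ?thesis unfolding f X12 using qcomm_power_left[OF qcomm_gens(4)] by (intro exI[of _ "\<beta> ^ l"]) simp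
    next
      case X21
      show ?thesis unfolding f X21 using qcomm_power_left[OF qcomm_gens(2)] by (intro exI[of _ "\<alpha> ^ l"]) simp
    next
      case X22
      show ?thesis unfolding f X22 using qcomm_power_left[OF qcomm_refl[of x22], of l] by (intro exI[of _ 1]) simp
    qed
  next
    case False
    then have f: "f = x11" using assms by blast
    show ?thesis
    proof (cases g)
      case X11
      show ?thesis unfolding f X11 using qcomm_power_left[OF qcomm_refl[of x11], of l] by (intro exI[of _ 1]) simp
    next
      case X12
      show ?thesis unfolding f X12 using qcomm_power_left[OF qcomm_gens'(1)] by (intro exI[of _ "inverse \<alpha> ^ l"]) simp
    next
      case X21
      show ?thesis unfolding f X21 using qcomm_power_left[OF qcomm_gens'(3)] by (intro exI[of _ "inverse \<beta> ^ l"]) simp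
    next
      case X22
      show ?thesis unfolding f X22 using q(2) by (intro exI[of _ 1]) simp
    qed
  qed
qed

text \<open>A vector killed by \<open>f\<close> is killed by \<open>f ^ l\<close>, so on a simple
  module failure of torsionfreeness forces \<open>f ^ l\<close> to act as zero. For
  \<open>x22\<close> this is the nilpotency that the height \<open>l\<close> of \<open>V3\<close>
  requires.\<close>

lemma torsionfree_or_kills:
  assumes "f \<in> {x11, x22}"
  shows "torsionfree (M2 \<alpha> \<beta>) N (M2_class \<alpha> \<beta> f) \<or> kills (f ^ l)"
proof (rule disjCI)
  assume nk: "\<not> kills (f ^ l)"
  show "torsionfree (M2 \<alpha> \<beta>) N (M2_class \<alpha> \<beta> f)" unfolding torsionfree_iff
  proof (intro ballI impI)
    fix m assume m: "m \<in> carrier N" "m \<bullet> f = \<zero>"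
    obtain j where j: "l = Suc j" using l_pos by (cases l) auto
    have "m \<bullet> f ^ l = m \<bullet> f \<bullet> f ^ j" unfolding j using m(1) by (simp add: act_mult)
    then have "m \<bullet> f ^ l = \<zero>" using m by simp
    with power_l_kills_or_inj[OF assms] nk m(1) show "m = \<zero>" by (elim disjE) (erule notE, assumption, drule bspec, assumption, erule mp, assumption)
  qed
qed

lemma torsion_imp_not_torsionfree:
  assumes "torsion (M2 \<alpha> \<beta>) N x" shows "\<not> torsionfree (M2 \<alpha> \<beta>) N x"
proof
  assume tf: "torsionfree (M2 \<alpha> \<beta>) N x"
  obtain m where m: "m \<in> carrier N" "m \<noteq> \<zero>" using carrier_nontrivial by blast
  have "(\<exists>k::nat. m \<star> (x [^]\<^bsub>M2 \<alpha> \<beta>\<^esub> k) = \<zero>) \<longrightarrow> m = \<zero>"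
    using tf m(1) unfolding torsionfree_def by (rule bspec)
  moreover have "\<exists>k::nat. m \<star> (x [^]\<^bsub>M2 \<alpha> \<beta>\<^esub> k) = \<zero>"
    using assms m(1) unfolding torsion_def by (rule bspec)
  ultimately show False using m(2) by (elim notE mp)
qed

lemma x11_kernel:
  assumes "\<not> torsionfree (M2 \<alpha> \<beta>) N (M2_gen \<alpha> \<beta> X11)"
  obtains v where "v \<in> carrier N" "v \<noteq> \<zero>" "v \<bullet> x11 = \<zero>"
proof -
  have "\<exists>v\<in>carrier N. v \<bullet> x11 = \<zero> \<and> v \<noteq> \<zero>"
    using assms unfolding M2_gen_def torsionfree_iff by simp
  then show ?thesis using that by auto
qed

text \<open>The cases are phrased by negated torsionfreeness, which on a nonzero module follows from
  torsion. So they exhaust all possibilities and also yield the disjunction in the theorem.\<close>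

lemma classification:
  "torsionfree (M2 \<alpha> \<beta>) N (M2_gen \<alpha> \<beta> X11) \<Longrightarrow> iso_to_V1 \<alpha> \<beta> N"
  "\<not> torsionfree (M2 \<alpha> \<beta>) N (M2_gen \<alpha> \<beta> X11) \<Longrightarrow> torsionfree (M2 \<alpha> \<beta>) N (M2_gen \<alpha> \<beta> X22) \<Longrightarrow>
    iso_to_V2 \<alpha> \<beta> N"
  "\<not> torsionfree (M2 \<alpha> \<beta>) N (M2_gen \<alpha> \<beta> X11) \<Longrightarrow> \<not> torsionfree (M2 \<alpha> \<beta>) N (M2_gen \<alpha> \<beta> X22) \<Longrightarrow>
    iso_to_V3 \<alpha> \<beta> N"
proof -
  assume tf: "torsionfree (M2 \<alpha> \<beta>) N (M2_gen \<alpha> \<beta> X11)"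
  show "iso_to_V1 \<alpha> \<beta> N" by (rule V1_iso) (rule torsionfreeD[OF tf[unfolded M2_gen_def]])
next
  assume "\<not> torsionfree (M2 \<alpha> \<beta>) N (M2_gen \<alpha> \<beta> X11)"
  then obtain v where v: "v \<in> carrier N" "v \<noteq> \<zero>" "v \<bullet> x11 = \<zero>" by (rule x11_kernel)
  show "iso_to_V2 \<alpha> \<beta> N" if "torsionfree (M2 \<alpha> \<beta>) N (M2_gen \<alpha> \<beta> X22)"
    using v by (rule V2_iso) (rule torsionfreeD[OF that[unfolded M2_gen_def]])
  show "iso_to_V3 \<alpha> \<beta> N" if "\<not> torsionfree (M2 \<alpha> \<beta>) N (M2_gen \<alpha> \<beta> X22)"
    using v by (rule V3_iso) (use that torsionfree_or_kills[of x22] in \<open>simp add: M2_gen_def\<close>)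
qed

end

theorem theorem6p1:
  fixes \<alpha> \<beta> :: "'k::alg_closed_field"
  assumes "\<alpha> \<noteq> 0" and "\<exists>n>0. \<alpha> ^ n = 1"
    and "\<beta> \<noteq> 0" and "\<exists>n>0. \<beta> ^ n = 1"
    and "\<alpha> * \<beta> \<noteq> 1"
  shows
    "(\<forall>\<mu>1 \<mu>2 \<mu>3 \<mu>4. \<mu>1 \<noteq> 0 \<and> \<mu>2 \<noteq> 0 \<and> \<mu>3 \<noteq> 0 \<and> \<mu>4 \<noteq> 0 \<longrightarrow>
        simple_right_module (M2 \<alpha> \<beta>) (V1 \<alpha> \<beta> \<mu>1 \<mu>2 \<mu>3 \<mu>4)) \<and>
     (\<forall>\<mu>1 \<mu>2 \<mu>3. \<mu>1 \<noteq> 0 \<and> \<mu>2 \<noteq> 0 \<and> \<mu>3 \<noteq> 0 \<longrightarrow>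
        simple_right_module (M2 \<alpha> \<beta>) (V2 \<alpha> \<beta> \<mu>1 \<mu>2 \<mu>3)) \<and>
     (\<forall>\<mu>1 \<mu>2. \<mu>1 \<noteq> 0 \<and> \<mu>2 \<noteq> 0 \<longrightarrow>
        simple_right_module (M2 \<alpha> \<beta>) (V3 \<alpha> \<beta> \<mu>1 \<mu>2)) \<and>
     (\<forall>N :: ('k falg set, 'n) rmodule.
        simple_right_module (M2 \<alpha> \<beta>) N \<and>
        torsionfree (M2 \<alpha> \<beta>) N (M2_gen \<alpha> \<beta> X12) \<and>
        torsionfree (M2 \<alpha> \<beta>) N (M2_gen \<alpha> \<beta> X21) \<and>
        torsionfree (M2 \<alpha> \<beta>) N (M2_det \<alpha> \<beta>) \<longrightarrow>
        (iso_to_V1 \<alpha> \<beta> N \<or> iso_to_V2 \<alpha> \<beta> N \<or> iso_to_V3 \<alpha> \<beta> N) \<and>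
        (torsionfree (M2 \<alpha> \<beta>) N (M2_gen \<alpha> \<beta> X11) \<longrightarrow> iso_to_V1 \<alpha> \<beta> N) \<and>
        (torsion (M2 \<alpha> \<beta>) N (M2_gen \<alpha> \<beta> X11) \<and>
         torsionfree (M2 \<alpha> \<beta>) N (M2_gen \<alpha> \<beta> X22) \<longrightarrow> iso_to_V2 \<alpha> \<beta> N) \<and>
        (torsion (M2 \<alpha> \<beta>) N (M2_gen \<alpha> \<beta> X11) \<and>
         torsion (M2 \<alpha> \<beta>) N (M2_gen \<alpha> \<beta> X22) \<longrightarrow> iso_to_V3 \<alpha> \<beta> N))"
proof -
  interpret roots_of_unity \<alpha> \<beta> using assms by unfold_locales
  have "(iso_to_V1 \<alpha> \<beta> N \<or> iso_to_V2 \<alpha> \<beta> N \<or> iso_to_V3 \<alpha> \<beta> N) \<and>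
        (torsionfree (M2 \<alpha> \<beta>) N (M2_gen \<alpha> \<beta> X11) \<longrightarrow> iso_to_V1 \<alpha> \<beta> N) \<and>
        (torsion (M2 \<alpha> \<beta>) N (M2_gen \<alpha> \<beta> X11) \<and>
         torsionfree (M2 \<alpha> \<beta>) N (M2_gen \<alpha> \<beta> X22) \<longrightarrow> iso_to_V2 \<alpha> \<beta> N) \<and>
        (torsion (M2 \<alpha> \<beta>) N (M2_gen \<alpha> \<beta> X11) \<and>
         torsion (M2 \<alpha> \<beta>) N (M2_gen \<alpha> \<beta> X22) \<longrightarrow> iso_to_V3 \<alpha> \<beta> N)"
    if N: "simple_right_module (M2 \<alpha> \<beta>) N" "torsionfree (M2 \<alpha> \<beta>) N (M2_gen \<alpha> \<beta> X12)"
      "torsionfree (M2 \<alpha> \<beta>) N (M2_gen \<alpha> \<beta> X21)" "torsionfree (M2 \<alpha> \<beta>) N (M2_det \<alpha> \<beta>)"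
    for N :: "('k falg set, 'n) rmodule"
  proof -
    interpret simple_M2_module \<alpha> \<beta> N using N by unfold_locales
    note not_tf = torsion_imp_not_torsionfree
    show ?thesis
    proof (intro conjI impI)
      show "iso_to_V1 \<alpha> \<beta> N \<or> iso_to_V2 \<alpha> \<beta> N \<or> iso_to_V3 \<alpha> \<beta> N"
        by (cases "torsionfree (M2 \<alpha> \<beta>) N (M2_gen \<alpha> \<beta> X11)"; cases "torsionfree (M2 \<alpha> \<beta>) N (M2_gen \<alpha> \<beta> X22)")
          (simp_all add: classification)
    qed (simp_all add: classification not_tf)
  qed
  then show ?thesis by (simp add: V1_simple V2_simple V3_simple)
qed

end
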